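(* Let $x=j(\tau)$ and $y=j(\tau')$ be two singular moduli of respective discriminants $\Delta$ and $\Delta'$, and let $m,n$ be positive integers. If $\{\Delta,\Delta'\}=\{-4\cdot 23,-23\}$ or $\{\Delta,\Delta'\}=\{-4\cdot 31,-31\}$, then the three numbers $1, x^m, y^n$ are linearly independent over $\mathbb{Q}$.
   Context: Let $j$ denote the classical modular $j$-invariant on the upper half-plane $\mathbb{H}=\{z\in\mathbb{C}:\operatorname{Im} z>0\}$. A singular modulus is a number of the form $j(\tau)$ where $\tau\in\mathbb{H}$ is an algebraic number of degree $2$ over $\mathbb{Q}$. Its discriminant is the discriminant $b^2-4ac$ of the minimal polynomial $aX^2+bX+c\in\mathbb{Z}[X]$ of $\tau$ over $\mathbb{Z}$ (with $a>0$ and $\gcd(a,b,c)=1$). *)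

theory Defs
  imports "HOL-Complex_Analysis.Complex_Analysis" "HOL-Computational_Algebra.Computational_Algebra"
begin

text \<open>Eisenstein series of the lattice \<open>\<int> + \<int> \<tau>\<close>. For \<open>k \<ge> 3\<close> and \<open>Im \<tau> > 0\<close> the family is
  absolutely summable, so the unordered sum is the classical one.\<close>

definition eisenstein_G :: "nat \<Rightarrow> complex \<Rightarrow> complex" where
  "eisenstein_G k \<tau> =
     (\<Sum>\<^sub>\<infinity>(m, n) \<in> (UNIV :: (int \<times> int) set) - {(0, 0)}. 1 / (of_int m + of_int n * \<tau>) ^ k)"

definition weierstrass_g2 :: "complex \<Rightarrow> complex" where
  "weierstrass_g2 \<tau> = 60 * eisenstein_G 4 \<tau>"

definition weierstrass_g3 :: "complex \<Rightarrow> complex" where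
  "weierstrass_g3 \<tau> = 140 * eisenstein_G 6 \<tau>"

text \<open>Normalised so that \<open>j \<tau> = 1/q + 744 + O(q)\<close> with \<open>q = exp (2 \<pi> \<i> \<tau>)\<close>; only meaningful
  for \<open>Im \<tau> > 0\<close>, where the denominator does not vanish.\<close>

definition modular_j :: "complex \<Rightarrow> complex" where
  "modular_j \<tau> =
     1728 * weierstrass_g2 \<tau> ^ 3 / (weierstrass_g2 \<tau> ^ 3 - 27 * weierstrass_g3 \<tau> ^ 2)"

text \<open>The minimal polynomial over \<open>\<int>\<close> is the primitive integer polynomial with positive leading
  coefficient and least degree that vanishes at the number; its degree is the degree over \<open>\<rat>\<close>.\<close>

definition is_min_int_poly :: "int poly \<Rightarrow> complex \<Rightarrow> bool" where
  "is_min_int_poly p z \<longleftrightarrow>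
     poly (map_poly of_int p) z = 0 \<and> lead_coeff p > 0 \<and> content p = 1 \<and>
     (\<forall>q. q \<noteq> 0 \<and> poly (map_poly of_int q) z = 0 \<longrightarrow> degree p \<le> degree q)"

definition quadratic_with_discriminant :: "complex \<Rightarrow> int \<Rightarrow> bool" where
  "quadratic_with_discriminant \<tau> D \<longleftrightarrow>
     (\<exists>a b c. a \<noteq> 0 \<and> is_min_int_poly [:c, b, a:] \<tau> \<and> D = b\<^sup>2 - 4 * a * c)"

definition is_singular_modulus_at :: "complex \<Rightarrow> complex \<Rightarrow> int \<Rightarrow> bool" where
  "is_singular_modulus_at x \<tau> D \<longleftrightarrow>
     Im \<tau> > 0 \<and> quadratic_with_discriminant \<tau> D \<and> x = modular_j \<tau>"

global_interpretation rat_complex: vector_space "\<lambda>(q :: rat) (z :: complex). of_rat q * z"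
  by unfold_locales (simp_all add: algebra_simps of_rat_add of_rat_mult)

text \<open>Independence of a family rather than of a set: repeated entries make the list dependent.\<close>

definition rat_lin_independent :: "complex list \<Rightarrow> bool" where
  "rat_lin_independent vs \<longleftrightarrow> distinct vs \<and> rat_complex.independent (set vs)"

end

theory Submission imports Defs begin

text \<open>
  A lattice of discriminant \<open>-23\<close> or \<open>-31\<close> is \<open>2\<close>-isogenous to the two other classes of the same
  discriminant and to one lattice of four times that discriminant. So the three singular moduli
  \<open>x\<^sub>1, x\<^sub>2, x\<^sub>3\<close> of the odd discriminant are pairwise related by the modular polynomial of level \<open>2\<close>,
  and the third root of that polynomial over \<open>x\<^sub>i\<close> is the singular modulus
  \<open>y\<^sub>i = x\<^sub>i\<^sup>2 - 1487 x\<^sub>i + 162000 - (x\<^sub>1 + x\<^sub>2 + x\<^sub>3)\<close> of the even discriminant. The \<open>x\<^sub>i\<close> are distinct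
  because \<open>j\<close> separates homothety classes of lattices, and three distinct pairwise related numbers can
  only be the roots of one of two explicit cubics. Both cubics are treated alike, so one never has to
  decide numerically which one belongs to which discriminant.

  The exponents are handled at the prime \<open>17\<close>. Put \<open>z\<^sub>i = (y\<^sub>i - 8) / 17\<close>. Then \<open>1, x\<^sub>i, z\<^sub>i\<close> is a basis of
  an order in which \<open>x\<^sub>i\<^sup>2\<close> is congruent to \<open>8 x\<^sub>i\<close> modulo \<open>17\<close>. Modulo the constants, \<open>x\<^sub>i\<^sup>m\<close> therefore
  points in the direction of \<open>x\<^sub>i\<close> modulo \<open>17\<close>, while \<open>y\<^sub>i\<^sup>n = (8 + 17 z\<^sub>i)\<^sup>n\<close> is a power of \<open>17\<close> times
  a vector in the direction of \<open>z\<^sub>i\<close> modulo \<open>17\<close>. The two are never proportional.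
\<close>

section \<open>The Weierstrass function of a lattice\<close>

text \<open>Nothing about \<open>j\<close> is taken from q-expansions. That \<open>j\<close>
  separates homothety classes rests on recovering a lattice from its Eisenstein sums of weights 4
  and 6: the Weierstrass function solves a differential equation with these sums as coefficients,
  and its poles are the lattice. The relation of level 2 comes from the values of the same function
  at the half-periods.

  The arithmetic has to exclude a relation for all pairs of exponents at once, so it needs a prime
  at which every power of \<open>x\<close> keeps one direction and every power of \<open>y\<close>
  another. The prime 17 serves both cubics because in both of them the coefficient 1487 and the
  constant term of \<open>y\<close> as a polynomial in \<open>x\<close> are 8 modulo 17. Hence
  \<open>y - 8\<close> is \<open>x^2 - 8 x\<close> up to multiples of 17 in
  \<open>\<int>[x]\<close>, and dividing it by 17 still gives an integral element. That single
  divisibility yields both the enlarged order and the congruence that controls the powers of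
  \<open>x\<close>.\<close>

lemma infsum_has_field_derivative:
  fixes f f' :: "'a \<Rightarrow> complex \<Rightarrow> complex"
  assumes deriv: "\<And>w z. w \<in> A \<Longrightarrow> z \<in> ball z0 r \<Longrightarrow> (f w has_field_derivative f' w z) (at z)"
    and bound: "\<And>w z. w \<in> A \<Longrightarrow> z \<in> ball z0 r \<Longrightarrow> norm (f w z) \<le> M w"
    and summable: "M summable_on A" and "r > 0"
  shows "((\<lambda>z. \<Sum>\<^sub>\<infinity>w\<in>A. f w z) has_field_derivative (\<Sum>\<^sub>\<infinity>w\<in>A. f' w z0)) (at z0)"
proof -
  let ?F = "finite_subsets_at_top A"
  have sub: "cball z0 (r/2) \<subseteq> ball z0 r" "ball z0 (r/2) \<subseteq> ball z0 r"
    using \<open>r > 0\<close> by auto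
  have ulim: "uniform_limit (cball z0 (r/2)) (\<lambda>X z. \<Sum>w\<in>X. f w z) (\<lambda>z. \<Sum>\<^sub>\<infinity>w\<in>A. f w z) ?F"
    by (rule Weierstrass_m_test_general[OF _ summable]) (use bound sub in blast)
  have "eventually (\<lambda>X. continuous_on (cball z0 (r/2)) (\<lambda>z. \<Sum>w\<in>X. f w z) \<and>
          (\<forall>z\<in>ball z0 (r/2). ((\<lambda>z. \<Sum>w\<in>X. f w z) has_field_derivative (\<Sum>w\<in>X. f' w z)) (at z))) ?F"
    unfolding eventually_finite_subsets_at_top
  proof (intro exI[of _ "{}"] conjI allI impI ballI)
    fix X assume X: "finite X \<and> {} \<subseteq> X \<and> X \<subseteq> A"
    have D: "((\<lambda>z. \<Sum>w\<in>X. f w z) has_field_derivative (\<Sum>w\<in>X. f' w z)) (at z)" if "z \<in> ball z0 r" for z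
      by (rule DERIV_sum) (use X deriv that in auto)
    show "continuous_on (cball z0 (r/2)) (\<lambda>z. \<Sum>w\<in>X. f w z)"
      by (intro continuous_at_imp_continuous_on ballI DERIV_isCont[OF D]) (use sub in auto)
    show "((\<lambda>z. \<Sum>w\<in>X. f w z) has_field_derivative (\<Sum>w\<in>X. f' w z)) (at z)" if "z \<in> ball z0 (r/2)" for z
      by (rule D) (use that sub in auto)
  qed auto
  \<comment> \<open>Uniform limits of holomorphic functions may be differentiated termwise, so
    dominating the terms already controls their derivatives.\<close>
  from has_complex_derivative_uniform_limit[OF this ulim] \<open>r > 0\<close>
  obtain g' where g': "\<And>z. z \<in> ball z0 (r/2) \<Longrightarrow>
      ((\<lambda>z. \<Sum>\<^sub>\<infinity>w\<in>A. f w z) has_field_derivative g' z) (at z) \<and>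
      ((\<lambda>X. \<Sum>w\<in>X. f' w z) \<longlongrightarrow> g' z) ?F"
    by auto
  from g'[of z0] \<open>r > 0\<close> have "((\<lambda>w. f' w z0) has_sum g' z0) A"
    by (simp add: has_sum_def)
  with g'[of z0] \<open>r > 0\<close> show ?thesis
    by (simp add: infsumI)
qed

section \<open>Discreteness of a period lattice and domination of lattice sums\<close>

lemma summable_on_imp_finite_ge:
  fixes f :: "'a \<Rightarrow> real"
  assumes "f summable_on A" "\<And>x. x \<in> A \<Longrightarrow> f x \<ge> 0" "t > 0"
  shows "finite {x \<in> A. f x \<ge> t}"
proof (rule ccontr)
  assume inf: "infinite {x \<in> A. f x \<ge> t}"
  obtain n :: nat where n: "real n * t > infsum f A"
    using assms(3) reals_Archimedean3 by blast
  from infinite_arbitrarily_large[OF inf, of n] obtain X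
    where X: "finite X" "card X = n" "X \<subseteq> {x \<in> A. f x \<ge> t}" by auto
  have "real n * t \<le> sum f X"
    using sum_bounded_below[of X t f] X by auto
  also have "\<dots> \<le> infsum f A"
    by (rule finite_sum_le_infsum) (use X assms in auto)
  finally show False using n by simp
qed

text \<open>The axioms are the analytic facts that the theory consumes, not a choice of basis:
  summability gives discreteness and convergence from weight 3 on, \<open>covering\<close> stands
  for a bounded fundamental region. The summand 1 in the denominator keeps the lattice point 0
  harmless.\<close>

locale period_lattice =
  fixes L :: "complex set"
  assumes zero [simp]: "0 \<in> L"
    and diff: "x \<in> L \<Longrightarrow> y \<in> L \<Longrightarrow> x - y \<in> L"
    and summable: "(\<lambda>w. 1 / (1 + norm w) ^ 3) summable_on L"
    and covering: "\<exists>R. \<forall>z. \<exists>w\<in>L. norm (z - w) \<le> R"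

definition weierstrass_p :: "complex set \<Rightarrow> complex \<Rightarrow> complex" where
  "weierstrass_p L z = 1 / z ^ 2 + (\<Sum>\<^sub>\<infinity>w\<in>L - {0}. 1 / (z - w) ^ 2 - 1 / w ^ 2)"

text \<open>For \<open>k >= 3\<close> this is the derivative of order \<open>k - 2\<close> of the
  Weierstrass function, divided by \<open>(-1)^k (k - 1)!\<close>. All derivatives are handled
  through these sums, whose periodicity is a mere reindexing.\<close>

definition pole_sum :: "complex set \<Rightarrow> nat \<Rightarrow> complex \<Rightarrow> complex" where
  "pole_sum L k z = (\<Sum>\<^sub>\<infinity>w\<in>L. 1 / (z - w) ^ k)"

definition lattice_G :: "complex set \<Rightarrow> nat \<Rightarrow> complex" where
  "lattice_G L k = (\<Sum>\<^sub>\<infinity>w\<in>L - {0}. 1 / w ^ k)"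

context period_lattice
begin

lemma uminus: "x \<in> L \<Longrightarrow> - x \<in> L"
  using diff[of 0 x] by simp

lemma add: "x \<in> L \<Longrightarrow> y \<in> L \<Longrightarrow> x + y \<in> L"
  using diff[of x "- y"] uminus[of y] by simp

lemma uminus_iff [simp]: "- x \<in> L \<longleftrightarrow> x \<in> L"
  using uminus[of x] uminus[of "-x"] by auto

lemma add_right_iff [simp]: "y \<in> L \<Longrightarrow> x + y \<in> L \<longleftrightarrow> x \<in> L"
  using add[of x y] diff[of "x + y" y] by auto

lemma add_left_iff [simp]: "y \<in> L \<Longrightarrow> y + x \<in> L \<longleftrightarrow> x \<in> L"
  using add_right_iff[of y x] by (simp add: add.commute)

lemma diff_right_iff [simp]: "y \<in> L \<Longrightarrow> x - y \<in> L \<longleftrightarrow> x \<in> L"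
  using add_right_iff[of "-y" x] by simp

text \<open>Every lattice point of the disc contributes at least a fixed amount to a convergent sum
  of nonnegative terms.\<close>

lemma finite_ball: "finite {w \<in> L. norm w \<le> r}"
proof (rule finite_subset)
  show "finite {w \<in> L. 1 / (1 + norm w) ^ 3 \<ge> 1 / (1 + max r 0) ^ 3}"
    by (rule summable_on_imp_finite_ge[OF summable]) simp_all
  show "{w \<in> L. norm w \<le> r} \<subseteq> {w \<in> L. 1 / (1 + norm w) ^ 3 \<ge> 1 / (1 + max r 0) ^ 3}"
  proof clarify
    fix w :: complex assume "norm w \<le> r"
    then have "(1 + norm w) ^ 3 \<le> (1 + max r 0) ^ 3"
      by (intro power_mono) simp_all
    moreover have "0 < (1 + norm w) ^ 3"
      by (simp add: add_pos_nonneg)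
    ultimately show "1 / (1 + max r 0) ^ 3 \<le> 1 / (1 + norm w) ^ 3"
      by (intro divide_left_mono mult_pos_pos) simp_all
  qed
qed

lemma finite_Int_cball: "finite (L \<inter> cball z r)"
proof (rule finite_subset[OF _ finite_ball[of "norm z + r"]])
  show "L \<inter> cball z r \<subseteq> {w \<in> L. norm w \<le> norm z + r}"
  proof clarsimp
    fix w assume "dist z w \<le> r"
    then show "norm w \<le> norm z + r"
      using norm_triangle_ineq2[of w z] by (simp add: dist_norm norm_minus_commute)
  qed
qed

lemma countable: "countable L"
proof -
  have "L = (\<Union>n::nat. {w \<in> L. norm w \<le> real n})"
    using real_arch_simple by auto
  then show ?thesis
    by (subst \<open>L = _\<close>) (intro countable_UN countable_finite finite_ball countableI_type)
qed

lemma separation: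
  assumes "A \<subseteq> L" "z0 \<notin> A"
  obtains d where "d > 0" "\<And>w. w \<in> A \<Longrightarrow> dist z0 w \<ge> d"
proof -
  have "finite (A \<inter> cball z0 1)"
    by (rule finite_subset[OF _ finite_Int_cball[of z0 1]]) (use assms in auto)
  from finite_set_avoid[OF this, of z0]
  obtain d where d: "d > 0" "\<forall>w\<in>A \<inter> cball z0 1. w \<noteq> z0 \<longrightarrow> d \<le> dist z0 w"
    by blast
  have "dist z0 w \<ge> min d 1" if "w \<in> A" for w
  proof (cases "dist z0 w \<le> 1")
    case True
    with d that assms(2) show ?thesis by auto
  qed auto
  with d(1) show thesis by (intro that[of "min d 1"]) auto
qed

lemma open_compl: "A \<subseteq> L \<Longrightarrow> open (- A)"
  unfolding open_contains_ball
proof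
  fix z0 assume A: "A \<subseteq> L" "z0 \<in> - A"
  then obtain d where "d > 0" "\<And>w. w \<in> A \<Longrightarrow> dist z0 w \<ge> d"
    using separation[of A z0] by auto
  then show "\<exists>e>0. ball z0 e \<subseteq> - A"
    by (intro exI[of _ d]) force
qed

text \<open>Nearby lattice points are kept away by discreteness, distant ones by the triangle
  inequality. The constant \<open>K\<close> merges both into one linear bound, which dominates the
  lattice sums on a whole disc around \<open>z0\<close>.\<close>

lemma uniform_separation:
  assumes "A \<subseteq> L" "z0 \<notin> A"
  obtains c d where "c > 0" "d > 0" "d \<le> 1"
    "\<And>w z. w \<in> A \<Longrightarrow> z \<in> ball z0 d \<Longrightarrow> norm (z - w) \<ge> c * (1 + norm w)"
proof -
  obtain d' where d': "d' > 0" "\<And>w. w \<in> A \<Longrightarrow> dist z0 w \<ge> d'"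
    using separation[OF assms] by auto
  define d where "d = min (d' / 2) 1"
  have d: "d > 0" "d \<le> 1" "2 * d \<le> d'" using d' by (auto simp: d_def)
  define K where "K = (norm z0 + 2) / d"
  have "K \<ge> 0" using d by (simp add: K_def)
  show thesis
  proof (rule that[of "1 / (1 + K)" d])
    fix w z assume w: "w \<in> A" and z: "z \<in> ball z0 d"
    have 1: "norm (z - w) \<ge> d"
      using d'(2)[OF w] z d dist_triangle[of z0 w z] by (simp add: dist_norm)
    have "norm z \<le> norm z0 + 1"
      using z d norm_triangle_ineq2[of z z0] by (simp add: dist_norm norm_minus_commute)
    then have "1 + norm w \<le> norm (z - w) + (norm z0 + 2)"
      using norm_triangle_ineq2[of w z] by (simp add: norm_minus_commute)
    also have "norm z0 + 2 = K * d" using d by (simp add: K_def)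
    also have "K * d \<le> K * norm (z - w)"
      using 1 \<open>K \<ge> 0\<close> by (rule mult_left_mono)
    finally have "1 + norm w \<le> norm (z - w) * (1 + K)"
      by (simp add: algebra_simps)
    then show "norm (z - w) \<ge> 1 / (1 + K) * (1 + norm w)"
      using \<open>K \<ge> 0\<close> by (simp add: field_simps)
  qed (use d \<open>K \<ge> 0\<close> in auto)
qed

lemma nonzero_norm_ge:
  obtains c where "c > 0" "\<And>w. w \<in> L - {0} \<Longrightarrow> norm w \<ge> c * (1 + norm w)"
proof -
  obtain c d where c: "c > 0" "d > 0"
    "\<And>w z. w \<in> L - {0} \<Longrightarrow> z \<in> ball 0 d \<Longrightarrow> norm (z - w) \<ge> c * (1 + norm w)"
    by (rule uniform_separation[of "L - {0}" 0]) auto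
  have "norm w \<ge> c * (1 + norm w)" if "w \<in> L - {0}" for w
    using c(3)[OF that, of 0] \<open>d > 0\<close> by simp
  with \<open>c > 0\<close> show thesis by (rule that)
qed

lemma summable_bound: "A \<subseteq> L \<Longrightarrow> (\<lambda>w. C / (1 + norm w) ^ 3) summable_on A"
  using summable_on_cmult_right[OF summable_on_subset_banach[OF summable], of A C] by simp

end

section \<open>Termwise differentiation of lattice sums\<close>

lemma has_field_derivative_inverse_power:
  fixes z w :: "'a :: real_normed_field"
  assumes "z \<noteq> w"
  shows "((\<lambda>z. 1 / (z - w) ^ k) has_field_derivative - of_nat k * (1 / (z - w) ^ Suc k)) (at z)"
proof (cases k)
  case (Suc j)
  have "((\<lambda>z. (z - w) ^ k) has_field_derivative of_nat k * (z - w) ^ j) (at z)"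
    by (rule DERIV_cong[OF DERIV_power[OF DERIV_diff[OF DERIV_ident DERIV_const]]]) (simp add: Suc)
  from DERIV_inverse_fun[OF this] assms
  have "((\<lambda>z. 1 / (z - w) ^ k) has_field_derivative
      - (inverse ((z - w) ^ k) * (of_nat k * (z - w) ^ j) * inverse ((z - w) ^ k))) (at z)"
    by (simp add: inverse_eq_divide)
  moreover have "- (inverse (u ^ k) * (of_nat k * u ^ j) * inverse (u ^ k)) = - of_nat k * (1 / u ^ Suc k)"
    if "u \<noteq> 0" for u :: 'a
    using that unfolding Suc by (simp add: field_simps)
  ultimately show ?thesis using assms by simp
qed auto

context period_lattice
begin

lemma summable_on_if_bounded:
  fixes f :: "complex \<Rightarrow> complex"
  assumes "A \<subseteq> L" "\<And>w. w \<in> A \<Longrightarrow> norm (f w) \<le> C / (1 + norm w) ^ 3"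
  shows "f summable_on A"
  by (rule abs_summable_summable, rule Infinite_Sum.abs_summable_on_comparison_test'[OF summable_bound[OF assms(1)] assms(2)])

lemma norm_inverse_power_le:
  assumes "c > 0" "norm u \<ge> c * (1 + norm (w :: complex))" "k \<ge> 3"
  shows "norm (1 / (u :: complex) ^ k) \<le> (1 / c ^ k) / (1 + norm w) ^ 3"
proof -
  have "c ^ k * (1 + norm w) ^ 3 \<le> c ^ k * (1 + norm w) ^ k"
    using assms by (intro mult_left_mono power_increasing) auto
  also have "\<dots> = (c * (1 + norm w)) ^ k" by (simp add: power_mult_distrib)
  also have "\<dots> \<le> norm u ^ k"
    using assms by (intro power_mono) (auto intro!: mult_nonneg_nonneg add_nonneg_nonneg)
  finally have "c ^ k * (1 + norm w) ^ 3 \<le> norm u ^ k" .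
  moreover have "0 < c ^ k * (1 + norm w) ^ 3"
    using assms(1) by (intro mult_pos_pos zero_less_power) (auto intro: add_pos_nonneg)
  ultimately have "1 / norm u ^ k \<le> 1 / (c ^ k * (1 + norm w) ^ 3)"
    by (intro divide_left_mono) (auto intro: mult_pos_pos)
  then show ?thesis by (simp add: norm_divide norm_power)
qed

lemma summable_inverse_power:
  assumes "A \<subseteq> L" "z \<notin> A" "k \<ge> 3"
  shows "(\<lambda>w. 1 / (z - w) ^ k) summable_on A"
proof -
  obtain c d where cd: "c > 0" "d > 0"
    "\<And>w z'. w \<in> A \<Longrightarrow> z' \<in> ball z d \<Longrightarrow> norm (z' - w) \<ge> c * (1 + norm w)"
    by (rule uniform_separation[OF assms(1,2)]) blast
  show ?thesis
    by (rule summable_on_if_bounded[OF assms(1), where C = "1 / c ^ k"],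
        rule norm_inverse_power_le[OF cd(1) cd(3) assms(3)]) (use cd in auto)
qed

lemma has_derivative_sum_inverse_power:
  assumes "A \<subseteq> L" "z \<notin> A" "k \<ge> 3"
  shows "((\<lambda>z. \<Sum>\<^sub>\<infinity>w\<in>A. 1 / (z - w) ^ k) has_field_derivative
           - of_nat k * (\<Sum>\<^sub>\<infinity>w\<in>A. 1 / (z - w) ^ Suc k)) (at z)"
proof -
  obtain c d where cd: "c > 0" "d > 0"
    "\<And>w z'. w \<in> A \<Longrightarrow> z' \<in> ball z d \<Longrightarrow> norm (z' - w) \<ge> c * (1 + norm w)"
    by (rule uniform_separation[OF assms(1,2)]) blast
  have "((\<lambda>z. \<Sum>\<^sub>\<infinity>w\<in>A. 1 / (z - w) ^ k) has_field_derivative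
           (\<Sum>\<^sub>\<infinity>w\<in>A. - of_nat k * (1 / (z - w) ^ Suc k))) (at z)"
  proof (rule infsum_has_field_derivative[OF _ norm_inverse_power_le[OF cd(1) cd(3) assms(3)]
        summable_bound[OF assms(1)] cd(2)])
    fix w z' assume *: "w \<in> A" "z' \<in> ball z d"
    have "z' - w \<noteq> 0"
    proof
      assume "z' - w = 0"
      then have "c * (1 + norm w) \<le> 0" using cd(3)[OF *] by simp
      moreover have "c * (1 + norm w) > 0" using cd(1) by (simp add: add_pos_nonneg)
      ultimately show False by simp
    qed
    then show "((\<lambda>z. 1 / (z - w) ^ k) has_field_derivative - of_nat k * (1 / (z' - w) ^ Suc k)) (at z')"
      by (intro has_field_derivative_inverse_power) auto
  qed auto
  then show ?thesis by (simp only: infsum_cmult_right')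
qed

lemma pole_sum_has_field_derivative:
  "z \<notin> L \<Longrightarrow> k \<ge> 3 \<Longrightarrow>
    (pole_sum L k has_field_derivative - of_nat k * pole_sum L (Suc k) z) (at z)"
  using has_derivative_sum_inverse_power[of L z k] by (simp add: pole_sum_def [abs_def])

lemma infsum_insert_zero:
  fixes f :: "complex \<Rightarrow> complex"
  assumes "f summable_on (L - {0})"
  shows "infsum f L = f 0 + infsum f (L - {0})"
proof -
  have "infsum f ({0} \<union> (L - {0})) = infsum f {0} + infsum f (L - {0})"
    by (rule infsum_Un_disjoint) (use assms in auto)
  then show ?thesis by (simp add: insert_absorb)
qed

text \<open>Subtracting \<open>1 / w^2\<close> gains the one power of \<open>w\<close> needed for
  cubic decay. The second expression, times \<open>z^6\<close>, is the exact remainder of the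
  expansion of \<open>1 / (z - w)^2\<close> in powers of \<open>z\<close> after the term with
  \<open>z^5\<close>.\<close>

lemma weierstrass_term_bound:
  assumes "A \<subseteq> L - {0}" "z0 \<notin> A"
  obtains C d where "d > 0" "\<And>w z. w \<in> A \<Longrightarrow> z \<in> ball z0 d \<Longrightarrow>
     w \<noteq> 0 \<and> z \<noteq> w \<and> norm (1 / (z - w) ^ 2 - 1 / w ^ 2) \<le> C / (1 + norm w) ^ 3 \<and>
     norm ((7 * w - 6 * z) / (w ^ 7 * (z - w) ^ 2)) \<le> C / (1 + norm w) ^ 3"
proof -
  obtain c d where cd: "c > 0" "d > 0" "d \<le> 1"
    "\<And>w z. w \<in> A \<Longrightarrow> z \<in> ball z0 d \<Longrightarrow> norm (z - w) \<ge> c * (1 + norm w)"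
    by (rule uniform_separation[of A z0]) (use assms in auto)
  obtain b where b: "b > 0" "\<And>w. w \<in> L - {0} \<Longrightarrow> norm w \<ge> b * (1 + norm w)"
    by (rule nonzero_norm_ge) auto
  define K where "K = norm z0 + 1"
  have K: "K \<ge> 1" by (simp add: K_def)
  define C where "C = max (K * (2 + K) / (b ^ 2 * c ^ 2)) ((7 + 6 * K) / (b ^ 7 * c ^ 2))"
  show thesis
  proof (rule that[of d C])
    show "d > 0" by (rule cd)
    fix w z assume w: "w \<in> A" and z: "z \<in> ball z0 d"
    define N where "N = 1 + norm w"
    have N: "N \<ge> 1" by (simp add: N_def)
    have zw: "norm (z - w) \<ge> c * N" and w': "norm w \<ge> b * N"
      using cd(4)[OF w z] b(2)[of w] w assms(1) by (auto simp: N_def)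
    have zK: "norm z \<le> K"
      using z cd norm_triangle_ineq2[of z z0] by (simp add: dist_norm norm_minus_commute K_def)
    have pos: "c * N > 0" "b * N > 0" using cd(1) b(1) N by auto
    have nz: "w \<noteq> 0" "z - w \<noteq> 0" using pos zw w' by auto
    have KN: "norm z \<le> K * N"
      by (rule order_trans[OF zK]) (use mult_left_mono[OF N, of K] K in simp)
    have num1: "norm (2 * w - z) \<le> (2 + K) * N"
    proof -
      have "norm (2 * w - z) \<le> 2 * norm w + norm z"
        using norm_triangle_ineq4[of "2 * w" z] by (simp add: norm_mult)
      also have "\<dots> \<le> 2 * N + K * N"
        using KN by (simp add: N_def)
      finally show ?thesis by (simp add: algebra_simps)
    qed
    have num2: "norm (7 * w - 6 * z) \<le> (7 + 6 * K) * N"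
    proof -
      have "norm (7 * w - 6 * z) \<le> 7 * norm w + 6 * norm z"
        using norm_triangle_ineq4[of "7 * w" "6 * z"] by (simp add: norm_mult)
      also have "\<dots> \<le> 7 * N + 6 * (K * N)"
        using KN by (simp add: N_def)
      finally show ?thesis by (simp add: algebra_simps)
    qed
    have den: "(b * N) ^ k * (c * N) ^ 2 \<le> norm (w ^ k * (z - w) ^ 2)" for k
      unfolding norm_mult norm_power using pos zw w'
      by (intro mult_mono power_mono) auto
    have dpos: "0 < (b * N) ^ k * (c * N) ^ 2" for k
      using cd(1) b(1) N by (intro mult_pos_pos zero_less_power) auto
    have "1 / (z - w) ^ 2 - 1 / w ^ 2 = z * (2 * w - z) / (w ^ 2 * (z - w) ^ 2)"
      using nz by (simp add: divide_simps) (simp add: power2_eq_square algebra_simps)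
    then have "norm (1 / (z - w) ^ 2 - 1 / w ^ 2) = norm z * norm (2 * w - z) / norm (w ^ 2 * (z - w) ^ 2)"
      by (simp add: norm_mult norm_divide)
    also have "\<dots> \<le> (K * ((2 + K) * N)) / ((b * N) ^ 2 * (c * N) ^ 2)"
      using dpos K N by (intro frac_le mult_mono zK num1 den) auto
    also have "\<dots> = (K * (2 + K) / (b ^ 2 * c ^ 2)) / N ^ 3"
      using N cd(1) b(1) by (simp add: field_simps power_mult_distrib eval_nat_numeral)
    also have "\<dots> \<le> C / N ^ 3"
      unfolding C_def using N by (intro divide_right_mono max.cobounded1) auto
    finally have 1: "norm (1 / (z - w) ^ 2 - 1 / w ^ 2) \<le> C / N ^ 3" .
    have "norm ((7 * w - 6 * z) / (w ^ 7 * (z - w) ^ 2)) \<le> ((7 + 6 * K) * N) / ((b * N) ^ 7 * (c * N) ^ 2)"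
      unfolding norm_divide using dpos K N by (intro frac_le num2 den) auto
    also have "\<dots> = ((7 + 6 * K) / (b ^ 7 * c ^ 2)) / N ^ 8"
      using N cd(1) b(1) by (simp add: field_simps power_mult_distrib eval_nat_numeral)
    also have "\<dots> \<le> ((7 + 6 * K) / (b ^ 7 * c ^ 2)) / N ^ 3"
      using N K b(1) cd(1) by (intro divide_left_mono power_increasing) auto
    also have "\<dots> \<le> C / N ^ 3"
      unfolding C_def using N by (intro divide_right_mono max.cobounded2) auto
    finally show "w \<noteq> 0 \<and> z \<noteq> w \<and> norm (1 / (z - w) ^ 2 - 1 / w ^ 2) \<le> C / (1 + norm w) ^ 3 \<and>
     norm ((7 * w - 6 * z) / (w ^ 7 * (z - w) ^ 2)) \<le> C / (1 + norm w) ^ 3"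
      using 1 nz by (auto simp: N_def)
  qed
qed

lemma summable_weierstrass_terms:
  assumes "z \<notin> L - {0}"
  shows "(\<lambda>w. 1 / (z - w) ^ 2 - 1 / w ^ 2) summable_on (L - {0})"
    "(\<lambda>w. (7 * w - 6 * z) / (w ^ 7 * (z - w) ^ 2)) summable_on (L - {0})"
proof -
  obtain C d where d: "d > 0" "\<And>w z'. w \<in> L - {0} \<Longrightarrow> z' \<in> ball z d \<Longrightarrow>
     w \<noteq> 0 \<and> z' \<noteq> w \<and> norm (1 / (z' - w) ^ 2 - 1 / w ^ 2) \<le> C / (1 + norm w) ^ 3 \<and>
     norm ((7 * w - 6 * z') / (w ^ 7 * (z' - w) ^ 2)) \<le> C / (1 + norm w) ^ 3"
    by (rule weierstrass_term_bound[OF subset_refl assms]) blast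
  show "(\<lambda>w. 1 / (z - w) ^ 2 - 1 / w ^ 2) summable_on (L - {0})"
    "(\<lambda>w. (7 * w - 6 * z) / (w ^ 7 * (z - w) ^ 2)) summable_on (L - {0})"
    using d(2)[of _ z] d(1) by (auto intro!: summable_on_if_bounded[of _ _ C])
qed

lemma weierstrass_sum_has_field_derivative:
  assumes "z \<notin> L - {0}"
  shows "((\<lambda>z. \<Sum>\<^sub>\<infinity>w\<in>L - {0}. 1 / (z - w) ^ 2 - 1 / w ^ 2) has_field_derivative
          -2 * (\<Sum>\<^sub>\<infinity>w\<in>L - {0}. 1 / (z - w) ^ 3)) (at z)"
    "(\<lambda>z. \<Sum>\<^sub>\<infinity>w\<in>L - {0}. (7 * w - 6 * z) / (w ^ 7 * (z - w) ^ 2)) field_differentiable (at z)"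
proof -
  obtain C d where d: "d > 0" "\<And>w z'. w \<in> L - {0} \<Longrightarrow> z' \<in> ball z d \<Longrightarrow>
     w \<noteq> 0 \<and> z' \<noteq> w \<and> norm (1 / (z' - w) ^ 2 - 1 / w ^ 2) \<le> C / (1 + norm w) ^ 3 \<and>
     norm ((7 * w - 6 * z') / (w ^ 7 * (z' - w) ^ 2)) \<le> C / (1 + norm w) ^ 3"
    by (rule weierstrass_term_bound[OF subset_refl assms]) blast
  have "((\<lambda>z. \<Sum>\<^sub>\<infinity>w\<in>L - {0}. 1 / (z - w) ^ 2 - 1 / w ^ 2) has_field_derivative
          (\<Sum>\<^sub>\<infinity>w\<in>L - {0}. -2 * (1 / (z - w) ^ 3))) (at z)"
  proof (rule infsum_has_field_derivative[OF _ _ summable_bound d(1)])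
    fix w z' assume *: "w \<in> L - {0}" "z' \<in> ball z d"
    then have "z' - w \<noteq> 0" using d(2) by force
    then show "((\<lambda>z. 1 / (z - w) ^ 2 - 1 / w ^ 2) has_field_derivative -2 * (1 / (z' - w) ^ 3)) (at z')"
      using DERIV_diff[OF has_field_derivative_inverse_power[of z' w 2] DERIV_const[of "1 / w\<^sup>2"]]
      by (simp add: eval_nat_numeral)
    show "norm (1 / (z' - w) ^ 2 - 1 / w ^ 2) \<le> C / (1 + norm w) ^ 3"
      using d(2)[OF *] by blast
  qed auto
  then show "((\<lambda>z. \<Sum>\<^sub>\<infinity>w\<in>L - {0}. 1 / (z - w) ^ 2 - 1 / w ^ 2) has_field_derivative
          -2 * (\<Sum>\<^sub>\<infinity>w\<in>L - {0}. 1 / (z - w) ^ 3)) (at z)"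
    by (simp only: infsum_cmult_right')
  have "((\<lambda>z. \<Sum>\<^sub>\<infinity>w\<in>L - {0}. (7 * w - 6 * z) / (w ^ 7 * (z - w) ^ 2)) has_field_derivative
     (\<Sum>\<^sub>\<infinity>w\<in>L - {0}. deriv (\<lambda>z. (7 * w - 6 * z) / (w ^ 7 * (z - w) ^ 2)) z)) (at z)"
  proof (rule infsum_has_field_derivative[OF _ _ summable_bound d(1)])
    fix w z' assume *: "w \<in> L - {0}" "z' \<in> ball z d"
    then have "w \<noteq> 0" "z' - w \<noteq> 0" using d(2) by force+
    then show "((\<lambda>z. (7 * w - 6 * z) / (w ^ 7 * (z - w) ^ 2)) has_field_derivative
        deriv (\<lambda>z. (7 * w - 6 * z) / (w ^ 7 * (z - w) ^ 2)) z') (at z')"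
      unfolding DERIV_deriv_iff_field_differentiable
      by (intro derivative_intros) auto
    show "norm ((7 * w - 6 * z') / (w ^ 7 * (z' - w) ^ 2)) \<le> C / (1 + norm w) ^ 3"
      using d(2)[OF *] by blast
  qed auto
  then show "(\<lambda>z. \<Sum>\<^sub>\<infinity>w\<in>L - {0}. (7 * w - 6 * z) / (w ^ 7 * (z - w) ^ 2)) field_differentiable (at z)"
    unfolding field_differentiable_def by blast
qed

lemma weierstrass_p_has_field_derivative:
  assumes "z \<notin> L"
  shows "(weierstrass_p L has_field_derivative -2 * pole_sum L 3 z) (at z)"
proof -
  have "z \<noteq> 0" using assms by auto
  have eq: "pole_sum L 3 z = 1 / z ^ 3 + (\<Sum>\<^sub>\<infinity>w\<in>L - {0}. 1 / (z - w) ^ 3)"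
    unfolding pole_sum_def
    by (subst infsum_insert_zero) (use assms in \<open>auto intro!: summable_inverse_power\<close>)
  have "((\<lambda>z. 1 / z ^ 2) has_field_derivative -2 * (1 / z ^ 3)) (at z)"
    using \<open>z \<noteq> 0\<close> by (auto intro!: derivative_eq_intros simp: divide_simps eval_nat_numeral)
  from DERIV_add[OF this weierstrass_sum_has_field_derivative(1)] assms
  show ?thesis unfolding weierstrass_p_def[abs_def] eq by (simp add: algebra_simps)
qed

section \<open>Periodicity, parity, and the differential equations by Liouville's theorem\<close>

lemma pole_sum_periodic:
  assumes "w \<in> L"
  shows "pole_sum L k (z + w) = pole_sum L k z"
  unfolding pole_sum_def
  by (rule infsum_reindex_bij_witness[of _ "\<lambda>u. u + w" "\<lambda>u. u - w"])
     (use assms in \<open>auto simp: algebra_simps\<close>)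

lemma lattice_G_odd: "odd k \<Longrightarrow> lattice_G L k = 0"
proof -
  assume "odd k"
  have "lattice_G L k = (\<Sum>\<^sub>\<infinity>w\<in>L - {0}. 1 / (- w) ^ k)"
    unfolding lattice_G_def
    by (rule infsum_reindex_bij_witness[of _ uminus uminus]) auto
  also have "\<dots> = (\<Sum>\<^sub>\<infinity>w\<in>L - {0}. - (1 / w ^ k))"
    using \<open>odd k\<close> by (simp add: power_minus_odd)
  also have "\<dots> = - lattice_G L k"
    by (simp add: lattice_G_def infsum_uminus)
  finally show ?thesis by simp
qed

lemma weierstrass_p_even: "weierstrass_p L (- z) = weierstrass_p L z"
proof -
  have "(\<Sum>\<^sub>\<infinity>w\<in>L - {0}. 1 / (- z - w) ^ 2 - 1 / w ^ 2) = (\<Sum>\<^sub>\<infinity>w\<in>L - {0}. 1 / (z - w) ^ 2 - 1 / w ^ 2)"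
    by (rule infsum_reindex_bij_witness[of _ uminus uminus])
       (auto simp: power2_eq_square algebra_simps)
  then show ?thesis by (simp add: weierstrass_p_def)
qed

lemma pole_sum_minus: "pole_sum L k (- z) = (-1) ^ k * pole_sum L k z"
proof -
  have *: "1 / (- z - w) ^ k = (-1) ^ k * (1 / (z - - w) ^ k)" for w
  proof -
    have "- z - w = (-1) * (z - - w)" by simp
    then have "(- z - w) ^ k = (-1) ^ k * (z - - w) ^ k"
      by (simp only: power_mult_distrib)
    then show ?thesis by (cases "even k") auto
  qed
  have "pole_sum L k (- z) = (\<Sum>\<^sub>\<infinity>w\<in>L. (-1) ^ k * (1 / (z - w) ^ k))"
    unfolding pole_sum_def
    by (rule infsum_reindex_bij_witness[of _ uminus uminus]) (use * in auto)
  also have "\<dots> = (-1) ^ k * pole_sum L k z"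
    unfolding pole_sum_def by (rule infsum_cmult_right')
  finally show ?thesis .
qed


text \<open>Periodicity carries the limit at 0 to every lattice point, so extending by 0 there gives
  a continuous function. Its isolated singularities are removable, \<open>covering\<close> lets one
  disc carry all its values, and Liouville's theorem makes it constant, with value 0 at 0.\<close>

lemma elliptic_vanish:
  assumes hol: "f holomorphic_on (- L)"
    and per: "\<And>z w. z \<notin> L \<Longrightarrow> w \<in> L \<Longrightarrow> f (z + w) = f z"
    and lim: "(f \<longlongrightarrow> 0) (at 0)" and "z \<notin> L"
  shows "f z = 0"
proof -
  define g where "g = (\<lambda>z. if z \<in> L then 0 else f z)"
  have g_per: "g (z + w) = g z" if "w \<in> L" for z w
    using that per by (auto simp: g_def)
  have open_L: "open (- L)" by (rule open_compl) simp
  have cont0: "isCont g 0"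
  proof -
    have "eventually (\<lambda>z. z \<in> - (L - {0})) (nhds 0)"
      by (rule eventually_nhds_in_open[OF open_compl]) auto
    then have "eventually (\<lambda>z. f z = g z) (at 0)"
      by (auto simp: eventually_at_filter g_def elim!: eventually_mono)
    with lim have "(g \<longlongrightarrow> 0) (at 0)"
      by (simp add: tendsto_cong)
    then show ?thesis by (simp add: isCont_def g_def)
  qed
  have cont: "isCont g p" for p
  proof (cases "p \<in> L")
    case True
    have "isCont (\<lambda>z. g (z - p)) p"
      by (rule isCont_o2[where g = g]) (use cont0 in auto)
    moreover have "g (z - p) = g z" for z
      using g_per[of "-p" z] True by simp
    ultimately show ?thesis by simp
  next
    case False
    have "isCont f p"
      using hol open_L False by (meson ComplI continuous_on_eq_continuous_at holomorphic_on_imp_continuous_on)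
    moreover have "eventually (\<lambda>z. f z = g z) (nhds p)"
      using eventually_nhds_in_open[OF open_L, of p] False
      by (auto simp: g_def elim!: eventually_mono)
    ultimately show ?thesis using isCont_cong by blast
  qed
  have "g holomorphic_on ball p 1" for p
  proof (rule no_isolated_singularity)
    show "continuous_on (ball p 1) g"
      by (intro continuous_at_imp_continuous_on ballI cont)
    show "finite (L \<inter> cball p 1)" by (rule finite_Int_cball)
    have "f holomorphic_on (ball p 1 - L \<inter> cball p 1)"
      by (rule holomorphic_on_subset[OF hol]) auto
    then show "g holomorphic_on (ball p 1 - L \<inter> cball p 1)"
      by (rule holomorphic_transform) (auto simp: g_def)
  qed auto
  then have g_hol: "g holomorphic_on UNIV"
    by (meson UNIV_I centre_in_ball holomorphic_on_def holomorphic_on_open open_ball open_UNIV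
        field_differentiable_at_within at_within_open zero_less_one)
  obtain R where R: "\<And>z. \<exists>w\<in>L. norm (z - w) \<le> R" using covering by blast
  have "range g \<subseteq> g ` cball 0 R"
  proof safe
    fix z obtain w where w: "w \<in> L" "norm (z - w) \<le> R" using R by blast
    have "g z = g (z - w)" using g_per[of "-w" z] w by simp
    then show "g z \<in> g ` cball 0 R" using w by auto
  qed
  moreover have "compact (g ` cball 0 R)"
    by (intro compact_continuous_image continuous_at_imp_continuous_on ballI cont) auto
  ultimately have "bounded (range g)"
    using bounded_subset compact_imp_bounded by blast
  then have "g constant_on UNIV" by (rule Liouville_theorem[OF g_hol])
  then have "g z = g 0" by (auto simp: constant_on_def)
  then show ?thesis using \<open>z \<notin> L\<close> by (simp add: g_def)
qed

lemma summable_inverse_power_0: "k \<ge> 3 \<Longrightarrow> (\<lambda>w. 1 / w ^ k) summable_on (L - {0})"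
  using summable_inverse_power[of "L - {0}" 0 k]
    summable_on_reindex_bij_witness[of "L - {0}" uminus uminus "L - {0}" "\<lambda>w. 1 / (0 - w) ^ k" "\<lambda>w. 1 / w ^ k"]
  by auto

text \<open>A finite expansion with exact remainder replaces the Laurent series. Odd weights cancel
  under \<open>w |-> - w\<close>, and the terms up to \<open>z^4\<close> are all that the polar
  parts and constant terms in the differential equations see.\<close>

lemma weierstrass_p_expansion:
  assumes "z \<notin> L"
  shows "weierstrass_p L z = 1 / z ^ 2 + 3 * lattice_G L 4 * z ^ 2 + 5 * lattice_G L 6 * z ^ 4 +
           z ^ 6 * (\<Sum>\<^sub>\<infinity>w\<in>L - {0}. (7 * w - 6 * z) / (w ^ 7 * (z - w) ^ 2))"
proof -
  have G: "((\<lambda>w. 1 / w ^ k) has_sum lattice_G L k) (L - {0})" if "k \<ge> 3" for k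
    using summable_inverse_power_0[OF that] by (simp add: lattice_G_def)
  have R: "((\<lambda>w. (7 * w - 6 * z) / (w ^ 7 * (z - w) ^ 2)) has_sum
      (\<Sum>\<^sub>\<infinity>w\<in>L - {0}. (7 * w - 6 * z) / (w ^ 7 * (z - w) ^ 2))) (L - {0})"
    using summable_weierstrass_terms(2)[of z] assms by simp
  let ?t = "\<lambda>w. 2 * z * (1 / w ^ 3) + 3 * z ^ 2 * (1 / w ^ 4) + 4 * z ^ 3 * (1 / w ^ 5) +
      5 * z ^ 4 * (1 / w ^ 6) + 6 * z ^ 5 * (1 / w ^ 7) + z ^ 6 * ((7 * w - 6 * z) / (w ^ 7 * (z - w) ^ 2))"
  have "(?t has_sum (2 * z * lattice_G L 3 + 3 * z ^ 2 * lattice_G L 4 + 4 * z ^ 3 * lattice_G L 5 +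
      5 * z ^ 4 * lattice_G L 6 + 6 * z ^ 5 * lattice_G L 7 + z ^ 6 *
      (\<Sum>\<^sub>\<infinity>w\<in>L - {0}. (7 * w - 6 * z) / (w ^ 7 * (z - w) ^ 2)))) (L - {0})"
    by (intro has_sum_add has_sum_cmult_right G R) auto
  moreover have "?t w = 1 / (z - w) ^ 2 - 1 / w ^ 2" if "w \<in> L - {0}" for w
  proof -
    have *: "2 * (w + u) * (1 / w ^ 3) + 3 * (w + u) ^ 2 * (1 / w ^ 4) + 4 * (w + u) ^ 3 * (1 / w ^ 5) +
      5 * (w + u) ^ 4 * (1 / w ^ 6) + 6 * (w + u) ^ 5 * (1 / w ^ 7) +
      (w + u) ^ 6 * ((7 * w - 6 * (w + u)) / (w ^ 7 * u ^ 2)) = 1 / u ^ 2 - 1 / w ^ 2"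
      if "w \<noteq> 0" "u \<noteq> 0" for u :: complex
      using that by (simp add: divide_simps) (simp add: eval_nat_numeral algebra_simps)
    have "w \<noteq> 0" "z - w \<noteq> 0" using that assms by auto
    from *[OF this] show ?thesis by simp
  qed
  ultimately have "((\<lambda>w. 1 / (z - w) ^ 2 - 1 / w ^ 2) has_sum (2 * z * lattice_G L 3 +
      3 * z ^ 2 * lattice_G L 4 + 4 * z ^ 3 * lattice_G L 5 +
      5 * z ^ 4 * lattice_G L 6 + 6 * z ^ 5 * lattice_G L 7 + z ^ 6 *
      (\<Sum>\<^sub>\<infinity>w\<in>L - {0}. (7 * w - 6 * z) / (w ^ 7 * (z - w) ^ 2)))) (L - {0})"
    using has_sum_cong[of "L - {0}" ?t "\<lambda>w. 1 / (z - w) ^ 2 - 1 / w ^ 2"] by blast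
  note infsumI[OF this]
  then show ?thesis
    by (simp add: weierstrass_p_def lattice_G_odd)
qed

lemma weierstrass_p_local:
  obtains r R where "r > 0" "R holomorphic_on ball 0 r" "L \<inter> ball 0 r = {0}"
    "\<And>z. z \<in> ball 0 r - {0} \<Longrightarrow>
      weierstrass_p L z = 1 / z ^ 2 + 3 * lattice_G L 4 * z ^ 2 + 5 * lattice_G L 6 * z ^ 4 + z ^ 6 * R z"
proof -
  define R where "R = (\<lambda>z. \<Sum>\<^sub>\<infinity>w\<in>L - {0}. (7 * w - 6 * z) / (w ^ 7 * (z - w) ^ 2))"
  obtain r where r: "r > 0" "\<And>w. w \<in> L - {0} \<Longrightarrow> dist 0 w \<ge> r"
    by (rule separation[of "L - {0}" 0]) auto
  have *: "z \<notin> L - {0}" if "z \<in> ball 0 r" for z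
    using r(2)[of z] that by fastforce
  show thesis
  proof (rule that[of r R])
    show "R holomorphic_on ball 0 r"
      unfolding R_def holomorphic_on_def
      by (intro ballI field_differentiable_at_within[OF weierstrass_sum_has_field_derivative(2)]) (rule *)
    show "L \<inter> ball 0 r = {0}" using * \<open>r > 0\<close> by auto
    show "weierstrass_p L z = 1 / z ^ 2 + 3 * lattice_G L 4 * z ^ 2 + 5 * lattice_G L 6 * z ^ 4 + z ^ 6 * R z"
      if "z \<in> ball 0 r - {0}" for z
      unfolding R_def by (rule weierstrass_p_expansion) (use * that in auto)
  qed (rule r)
qed

lemma weierstrass_p_holomorphic: "weierstrass_p L holomorphic_on (- L)"
  unfolding holomorphic_on_def field_differentiable_def
  using weierstrass_p_has_field_derivative DERIV_subset by blast

lemma pole_sum_holomorphic: "k \<ge> 3 \<Longrightarrow> pole_sum L k holomorphic_on (- L)"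
  unfolding holomorphic_on_def field_differentiable_def
  using pole_sum_has_field_derivative DERIV_subset by blast

lemma weierstrass_p_periodic:
  assumes "w \<in> L" "z \<notin> L"
  shows "weierstrass_p L (z + w) = weierstrass_p L z"
proof -
  have "connected (- L)"
    unfolding Compl_eq_Diff_UNIV by (intro connected_open_diff_countable countable) auto
  moreover have "((\<lambda>z. weierstrass_p L (z + w) - weierstrass_p L z) has_field_derivative 0) (at z)"
    if "z \<in> - L" for z
  proof -
    have "(weierstrass_p L has_field_derivative -2 * pole_sum L 3 (z + w)) (at (z + w))"
      by (rule weierstrass_p_has_field_derivative) (use that assms in auto)
    then have "((\<lambda>z. weierstrass_p L (z + w)) has_field_derivative -2 * pole_sum L 3 z) (at z)"
      by (simp add: DERIV_shift pole_sum_periodic assms)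
    from DERIV_diff[OF this weierstrass_p_has_field_derivative] that show ?thesis by simp
  qed
  ultimately have "(\<lambda>z. weierstrass_p L (z + w) - weierstrass_p L z) constant_on (- L)"
    by (intro has_field_derivative_0_imp_constant_on open_compl) auto
  then obtain c where c: "\<And>z. z \<in> - L \<Longrightarrow> weierstrass_p L (z + w) - weierstrass_p L z = c"
    by (auto simp: constant_on_def)
  \<comment> \<open>Periodicity up to a constant \<open>c\<close> is already known. By evenness the
    difference taken at \<open>- z - w\<close> is the negative of the one at \<open>z\<close>, which
    forces \<open>c = 0\<close>.\<close>
  have "- z - w \<notin> L" using assms by simp
  have "weierstrass_p L (- z - w) = weierstrass_p L (z + w)"
    using weierstrass_p_even[of "z + w"] by simp
  with c[of z] c[of "- z - w"] assms \<open>- z - w \<notin> L\<close> weierstrass_p_even[of z]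
  have "c + c = (weierstrass_p L (z + w) - weierstrass_p L z) + (weierstrass_p L z - weierstrass_p L (z + w))"
    by simp
  then have "c = 0" by simp
  then show ?thesis using c[of z] assms by simp
qed

lemma differential_equations_limits:
  "((\<lambda>z. 6 * pole_sum L 4 z - 6 * weierstrass_p L z ^ 2 + 30 * lattice_G L 4) \<longlongrightarrow> 0) (at 0)"
  "((\<lambda>z. 4 * pole_sum L 3 z ^ 2 - 4 * weierstrass_p L z ^ 3 + 60 * lattice_G L 4 * weierstrass_p L z
      + 140 * lattice_G L 6) \<longlongrightarrow> 0) (at 0)"
proof -
  obtain r R where r: "r > 0" "R holomorphic_on ball 0 r" "L \<inter> ball 0 r = {0}"
    "\<And>z. z \<in> ball 0 r - {0} \<Longrightarrow>
      weierstrass_p L z = 1 / z ^ 2 + 3 * lattice_G L 4 * z ^ 2 + 5 * lattice_G L 6 * z ^ 4 + z ^ 6 * R z"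
    using weierstrass_p_local by blast
  define a b where "a = 3 * lattice_G L 4" and "b = 5 * lattice_G L 6"
  define R1 where "R1 = deriv R"
  define R2 where "R2 = deriv R1"
  have hol: "R1 holomorphic_on ball 0 r" "R2 holomorphic_on ball 0 r"
    unfolding R1_def R2_def by (intro holomorphic_deriv r open_ball)+
  have D: "(R has_field_derivative R1 z) (at z)" "(R1 has_field_derivative R2 z) (at z)" if "z \<in> ball 0 r" for z
    unfolding R2_def using r(2) hol(1) that R1_def by (auto intro!: holomorphic_derivI[of _ "ball 0 r"])
  have cont: "isCont R 0" "isCont R1 0" "isCont R2 0"
    using r(1,2) hol by (meson centre_in_ball continuous_on_eq_continuous_at holomorphic_on_imp_continuous_on open_ball)+
  let ?B = "ball 0 r - {0}"
  have op: "open ?B" by auto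
  have notin: "z \<notin> L" if "z \<in> ?B" for z using that r(3) by blast
  have p0: "weierstrass_p L z = 1 / z ^ 2 + (a * z ^ 2 + b * z ^ 4 + z ^ 6 * R z)" if "z \<in> ?B" for z
    using r(4)[OF that] by (simp add: a_def b_def)
  have p1: "- 2 * pole_sum L 3 z = - 2 / z ^ 3 + (2 * a * z + 4 * b * z ^ 3 + 6 * z ^ 5 * R z + z ^ 6 * R1 z)"
    if z: "z \<in> ?B" for z
  proof (rule DERIV_unique)
    show "(weierstrass_p L has_field_derivative - 2 * pole_sum L 3 z) (at z)"
      using notin[OF z] by (rule weierstrass_p_has_field_derivative)
    have "((\<lambda>z. 1 / z ^ 2 + (a * z ^ 2 + b * z ^ 4 + z ^ 6 * R z)) has_field_derivative
        (- 2 / z ^ 3 + (2 * a * z + 4 * b * z ^ 3 + 6 * z ^ 5 * R z + z ^ 6 * R1 z))) (at z)"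
    proof (rule DERIV_add)
      show "((\<lambda>z. 1 / z ^ 2) has_field_derivative - 2 / z ^ 3) (at z)"
        using has_field_derivative_inverse_power[of z 0 2] z by (simp add: eval_nat_numeral)
      show "((\<lambda>z. a * z ^ 2 + b * z ^ 4 + z ^ 6 * R z) has_field_derivative
          2 * a * z + 4 * b * z ^ 3 + 6 * z ^ 5 * R z + z ^ 6 * R1 z) (at z)"
        using z by (auto intro!: derivative_eq_intros D(1))
    qed
    then show "(weierstrass_p L has_field_derivative
        (- 2 / z ^ 3 + (2 * a * z + 4 * b * z ^ 3 + 6 * z ^ 5 * R z + z ^ 6 * R1 z))) (at z)"
      by (rule has_field_derivative_transform_within_open[OF _ op z]) (use p0 in auto)
  qed
  have p2: "6 * pole_sum L 4 z = 6 / z ^ 4 + (2 * a + 12 * b * z ^ 2 + 30 * z ^ 4 * R z + 12 * z ^ 5 * R1 z + z ^ 6 * R2 z)"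
    if z: "z \<in> ?B" for z
  proof (rule DERIV_unique)
    show "((\<lambda>z. - 2 * pole_sum L 3 z) has_field_derivative 6 * pole_sum L 4 z) (at z)"
      using DERIV_cmult[OF pole_sum_has_field_derivative[OF notin[OF z], of 3], of "-2"] by simp
    have "((\<lambda>z. - 2 / z ^ 3 + (2 * a * z + 4 * b * z ^ 3 + 6 * z ^ 5 * R z + z ^ 6 * R1 z)) has_field_derivative
       (6 / z ^ 4 + (2 * a + 12 * b * z ^ 2 + 30 * z ^ 4 * R z + 12 * z ^ 5 * R1 z + z ^ 6 * R2 z))) (at z)"
    proof (rule DERIV_add)
      show "((\<lambda>z. - 2 / z ^ 3) has_field_derivative 6 / z ^ 4) (at z)"
        using DERIV_cmult[OF has_field_derivative_inverse_power[of z 0 3], of "-2"] z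
        by (simp add: eval_nat_numeral)
      show "((\<lambda>z. 2 * a * z + 4 * b * z ^ 3 + 6 * z ^ 5 * R z + z ^ 6 * R1 z) has_field_derivative
          2 * a + 12 * b * z ^ 2 + 30 * z ^ 4 * R z + 12 * z ^ 5 * R1 z + z ^ 6 * R2 z) (at z)"
        using z by (auto intro!: derivative_eq_intros D simp: eval_nat_numeral algebra_simps)
    qed
    then show "((\<lambda>z. - 2 * pole_sum L 3 z) has_field_derivative
       (6 / z ^ 4 + (2 * a + 12 * b * z ^ 2 + 30 * z ^ 4 * R z + 12 * z ^ 5 * R1 z + z ^ 6 * R2 z))) (at z)"
      by (rule has_field_derivative_transform_within_open[OF _ op z]) (use p1 in auto)
  qed
  have ev: "eventually (\<lambda>z. z \<in> ?B) (at 0)"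
    using eventually_at_in_open[of "ball 0 r" 0] r(1) by simp
  \<comment> \<open>What remains of the first combination once its pole and its constant term have
    cancelled; every summand visibly vanishes at 0. \<open>?f2\<close> below plays the same part for
    the second combination.\<close>
  let ?f1 = "\<lambda>z. 18 * z ^ 4 * R z + 12 * z ^ 5 * R1 z + z ^ 6 * R2 z - 6 * (a * z ^ 2 + b * z ^ 4 + z ^ 6 * R z) ^ 2"
  have "isCont ?f1 0" by (intro continuous_intros cont)
  then have lim1: "?f1 \<midarrow>0\<rightarrow> 0" by (simp add: isCont_def)
  have eq1: "6 * pole_sum L 4 z - 6 * weierstrass_p L z ^ 2 + 30 * lattice_G L 4 = ?f1 z" if "z \<in> ?B" for z
  proof -
    have "z \<noteq> 0" using that by auto
    then have "6 / z ^ 4 + (2 * a + 12 * b * z ^ 2 + 30 * z ^ 4 * R z + 12 * z ^ 5 * R1 z + z ^ 6 * R2 z)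
       - 6 * (1 / z ^ 2 + (a * z ^ 2 + b * z ^ 4 + z ^ 6 * R z)) ^ 2 + 10 * a = ?f1 z"
      by (simp add: field_simps) (simp add: eval_nat_numeral algebra_simps)
    then show ?thesis unfolding p0[OF that] p2[OF that] by (simp add: a_def)
  qed
  show "((\<lambda>z. 6 * pole_sum L 4 z - 6 * weierstrass_p L z ^ 2 + 30 * lattice_G L 4) \<longlongrightarrow> 0) (at 0)"
    by (rule Lim_transform_eventually[OF lim1 eventually_mono[OF ev eq1[symmetric]]])
  let ?f2 = "\<lambda>z. - 36 * z ^ 2 * R z - 4 * z ^ 3 * R1 z + (2 * a * z + 4 * b * z ^ 3 + 6 * z ^ 5 * R z + z ^ 6 * R1 z) ^ 2
     - 12 * z ^ 2 * (a + b * z ^ 2 + z ^ 4 * R z) ^ 2 - 4 * (a * z ^ 2 + b * z ^ 4 + z ^ 6 * R z) ^ 3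
     + 20 * a * (a * z ^ 2 + b * z ^ 4 + z ^ 6 * R z)"
  have "isCont ?f2 0" by (intro continuous_intros cont)
  then have lim2: "?f2 \<midarrow>0\<rightarrow> 0" by (simp add: isCont_def)
  have eq2: "4 * pole_sum L 3 z ^ 2 - 4 * weierstrass_p L z ^ 3 + 60 * lattice_G L 4 * weierstrass_p L z
      + 140 * lattice_G L 6 = ?f2 z" if "z \<in> ?B" for z
  proof -
    have "z \<noteq> 0" using that by auto
    \<comment> \<open>Naming \<open>1 / z\<close> and the regular parts turns the cancellation of
      poles into polynomial algebra: the relations \<open>e\<close> rewrite each product of a pole
      with a regular part.\<close>
    define i A A1 C where "i = 1 / z" and "A = a * z ^ 2 + b * z ^ 4 + z ^ 6 * R z"
      and "A1 = 2 * a * z + 4 * b * z ^ 3 + 6 * z ^ 5 * R z + z ^ 6 * R1 z"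
      and "C = a + b * z ^ 2 + z ^ 4 * R z"
    have e: "i ^ 3 * A1 = 2 * a * i ^ 2 + 4 * b + 6 * z ^ 2 * R z + z ^ 3 * R1 z"
      "i ^ 2 * A = C" "A = z ^ 2 * C" "i ^ 2 * C = a * i ^ 2 + b + z ^ 2 * R z"
      using \<open>z \<noteq> 0\<close> by (auto simp: i_def A_def A1_def C_def divide_simps) (auto simp: eval_nat_numeral algebra_simps)
    have "(- 2 * i ^ 3 + A1) ^ 2 - 4 * (i ^ 2 + A) ^ 3 + 20 * a * (i ^ 2 + A) + 28 * b =
      - 4 * (i ^ 3 * A1) + A1 ^ 2 - 12 * (i ^ 2 * (i ^ 2 * A)) - 12 * ((i ^ 2 * A) * A) - 4 * A ^ 3
      + 20 * a * i ^ 2 + 20 * a * A + 28 * b"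
      by (simp add: eval_nat_numeral algebra_simps)
    also have "\<dots> = - 36 * z ^ 2 * R z - 4 * z ^ 3 * R1 z + A1 ^ 2 - 12 * (C * A) - 4 * A ^ 3 + 20 * a * A"
      unfolding e(1,2) e(4) by (simp add: algebra_simps)
    also have "C * A = z ^ 2 * C ^ 2" by (simp add: e(3) power2_eq_square)
    finally have "(- 2 / z ^ 3 + A1) ^ 2 - 4 * (1 / z ^ 2 + A) ^ 3 + 20 * a * (1 / z ^ 2 + A) + 28 * b = ?f2 z"
      unfolding A_def A1_def C_def i_def by (simp add: power_divide mult.assoc)
    moreover have "weierstrass_p L z = 1 / z ^ 2 + A" "- 2 * pole_sum L 3 z = - 2 / z ^ 3 + A1"
      using p0[OF that] p1[OF that] by (simp_all only: A_def A1_def)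
    moreover have "4 * pole_sum L 3 z ^ 2 = (- 2 * pole_sum L 3 z) ^ 2"
      by (simp add: power2_eq_square)
    moreover have "60 * lattice_G L 4 = 20 * a" "140 * lattice_G L 6 = 28 * b"
      by (simp_all add: a_def b_def)
    ultimately show ?thesis by (simp only:)
  qed
  show "((\<lambda>z. 4 * pole_sum L 3 z ^ 2 - 4 * weierstrass_p L z ^ 3 + 60 * lattice_G L 4 * weierstrass_p L z
      + 140 * lattice_G L 6) \<longlongrightarrow> 0) (at 0)"
    by (rule Lim_transform_eventually[OF lim2 eventually_mono[OF ev eq2[symmetric]]])
qed

text \<open>In classical terms these are \<open>p'' = 6 p^2 - g2 / 2\<close> and
  \<open>p'^2 = 4 p^3 - g2 p - g3\<close> with \<open>g2 = 60 G_4\<close> and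
  \<open>g3 = 140 G_6\<close>, because \<open>p' = - 2 pole_sum L 3\<close> and
  \<open>p'' = 6 pole_sum L 4\<close>.\<close>

theorem weierstrass_differential_equations:
  assumes "z \<notin> L"
  shows "6 * pole_sum L 4 z = 6 * weierstrass_p L z ^ 2 - 30 * lattice_G L 4"
    "4 * pole_sum L 3 z ^ 2 = 4 * weierstrass_p L z ^ 3 - 60 * lattice_G L 4 * weierstrass_p L z
      - 140 * lattice_G L 6"
proof -
  have "6 * pole_sum L 4 z - 6 * weierstrass_p L z ^ 2 + 30 * lattice_G L 4 = 0"
    by (rule elliptic_vanish[OF _ _ differential_equations_limits(1) assms])
       (auto intro!: holomorphic_intros weierstrass_p_holomorphic pole_sum_holomorphic
         simp: weierstrass_p_periodic pole_sum_periodic)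
  then show "6 * pole_sum L 4 z = 6 * weierstrass_p L z ^ 2 - 30 * lattice_G L 4"
    by (simp add: algebra_simps)
  have "4 * pole_sum L 3 z ^ 2 - 4 * weierstrass_p L z ^ 3 + 60 * lattice_G L 4 * weierstrass_p L z
      + 140 * lattice_G L 6 = 0"
    by (rule elliptic_vanish[OF _ _ differential_equations_limits(2) assms])
       (auto intro!: holomorphic_intros weierstrass_p_holomorphic pole_sum_holomorphic
         simp: weierstrass_p_periodic pole_sum_periodic)
  then show "4 * pole_sum L 3 z ^ 2 = 4 * weierstrass_p L z ^ 3 - 60 * lattice_G L 4 * weierstrass_p L z
      - 140 * lattice_G L 6"
    by (simp add: algebra_simps)
qed

end

section \<open>Recovering a lattice from its Eisenstein sums of weights 4 and 6\<close>

lemma weierstrass_ode_unique: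
  fixes f g :: "complex \<Rightarrow> complex"
  assumes S: "open S" "connected S" "z0 \<in> S"
    and hol: "f holomorphic_on S" "g holomorphic_on S"
    and f2: "\<And>z. z \<in> S \<Longrightarrow> deriv (deriv f) z = 6 * f z ^ 2 + c"
    and g2: "\<And>z. z \<in> S \<Longrightarrow> deriv (deriv g) z = 6 * g z ^ 2 + c"
    and init: "f z0 = g z0" "deriv f z0 = deriv g z0" and "z \<in> S"
  shows "f z = g z"
proof -
  \<comment> \<open>The difference of squares factors, so \<open>h\<close> solves the linear
    equation \<open>h'' = k h\<close>. The Leibniz rule then kills all derivatives of
    \<open>h\<close> at \<open>z0\<close>, and the identity theorem applies.\<close>
  define h k where "h = (\<lambda>z. f z - g z)" and "k = (\<lambda>z. 6 * (f z + g z))"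
  have hk: "h holomorphic_on S" "k holomorphic_on S"
    unfolding h_def k_def by (intro holomorphic_intros hol)+
  have df: "f field_differentiable (at z)" "g field_differentiable (at z)"
    "deriv f field_differentiable (at z)" "deriv g field_differentiable (at z)" if "z \<in> S" for z
    using hol S that holomorphic_deriv by (meson holomorphic_on_imp_differentiable_at)+
  have h1: "deriv h z = deriv f z - deriv g z" if "z \<in> S" for z
    unfolding h_def using df that by (simp add: deriv_diff)
  have h2: "deriv (deriv h) z = k z * h z" if z: "z \<in> S" for z
  proof -
    have "deriv (deriv h) z = deriv (\<lambda>z. deriv f z - deriv g z) z"
      by (rule deriv_cong_ev) (use eventually_nhds_in_open[OF S(1) z] h1 in \<open>auto elim!: eventually_mono\<close>)
    also have "\<dots> = deriv (deriv f) z - deriv (deriv g) z"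
      using df z by (simp add: deriv_diff)
    also have "\<dots> = k z * h z"
      unfolding f2[OF z] g2[OF z] h_def k_def by (simp add: power2_eq_square algebra_simps)
    finally show ?thesis .
  qed
  have "(deriv ^^ n) h z0 = 0" for n
  proof (induction n rule: less_induct)
    case (less n)
    consider "n = 0" | "n = 1" | m where "n = Suc (Suc m)"
      by (metis One_nat_def not0_implies_Suc)
    then show ?case
    proof cases
      case 3
      have "(deriv ^^ n) h z0 = (deriv ^^ m) (deriv (deriv h)) z0"
        unfolding 3 by (simp only: funpow_Suc_right o_def)
      also have "\<dots> = (deriv ^^ m) (\<lambda>z. k z * h z) z0"
        by (rule higher_deriv_cong_ev)
           (use eventually_nhds_in_open[OF S(1) S(3)] h2 in \<open>auto elim!: eventually_mono\<close>)
      also have "\<dots> = (\<Sum>i = 0..m. of_nat (m choose i) * (deriv ^^ i) k z0 * (deriv ^^ (m - i)) h z0)"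
        by (rule higher_deriv_mult[OF hk(2,1) S(1,3)])
      also have "\<dots> = 0"
        by (intro sum.neutral ballI) (use less 3 in auto)
      finally show ?thesis .
    qed (use init h1 S(3) in \<open>auto simp: h_def\<close>)
  qed
  from holomorphic_fun_eq_0_on_connected[OF hk(1) S(1,2) this S(3) \<open>z \<in> S\<close>]
  show ?thesis by (simp add: h_def)
qed

context period_lattice
begin

lemma weierstrass_p_pole: "((\<lambda>t. t ^ 2 * weierstrass_p L t) \<longlongrightarrow> 1) (at 0)"
proof -
  obtain r R where r: "r > 0" "R holomorphic_on ball 0 r" "L \<inter> ball 0 r = {0}"
    "\<And>z. z \<in> ball 0 r - {0} \<Longrightarrow>
      weierstrass_p L z = 1 / z ^ 2 + 3 * lattice_G L 4 * z ^ 2 + 5 * lattice_G L 6 * z ^ 4 + z ^ 6 * R z"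
    using weierstrass_p_local by blast
  have "isCont R 0"
    using r(1,2) by (meson centre_in_ball continuous_on_eq_continuous_at holomorphic_on_imp_continuous_on open_ball)
  then have "isCont (\<lambda>t. 1 + 3 * lattice_G L 4 * t ^ 4 + 5 * lattice_G L 6 * t ^ 6 + t ^ 8 * R t) 0"
    by (intro continuous_intros)
  then have lim: "((\<lambda>t. 1 + 3 * lattice_G L 4 * t ^ 4 + 5 * lattice_G L 6 * t ^ 6 + t ^ 8 * R t) \<longlongrightarrow> 1) (at 0)"
    by (simp add: isCont_def)
  have ev: "eventually (\<lambda>t. t \<in> ball 0 r - {0}) (at 0)"
    using eventually_at_in_open[of "ball 0 r" 0] r(1) by simp
  have "1 + 3 * lattice_G L 4 * t ^ 4 + 5 * lattice_G L 6 * t ^ 6 + t ^ 8 * R t = t ^ 2 * weierstrass_p L t"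
    if "t \<in> ball 0 r - {0}" for t
    unfolding r(4)[OF that] using that by (simp add: field_simps)
  then show ?thesis
    by (rule Lim_transform_eventually[OF lim eventually_mono[OF ev]])
qed

text \<open>If the value \<open>c\<close> were omitted, \<open>1 / (p - c)\<close> would be elliptic
  without poles and tend to 0 at the origin, hence vanish identically.\<close>

lemma weierstrass_p_surj:
  obtains z where "z \<notin> L" "weierstrass_p L z = c"
proof -
  have "L \<noteq> UNIV"
    using countable uncountable_UNIV_complex by auto
  then obtain u where u: "u \<notin> L" by auto
  {
    assume *: "\<And>z. z \<notin> L \<Longrightarrow> weierstrass_p L z \<noteq> c"
    have "((\<lambda>t. t ^ 2 / (t ^ 2 * weierstrass_p L t - t ^ 2 * c)) \<longlongrightarrow> 0 ^ 2 / (1 - 0 ^ 2 * c)) (at 0)"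
      by (intro tendsto_intros weierstrass_p_pole) auto
    moreover have "eventually (\<lambda>t. t ^ 2 / (t ^ 2 * weierstrass_p L t - t ^ 2 * c) = 1 / (weierstrass_p L t - c)) (at 0)"
    proof (rule eventually_mono[OF eventually_at_in_open[of "- (L - {0})" 0]])
      show "open (- (L - {0}))" by (rule open_compl) auto
      fix t assume "t \<in> - (L - {0}) - {0}"
      then have "t \<noteq> 0" by auto
      then show "t ^ 2 / (t ^ 2 * weierstrass_p L t - t ^ 2 * c) = 1 / (weierstrass_p L t - c)"
        by (simp add: right_diff_distrib [symmetric])
    qed auto
    ultimately have lim: "((\<lambda>t. 1 / (weierstrass_p L t - c)) \<longlongrightarrow> 0) (at 0)"
      using Lim_transform_eventually by fastforce
    have "1 / (weierstrass_p L u - c) = 0"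
      by (rule elliptic_vanish[OF _ _ lim u])
         (use * in \<open>auto intro!: holomorphic_intros weierstrass_p_holomorphic simp: weierstrass_p_periodic\<close>)
    with *[OF u] have False by simp
  }
  then show thesis using that by blast
qed

end

text \<open>The two translated functions solve the same second-order equation with the same initial
  data, so they agree off their poles, a countable set with connected complement. Starting from
  regular points \<open>u\<close> and \<open>v\<close> avoids an initial value problem at a pole. If
  \<open>v + z0\<close> were no pole, multiplying by \<open>t^2\<close> near \<open>z0\<close> would
  give the limit 0 on one side and 1 on the other.\<close>

lemma weierstrass_p_poles_subset:
  assumes "period_lattice L" "period_lattice M" and G4: "lattice_G L 4 = lattice_G M 4"
    and u: "u \<notin> L" "v \<notin> M"
    and eq: "weierstrass_p L u = weierstrass_p M v" "pole_sum L 3 u = pole_sum M 3 v"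
    and z0: "u + z0 \<in> L"
  shows "v + z0 \<in> M"
proof (rule ccontr)
  assume v: "v + z0 \<notin> M"
  interpret L: period_lattice L by fact
  interpret M: period_lattice M by fact
  define T where "T = (\<lambda>x. x - u) ` L \<union> (\<lambda>x. x - v) ` M"
  have T: "z \<in> T \<longleftrightarrow> u + z \<in> L \<or> v + z \<in> M" for z
    by (force simp: T_def image_iff algebra_simps)
  have openT: "open (- T)"
  proof -
    have "- T = (\<lambda>x. - u + x) ` (- L) \<inter> (\<lambda>x. - v + x) ` (- M)"
      by (force simp: T image_iff algebra_simps)
    then show ?thesis
      by (simp only: open_Int open_translation L.open_compl M.open_compl subset_refl)
  qed
  have connT: "connected (- T)"
    unfolding Compl_eq_Diff_UNIV
    by (intro connected_open_diff_countable) (auto simp: T_def L.countable M.countable)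
  define f g where "f = (\<lambda>z. weierstrass_p L (u + z))" and "g = (\<lambda>z. weierstrass_p M (v + z))"
  have f1: "(f has_field_derivative -2 * pole_sum L 3 (u + z)) (at z)"
    and f2: "((\<lambda>z. -2 * pole_sum L 3 (u + z)) has_field_derivative 6 * pole_sum L 4 (u + z)) (at z)"
    if "u + z \<notin> L" for z
  proof -
    have shift: "((\<lambda>z. u + z) has_field_derivative 1) (at z)" by (auto intro!: derivative_eq_intros)
    show "(f has_field_derivative -2 * pole_sum L 3 (u + z)) (at z)"
      using DERIV_chain2[OF L.weierstrass_p_has_field_derivative[OF that] shift] by (simp add: f_def)
    show "((\<lambda>z. -2 * pole_sum L 3 (u + z)) has_field_derivative 6 * pole_sum L 4 (u + z)) (at z)"
      using DERIV_cmult[OF DERIV_chain2[OF L.pole_sum_has_field_derivative[OF that, of 3] shift], of "-2"]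
      by simp
  qed
  have g1: "(g has_field_derivative -2 * pole_sum M 3 (v + z)) (at z)"
    and g2: "((\<lambda>z. -2 * pole_sum M 3 (v + z)) has_field_derivative 6 * pole_sum M 4 (v + z)) (at z)"
    if "v + z \<notin> M" for z
  proof -
    have shift: "((\<lambda>z. v + z) has_field_derivative 1) (at z)" by (auto intro!: derivative_eq_intros)
    show "(g has_field_derivative -2 * pole_sum M 3 (v + z)) (at z)"
      using DERIV_chain2[OF M.weierstrass_p_has_field_derivative[OF that] shift] by (simp add: g_def)
    show "((\<lambda>z. -2 * pole_sum M 3 (v + z)) has_field_derivative 6 * pole_sum M 4 (v + z)) (at z)"
      using DERIV_cmult[OF DERIV_chain2[OF M.pole_sum_has_field_derivative[OF that, of 3] shift], of "-2"]
      by simp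
  qed
  have fg: "f z = g z" if "z \<in> - T" for z
  proof (rule weierstrass_ode_unique[OF openT connT, of 0 f g "- 30 * lattice_G L 4"])
    show "f holomorphic_on - T"
      using f1 unfolding holomorphic_on_def field_differentiable_def
      by (metis ComplD DERIV_subset T subset_UNIV)
    show "g holomorphic_on - T"
      using g1 unfolding holomorphic_on_def field_differentiable_def
      by (metis ComplD DERIV_subset T subset_UNIV)
    show "deriv (deriv f) z = 6 * f z ^ 2 + - 30 * lattice_G L 4" if z: "z \<in> - T" for z
    proof -
      have "deriv (deriv f) z = deriv (\<lambda>z. -2 * pole_sum L 3 (u + z)) z"
        by (rule deriv_cong_ev) (use eventually_nhds_in_open[OF openT z] f1 T in
            \<open>auto elim!: eventually_mono intro!: DERIV_imp_deriv\<close>)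
      also have "\<dots> = 6 * pole_sum L 4 (u + z)"
        using f2[of z] z T by (auto intro!: DERIV_imp_deriv)
      also have "\<dots> = 6 * f z ^ 2 + - 30 * lattice_G L 4"
        using L.weierstrass_differential_equations(1)[of "u + z"] z T by (simp add: f_def)
      finally show ?thesis .
    qed
    show "deriv (deriv g) z = 6 * g z ^ 2 + - 30 * lattice_G L 4" if z: "z \<in> - T" for z
    proof -
      have "deriv (deriv g) z = deriv (\<lambda>z. -2 * pole_sum M 3 (v + z)) z"
        by (rule deriv_cong_ev) (use eventually_nhds_in_open[OF openT z] g1 T in
            \<open>auto elim!: eventually_mono intro!: DERIV_imp_deriv\<close>)
      also have "\<dots> = 6 * pole_sum M 4 (v + z)"
        using g2[of z] z T by (auto intro!: DERIV_imp_deriv)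
      also have "\<dots> = 6 * g z ^ 2 + - 30 * lattice_G L 4"
        using M.weierstrass_differential_equations(1)[of "v + z"] z T by (simp add: g_def G4)
      finally show ?thesis .
    qed
    show "f 0 = g 0" using eq by (simp add: f_def g_def)
    show "deriv f 0 = deriv g 0"
      using f1[of 0] g1[of 0] u eq by (simp add: DERIV_imp_deriv)
  qed (use that u T in auto)
  have ev: "eventually (\<lambda>t. t \<in> - (L - {0}) \<inter> (\<lambda>x. - (v + z0) + x) ` (- M) - {0}) (at 0)"
  proof (rule eventually_at_in_open)
    show "open (- (L - {0}) \<inter> (\<lambda>x. - (v + z0) + x) ` (- M))"
      by (intro open_Int open_translation L.open_compl M.open_compl) auto
    show "0 \<in> - (L - {0}) \<inter> (\<lambda>x. - (v + z0) + x) ` (- M)"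
      using v by (auto simp: image_iff intro!: bexI[of _ "v + z0"])
  qed
  have eqt: "t ^ 2 * weierstrass_p M (v + z0 + t) = t ^ 2 * weierstrass_p L t"
    if "t \<in> - (L - {0}) \<inter> (\<lambda>x. - (v + z0) + x) ` (- M) - {0}" for t
  proof -
    have t: "t \<notin> L" "v + z0 + t \<notin> M" using that by auto
    then have "z0 + t \<in> - T" using z0 L.add_left_iff[of "u + z0" t] by (simp add: T add.assoc)
    from fg[OF this] have "weierstrass_p L (t + (u + z0)) = weierstrass_p M (v + z0 + t)"
      by (simp add: f_def g_def add_ac)
    then show ?thesis using L.weierstrass_p_periodic[OF z0 t(1)] by simp
  qed
  have "isCont (weierstrass_p M) (v + z0 + 0)"
    using M.weierstrass_p_has_field_derivative[of "v + z0 + 0"] v by (auto intro!: DERIV_isCont)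
  then have "isCont (\<lambda>t. weierstrass_p M (v + z0 + t)) 0"
    by (rule isCont_o2[rotated]) (intro continuous_intros)
  then have "isCont (\<lambda>t. t ^ 2 * weierstrass_p M (v + z0 + t)) 0"
    by (intro continuous_intros)
  then have "((\<lambda>t. t ^ 2 * weierstrass_p M (v + z0 + t)) \<longlongrightarrow> 0) (at 0)"
    by (simp add: isCont_def)
  then have "((\<lambda>t. t ^ 2 * weierstrass_p L t) \<longlongrightarrow> 0) (at 0)"
    by (rule Lim_transform_eventually) (rule eventually_mono[OF ev eqt])
  with L.weierstrass_p_pole show False
    using LIM_unique zero_neq_one by blast
qed

text \<open>Surjectivity supplies a point where the second function takes the value that the first
  has at \<open>u\<close>. The first-order equation then matches the derivatives up to sign, and
  passing to the opposite point repairs the sign. Equal pole sets of the translates give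
  \<open>L - u = M - v\<close>, and \<open>0 \<in> L\<close> removes the shift.\<close>

lemma lattice_eqI:
  assumes "period_lattice L" "period_lattice M"
    and G: "lattice_G L 4 = lattice_G M 4" "lattice_G L 6 = lattice_G M 6"
  shows "L = M"
proof -
  interpret L: period_lattice L by fact
  interpret M: period_lattice M by fact
  obtain u where u: "u \<notin> L" by (rule L.weierstrass_p_surj[of 0])
  obtain v' where v': "v' \<notin> M" "weierstrass_p M v' = weierstrass_p L u"
    by (rule M.weierstrass_p_surj)
  have "(pole_sum L 3 u) ^ 2 = (pole_sum M 3 v') ^ 2"
    using L.weierstrass_differential_equations(2)[OF u] M.weierstrass_differential_equations(2)[OF v'(1)] v' G
    by (metis mult_left_cancel zero_neq_numeral)
  then consider "pole_sum L 3 u = pole_sum M 3 v'" | "pole_sum L 3 u = pole_sum M 3 (- v')"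
    using M.pole_sum_minus[of 3 v'] by (auto simp: power2_eq_iff)
  then obtain v where v: "v \<notin> M" "weierstrass_p M v = weierstrass_p L u" "pole_sum L 3 u = pole_sum M 3 v"
  proof cases
    case 1
    then show ?thesis using v' by (intro that[of v']) auto
  next
    case 2
    then show ?thesis using v' M.weierstrass_p_even[of v'] by (intro that[of "- v'"]) auto
  qed
  have sub: "u + z \<in> L \<longleftrightarrow> v + z \<in> M" for z
    using weierstrass_p_poles_subset[OF assms(1,2) G(1) u v(1), of z]
      weierstrass_p_poles_subset[OF assms(2,1) G(1)[symmetric] v(1) u, of z] v by auto
  have "v - u \<in> M" using sub[of "- u"] by simp
  have "w \<in> L \<longleftrightarrow> w \<in> M" for w
    using sub[of "w - u"] M.add_left_iff[OF \<open>v - u \<in> M\<close>, of w] by (simp add: algebra_simps)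
  then show ?thesis by auto
qed

section \<open>Two-isogenies and homotheties\<close>

text \<open>If \<open>\<omega>\<close> lies outside \<open>L\<close> and \<open>2 * \<omega>\<close>
  inside, this is an overlattice of index 2; the projection of the tori is a 2-isogeny with kernel
  generated by \<open>\<omega>\<close>.\<close>

definition superlattice :: "complex set \<Rightarrow> complex \<Rightarrow> complex set" where
  "superlattice L \<omega> = L \<union> (\<lambda>w. w + \<omega>) ` L"

context period_lattice
begin

lemma pole_sum_3_half_period:
  assumes "2 * \<omega> \<in> L"
  shows "pole_sum L 3 \<omega> = 0"
proof -
  have "pole_sum L 3 \<omega> = pole_sum L 3 (- \<omega>)"
    using pole_sum_periodic[OF assms, of 3 "- \<omega>"] by simp
  also have "\<dots> = - pole_sum L 3 \<omega>" by (simp add: pole_sum_minus)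
  finally show ?thesis by simp
qed

lemma half_period_cubic:
  assumes "\<omega> \<notin> L" "2 * \<omega> \<in> L"
  shows "4 * weierstrass_p L \<omega> ^ 3 - 60 * lattice_G L 4 * weierstrass_p L \<omega> - 140 * lattice_G L 6 = 0"
  using weierstrass_differential_equations(2)[OF assms(1)] pole_sum_3_half_period[OF assms(2)] by simp

text \<open>The derivative vanishes at every half-period, so equal values would mean equal initial
  data and identify the poles of the two translates.\<close>

lemma half_period_values_distinct:
  assumes "\<omega> \<notin> L" "2 * \<omega> \<in> L" "\<omega>' \<notin> L" "2 * \<omega>' \<in> L" "\<omega> - \<omega>' \<notin> L"
  shows "weierstrass_p L \<omega> \<noteq> weierstrass_p L \<omega>'"
proof
  assume "weierstrass_p L \<omega> = weierstrass_p L \<omega>'"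
  from weierstrass_p_poles_subset[OF period_lattice_axioms period_lattice_axioms refl assms(1,3) this,
      of "- \<omega>"] assms(2,4)
  have "\<omega>' - \<omega> \<in> L" by (simp add: pole_sum_3_half_period)
  then show False using assms(5) uminus[of "\<omega>' - \<omega>"] by simp
qed

lemma pole_sum_4:
  assumes "z \<notin> L"
  shows "pole_sum L 4 z = weierstrass_p L z ^ 2 - 5 * lattice_G L 4"
proof -
  have "6 * pole_sum L 4 z = 6 * (weierstrass_p L z ^ 2 - 5 * lattice_G L 4)"
    using weierstrass_differential_equations(1)[OF assms] by (simp add: algebra_simps)
  then show ?thesis by (metis mult_left_cancel zero_neq_numeral)
qed

text \<open>Differentiating the formula for \<open>pole_sum L 4\<close> gives
  \<open>pole_sum L 5\<close> as the product of \<open>p\<close> and \<open>pole_sum L 3\<close>;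
  differentiating once more reaches weight 6.\<close>

lemma pole_sum_6:
  assumes "z \<notin> L"
  shows "5 * pole_sum L 6 z = 2 * pole_sum L 3 z ^ 2 + 3 * weierstrass_p L z * pole_sum L 4 z"
proof -
  have op: "open (- L)" by (rule open_compl) simp
  have S5: "pole_sum L 5 z = weierstrass_p L z * pole_sum L 3 z" if z: "z \<notin> L" for z
  proof -
    have "(pole_sum L 4 has_field_derivative - 4 * pole_sum L 5 z) (at z)"
      using pole_sum_has_field_derivative[OF z, of 4] by simp
    moreover have "((\<lambda>z. weierstrass_p L z ^ 2 - 5 * lattice_G L 4) has_field_derivative
        - 4 * (weierstrass_p L z * pole_sum L 3 z)) (at z)"
      by (auto intro!: derivative_eq_intros weierstrass_p_has_field_derivative z)
    then have "(pole_sum L 4 has_field_derivative - 4 * (weierstrass_p L z * pole_sum L 3 z)) (at z)"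
      by (rule has_field_derivative_transform_within_open[OF _ op]) (use z pole_sum_4 in auto)
    ultimately have "- 4 * pole_sum L 5 z = - 4 * (weierstrass_p L z * pole_sum L 3 z)"
      by (rule DERIV_unique)
    then show ?thesis by simp
  qed
  have "(pole_sum L 5 has_field_derivative - 5 * pole_sum L 6 z) (at z)"
    using pole_sum_has_field_derivative[OF assms, of 5] by simp
  moreover have "((\<lambda>z. weierstrass_p L z * pole_sum L 3 z) has_field_derivative
      - (2 * pole_sum L 3 z ^ 2 + 3 * weierstrass_p L z * pole_sum L 4 z)) (at z)"
    using pole_sum_has_field_derivative[OF assms, of 3]
    by (auto intro!: derivative_eq_intros weierstrass_p_has_field_derivative assms
        simp: power2_eq_square algebra_simps)
  then have "(pole_sum L 5 has_field_derivative
      - (2 * pole_sum L 3 z ^ 2 + 3 * weierstrass_p L z * pole_sum L 4 z)) (at z)"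
    by (rule has_field_derivative_transform_within_open[OF _ op]) (use assms S5 in auto)
  ultimately have "- 5 * pole_sum L 6 z = - (2 * pole_sum L 3 z ^ 2 + 3 * weierstrass_p L z * pole_sum L 4 z)"
    by (rule DERIV_unique)
  then show ?thesis by (metis minus_mult_left minus_equation_iff)
qed

lemma superlattice_disjoint: "\<omega> \<notin> L \<Longrightarrow> L \<inter> (\<lambda>w. w + \<omega>) ` L = {}"
  by auto

lemma lattice_G_superlattice:
  assumes "\<omega> \<notin> L" "k \<ge> 3" "even k"
  shows "lattice_G (superlattice L \<omega>) k = lattice_G L k + pole_sum L k \<omega>"
proof -
  have inj: "inj_on (\<lambda>w. w + \<omega>) L" by (auto simp: inj_on_def)
  have "superlattice L \<omega> - {0} = (L - {0}) \<union> (\<lambda>w. w + \<omega>) ` L"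
  proof -
    have "0 \<notin> (\<lambda>w. w + \<omega>) ` L"
      using superlattice_disjoint[OF assms(1)] zero by blast
    then show ?thesis by (auto simp: superlattice_def)
  qed
  moreover have sum: "(\<lambda>w. 1 / w ^ k) summable_on (\<lambda>w. w + \<omega>) ` L"
    "infsum (\<lambda>w. 1 / w ^ k) ((\<lambda>w. w + \<omega>) ` L) = pole_sum L k \<omega>"
  proof -
    have "((\<lambda>w. 1 / (w + \<omega>) ^ k) has_sum pole_sum L k \<omega>) L"
      by (subst has_sum_reindex_bij_witness[of L uminus uminus L "\<lambda>w. 1 / (\<omega> - w) ^ k"])
         (use summable_inverse_power[of L \<omega> k] assms in \<open>auto simp: pole_sum_def add.commute\<close>)
    then have "((\<lambda>w. 1 / w ^ k) has_sum pole_sum L k \<omega>) ((\<lambda>w. w + \<omega>) ` L)"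
      by (simp add: has_sum_reindex[OF inj] o_def)
    then show "(\<lambda>w. 1 / w ^ k) summable_on (\<lambda>w. w + \<omega>) ` L"
      "infsum (\<lambda>w. 1 / w ^ k) ((\<lambda>w. w + \<omega>) ` L) = pole_sum L k \<omega>"
      by (auto simp: infsumI summable_on_def)
  qed
  moreover have "(\<lambda>w. 1 / w ^ k) summable_on (L - {0})"
    using assms(2) by (rule summable_inverse_power_0)
  ultimately show ?thesis
    using superlattice_disjoint[OF assms(1)]
    by (simp add: lattice_G_def infsum_Un_disjoint disjoint_iff)
qed

lemma lattice_G_4_superlattice:
  assumes "\<omega> \<notin> L" "2 * \<omega> \<in> L"
  shows "lattice_G (superlattice L \<omega>) 4 = weierstrass_p L \<omega> ^ 2 - 4 * lattice_G L 4"
  using assms by (simp add: lattice_G_superlattice pole_sum_4)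

lemma lattice_G_6_superlattice:
  assumes "\<omega> \<notin> L" "2 * \<omega> \<in> L"
  shows "lattice_G (superlattice L \<omega>) 6 = 22 * lattice_G L 6 + 6 * lattice_G L 4 * weierstrass_p L \<omega>"
proof -
  let ?e = "weierstrass_p L \<omega>"
  have "5 * pole_sum L 6 \<omega> = 3 * ?e ^ 3 - 15 * lattice_G L 4 * ?e"
    unfolding pole_sum_6[OF assms(1)] pole_sum_3_half_period[OF assms(2)] pole_sum_4[OF assms(1)]
    by (simp add: power2_eq_square power3_eq_cube algebra_simps)
  moreover have "4 * (5 * lattice_G (superlattice L \<omega>) 6) = 20 * lattice_G L 6 + 4 * (5 * pole_sum L 6 \<omega>)"
    using assms by (simp add: lattice_G_superlattice)
  ultimately have "20 * lattice_G (superlattice L \<omega>) 6 =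
      20 * lattice_G L 6 + 3 * (4 * ?e ^ 3) - 60 * lattice_G L 4 * ?e"
    by simp
  also have "4 * ?e ^ 3 = 60 * lattice_G L 4 * ?e + 140 * lattice_G L 6"
    using half_period_cubic[OF assms] by (simp add: algebra_simps)
  finally have "20 * lattice_G (superlattice L \<omega>) 6 = 20 * (22 * lattice_G L 6 + 6 * lattice_G L 4 * ?e)"
    by (simp add: algebra_simps)
  then show ?thesis by (metis mult_left_cancel zero_neq_numeral)
qed

end

section \<open>The modular polynomial of level 2\<close>

definition lattice_j :: "complex set \<Rightarrow> complex" where
  "lattice_j L = 1728 * (60 * lattice_G L 4) ^ 3 /
     ((60 * lattice_G L 4) ^ 3 - 27 * (140 * lattice_G L 6) ^ 2)"

text \<open>The classical modular polynomial of level \<open>2\<close>.\<close>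

definition Phi2 :: "'a :: comm_ring_1 \<Rightarrow> 'a \<Rightarrow> 'a" where
  "Phi2 x y = x ^ 3 + y ^ 3 - x ^ 2 * y ^ 2 + 1488 * (x ^ 2 * y + x * y ^ 2) - 162000 * (x ^ 2 + y ^ 2)
     + 40773375 * (x * y) + 8748000000 * (x + y) - 157464000000000"

lemma Phi2_commute: "Phi2 x y = Phi2 y x"
  by (simp add: Phi2_def algebra_simps)

text \<open>Vieta's formulas: subtracting two of the equations and cancelling a difference of roots
  lowers the degree, and repeating this gives the sum of the roots.\<close>

lemma depressed_cubic_roots:
  fixes e1 e2 e3 g2 g3 :: complex
  assumes "4 * e1 ^ 3 - g2 * e1 - g3 = 0" "4 * e2 ^ 3 - g2 * e2 - g3 = 0" "4 * e3 ^ 3 - g2 * e3 - g3 = 0"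
    and "e1 \<noteq> e2" "e1 \<noteq> e3" "e2 \<noteq> e3"
  shows "e1 + e2 + e3 = 0" "g2 = - 4 * (e1 * e2 + e1 * e3 + e2 * e3)" "g3 = 4 * e1 * e2 * e3"
proof -
  have "(e1 - e2) * (4 * (e1 ^ 2 + e1 * e2 + e2 ^ 2) - g2) = 0"
    using assms(1,2) by algebra
  then have g2: "4 * (e1 ^ 2 + e1 * e2 + e2 ^ 2) = g2" using assms(4) by simp
  have "(e1 - e3) * (4 * (e1 ^ 2 + e1 * e3 + e3 ^ 2) - g2) = 0"
    using assms(1,3) by algebra
  then have "4 * (e1 ^ 2 + e1 * e3 + e3 ^ 2) = g2" using assms(5) by simp
  moreover have "4 * ((e2 - e3) * (e1 + e2 + e3)) =
      4 * (e1 ^ 2 + e1 * e2 + e2 ^ 2) - 4 * (e1 ^ 2 + e1 * e3 + e3 ^ 2)"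
    by (simp add: power2_eq_square algebra_simps)
  ultimately have "4 * ((e2 - e3) * (e1 + e2 + e3)) = 0" using g2 by simp
  then show s: "e1 + e2 + e3 = 0" using assms(6) by simp
  have e3: "e3 = - e1 - e2" using s by (simp add: algebra_simps eq_neg_iff_add_eq_0)
  show "g2 = - 4 * (e1 * e2 + e1 * e3 + e2 * e3)"
    unfolding e3 g2 [symmetric] by algebra
  have "g3 = 4 * e1 ^ 3 - g2 * e1" using assms(1) by simp
  then show "g3 = 4 * e1 * e2 * e3" unfolding e3 g2 [symmetric] by algebra
qed

text \<open>The curve cut out by \<open>Phi2\<close> is rational, being a model of the modular curve
  \<open>X_0(2)\<close>, and \<open>h\<close> is a parameter on it. Replacing \<open>h\<close> by
  \<open>1 / h\<close> swaps the two arguments, which is the dual isogeny.\<close>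

lemma Phi2_parametrization:
  fixes h :: complex
  assumes "h \<noteq> 0"
  shows "Phi2 (64 * (h + 4) ^ 3 / h ^ 2) (64 * (4 * h + 1) ^ 3 / h) = 0"
proof -
  define i where "i = 1 / h"
  have "h * i = 1" using assms by (simp add: i_def)
  have "64 * (h + 4) ^ 3 / h ^ 2 = 64 * (h + 12 + 48 * i + 64 * i ^ 2)"
    "64 * (4 * h + 1) ^ 3 / h = 64 * (64 * h ^ 2 + 48 * h + 12 + i)"
    using assms by (simp_all add: i_def field_simps eval_nat_numeral)
  then show ?thesis unfolding Phi2_def using \<open>h * i = 1\<close> by algebra
qed

text \<open>Differences of the roots are the convenient coordinates, since the discriminants become
  monomials in them. In the last two identities \<open>60 * e1 ^ 2 - 4 * g2\<close> and
  \<open>22 * g3 + 14 * g2 * e1\<close> are the invariants \<open>g2\<close> and \<open>g3\<close>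
  of the overlattice belonging to \<open>e1\<close>.\<close>

lemma discriminant_roots:
  fixes A B C e1 e2 e3 g2 g3 :: complex
  assumes "e1 + e2 + e3 = 0" "g2 = - 4 * (e1 * e2 + e1 * e3 + e2 * e3)" "g3 = 4 * e1 * e2 * e3"
    and "A = e2 - e3" "B = e3 - e1" "C = e1 - e2"
  shows "g2 ^ 3 - 27 * g3 ^ 2 = 16 * (A * B * C) ^ 2" "3 * g2 = 4 * (A ^ 2 - B * C)"
    "3 * (60 * e1 ^ 2 - 4 * g2) = 4 * (A ^ 2 - 16 * B * C)"
    "(60 * e1 ^ 2 - 4 * g2) ^ 3 - 27 * (22 * g3 + 14 * g2 * e1) ^ 2 = - 256 * A ^ 4 * B * C"
proof -
  have e3: "e3 = - e1 - e2" using assms(1) by (simp add: algebra_simps eq_neg_iff_add_eq_0)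
  show "g2 ^ 3 - 27 * g3 ^ 2 = 16 * (A * B * C) ^ 2" "3 * g2 = 4 * (A ^ 2 - B * C)"
    "3 * (60 * e1 ^ 2 - 4 * g2) = 4 * (A ^ 2 - 16 * B * C)"
    "(60 * e1 ^ 2 - 4 * g2) ^ 3 - 27 * (22 * g3 + 14 * g2 * e1) ^ 2 = - 256 * A ^ 4 * B * C"
    unfolding assms(2-6) e3 by algebra+
qed

text \<open>The right-hand side is minus the coefficient of \<open>y^2\<close> in
  \<open>Phi2 x y\<close>, that is, the sum of its roots in \<open>y\<close>. It is verified
  directly because the three isogenous values may coincide, and then the vanishing of
  \<open>Phi2\<close> at each of them would not determine their sum.\<close>

lemma isogeny_trace_identity:
  fixes A B C :: complex
  assumes "A + B + C = 0" "A \<noteq> 0" "B \<noteq> 0" "C \<noteq> 0" 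
    and x: "x = 256 * (A ^ 2 - B * C) ^ 3 / (A * B * C) ^ 2"
  shows "- 16 * (A ^ 2 - 16 * B * C) ^ 3 / (A ^ 4 * B * C) - 16 * (B ^ 2 - 16 * C * A) ^ 3 / (B ^ 4 * C * A)
     - 16 * (C ^ 2 - 16 * A * B) ^ 3 / (C ^ 4 * A * B) = x ^ 2 - 1488 * x + 162000"
proof -
  define T P where "T = A ^ 2 - B * C" and "P = A * B * C"
  have "P \<noteq> 0" using assms by (simp add: P_def)
  have C: "C = - A - B" using assms(1) by (simp add: algebra_simps eq_neg_iff_add_eq_0)
  have *: "- 16 * (A ^ 2 - 16 * B * C) ^ 3 * (B * C) ^ 3 - 16 * (B ^ 2 - 16 * C * A) ^ 3 * (C * A) ^ 3
     - 16 * (C ^ 2 - 16 * A * B) ^ 3 * (A * B) ^ 3 = 65536 * T ^ 6 - 380928 * T ^ 3 * P ^ 2 + 162000 * P ^ 4"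
    unfolding C T_def P_def by algebra
  have 1: "- 16 * (A ^ 2 - 16 * B * C) ^ 3 / (A ^ 4 * B * C) = - 16 * (A ^ 2 - 16 * B * C) ^ 3 * (B * C) ^ 3 / P ^ 4"
    "16 * (B ^ 2 - 16 * C * A) ^ 3 / (B ^ 4 * C * A) = 16 * (B ^ 2 - 16 * C * A) ^ 3 * (C * A) ^ 3 / P ^ 4"
    "16 * (C ^ 2 - 16 * A * B) ^ 3 / (C ^ 4 * A * B) = 16 * (C ^ 2 - 16 * A * B) ^ 3 * (A * B) ^ 3 / P ^ 4"
    using assms(2-4) by (simp_all add: P_def frac_eq_eq power_mult_distrib) (simp_all add: eval_nat_numeral)
  have 2: "x ^ 2 - 1488 * x + 162000 = (65536 * T ^ 6 - 380928 * T ^ 3 * P ^ 2 + 162000 * P ^ 4) / P ^ 4"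
    unfolding x T_def [symmetric] P_def [symmetric] using \<open>P \<noteq> 0\<close>
    by (simp add: field_simps)
  show ?thesis unfolding 1 2 diff_divide_distrib [symmetric] * ..
qed

theorem (in period_lattice) lattice_j_two_isogeny:
  assumes half: "\<omega>1 \<notin> L" "2 * \<omega>1 \<in> L" "\<omega>2 \<notin> L" "2 * \<omega>2 \<in> L" "\<omega>3 \<notin> L" "2 * \<omega>3 \<in> L"
    and diff: "\<omega>1 - \<omega>2 \<notin> L" "\<omega>1 - \<omega>3 \<notin> L" "\<omega>2 - \<omega>3 \<notin> L"
  shows "(60 * lattice_G L 4) ^ 3 - 27 * (140 * lattice_G L 6) ^ 2 \<noteq> 0"
    "Phi2 (lattice_j L) (lattice_j (superlattice L \<omega>1)) = 0"
    "Phi2 (lattice_j L) (lattice_j (superlattice L \<omega>2)) = 0"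
    "Phi2 (lattice_j L) (lattice_j (superlattice L \<omega>3)) = 0"
    "lattice_j (superlattice L \<omega>1) + lattice_j (superlattice L \<omega>2) + lattice_j (superlattice L \<omega>3) =
       lattice_j L ^ 2 - 1488 * lattice_j L + 162000"
proof -
  define g2 g3 where "g2 = 60 * lattice_G L 4" and "g3 = 140 * lattice_G L 6"
  define e1 e2 e3 where "e1 = weierstrass_p L \<omega>1" and "e2 = weierstrass_p L \<omega>2" and "e3 = weierstrass_p L \<omega>3"
  define A B C where "A = e2 - e3" and "B = e3 - e1" and "C = e1 - e2"
  have "e1 \<noteq> e2" "e1 \<noteq> e3" "e2 \<noteq> e3"
    unfolding e1_def e2_def e3_def by (intro half_period_values_distinct half diff)+
  then have nz: "A \<noteq> 0" "B \<noteq> 0" "C \<noteq> 0" by (auto simp: A_def B_def C_def)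
  have ABC: "A + B + C = 0" by (simp add: A_def B_def C_def)
  note * = depressed_cubic_roots[OF half_period_cubic[OF half(1,2)] half_period_cubic[OF half(3,4)]
      half_period_cubic[OF half(5,6)], folded g2_def g3_def e1_def e2_def e3_def, OF \<open>e1 \<noteq> e2\<close> \<open>e1 \<noteq> e3\<close> \<open>e2 \<noteq> e3\<close>]
  have perm: "e2 + e3 + e1 = 0" "g2 = - 4 * (e2 * e3 + e2 * e1 + e3 * e1)" "g3 = 4 * e2 * e3 * e1"
    "e3 + e1 + e2 = 0" "g2 = - 4 * (e3 * e1 + e3 * e2 + e1 * e2)" "g3 = 4 * e3 * e1 * e2"
    using * by (simp_all add: algebra_simps)
  note D1 = discriminant_roots[OF * A_def B_def C_def]
  note D2 = discriminant_roots[OF perm(1-3) B_def C_def A_def]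
  note D3 = discriminant_roots[OF perm(4-6) C_def A_def B_def]
  show "(60 * lattice_G L 4) ^ 3 - 27 * (140 * lattice_G L 6) ^ 2 \<noteq> 0"
    unfolding g2_def[symmetric] g3_def[symmetric] D1(1) using nz by simp
  have j: "lattice_j L = 256 * (A ^ 2 - B * C) ^ 3 / (A * B * C) ^ 2"
  proof -
    have "lattice_j L = 64 * (3 * g2) ^ 3 / (16 * (A * B * C) ^ 2)"
      unfolding lattice_j_def g2_def[symmetric] g3_def[symmetric] D1(1) by (simp add: power_mult_distrib)
    then show ?thesis unfolding D1(2) by (simp only: power_mult_distrib) simp
  qed
  have j': "lattice_j (superlattice L \<omega>) = - 16 * (A ^ 2 - 16 * B * C) ^ 3 / (A ^ 4 * B * C)"
    if w: "\<omega> \<notin> L" "2 * \<omega> \<in> L" and e: "weierstrass_p L \<omega> = e"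
      and D: "3 * (60 * e ^ 2 - 4 * g2) = 4 * (A ^ 2 - 16 * B * C)"
        "(60 * e ^ 2 - 4 * g2) ^ 3 - 27 * (22 * g3 + 14 * g2 * e) ^ 2 = - 256 * A ^ 4 * B * C"
    for \<omega> e A B C
  proof -
    have g2': "60 * lattice_G (superlattice L \<omega>) 4 = 60 * e ^ 2 - 4 * g2"
      unfolding lattice_G_4_superlattice[OF w] by (simp add: e g2_def algebra_simps)
    have g3': "140 * lattice_G (superlattice L \<omega>) 6 = 22 * g3 + 14 * g2 * e"
      unfolding lattice_G_6_superlattice[OF w] by (simp add: e g2_def g3_def algebra_simps)
    have "1728 * (60 * e ^ 2 - 4 * g2) ^ 3 = 64 * (3 * (60 * e ^ 2 - 4 * g2)) ^ 3"
      by (simp only: power_mult_distrib) simp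
    then have "lattice_j (superlattice L \<omega>) = 64 * (3 * (60 * e ^ 2 - 4 * g2)) ^ 3 / (- 256 * A ^ 4 * B * C)"
      unfolding lattice_j_def g2' g3' D(2) by (simp only:)
    also have "\<dots> = - 16 * (A ^ 2 - 16 * B * C) ^ 3 / (A ^ 4 * B * C)"
      unfolding D(1) by (simp only: power_mult_distrib) simp
    finally show ?thesis .
  qed
  note j1 = j'[OF half(1,2) e1_def[symmetric] D1(3,4)]
  note j2 = j'[OF half(3,4) e2_def[symmetric] D2(3,4)]
  note j3 = j'[OF half(5,6) e3_def[symmetric] D3(3,4)]
  have Phi: "Phi2 (lattice_j L) (- 16 * (A' ^ 2 - 16 * B' * C') ^ 3 / (A' ^ 4 * B' * C')) = 0"
    if "A' ^ 2 - B' * C' = A ^ 2 - B * C" "A' * B' * C' = A * B * C" for A' B' C'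
  proof -
    have nz': "A' \<noteq> 0" "B' \<noteq> 0" "C' \<noteq> 0" using nz that(2) by auto
    \<comment> \<open>The value of the parameter for this isogeny: with it \<open>h + 4\<close> and
      \<open>4 h + 1\<close> become \<open>4 (A'^2 - B' C') / A'^2\<close> and
      \<open>(A'^2 - 16 B' C') / A'^2\<close>.\<close>
    define h where "h = - 4 * B' * C' / A' ^ 2"
    have hA: "h * A' ^ 2 = - 4 * B' * C'" using nz' by (simp add: h_def)
    have "h \<noteq> 0" using nz' by (simp add: h_def)
    have "256 * (A' ^ 2 - B' * C') ^ 3 / (A' * B' * C') ^ 2 = 64 * (h + 4) ^ 3 / h ^ 2"
      using nz' by (simp add: h_def divide_simps) (simp add: eval_nat_numeral algebra_simps)
    moreover have "- 16 * (A' ^ 2 - 16 * B' * C') ^ 3 / (A' ^ 4 * B' * C') = 64 * (4 * h + 1) ^ 3 / h"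
      using nz' by (simp add: h_def divide_simps) (simp add: eval_nat_numeral algebra_simps)
    ultimately show ?thesis
      unfolding j that[symmetric] using Phi2_parametrization[OF \<open>h \<noteq> 0\<close>] by simp
  qed
  \<comment> \<open>As \<open>A + B + C = 0\<close>, the quantity \<open>A^2 - B C\<close> is
    invariant under cyclic permutation, so one computation serves all three isogenies.\<close>
  have Q: "B ^ 2 - C * A = A ^ 2 - B * C" "C ^ 2 - A * B = A ^ 2 - B * C"
    using ABC by algebra+
  show "Phi2 (lattice_j L) (lattice_j (superlattice L \<omega>1)) = 0"
    "Phi2 (lattice_j L) (lattice_j (superlattice L \<omega>2)) = 0"
    "Phi2 (lattice_j L) (lattice_j (superlattice L \<omega>3)) = 0"
    unfolding j1 j2 j3 by (rule Phi; use Q in \<open>simp add: mult_ac\<close>)+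
  show "lattice_j (superlattice L \<omega>1) + lattice_j (superlattice L \<omega>2) + lattice_j (superlattice L \<omega>3) =
       lattice_j L ^ 2 - 1488 * lattice_j L + 162000"
    using isogeny_trace_identity[OF ABC nz j] unfolding j1 j2 j3 by simp
qed

section \<open>Homothetic lattices and the injectivity of \<open>j\<close> on them\<close>

definition scale_lattice :: "complex \<Rightarrow> complex set \<Rightarrow> complex set" where
  "scale_lattice c L = (\<lambda>w. c * w) ` L"

lemma lattice_G_scale:
  assumes "c \<noteq> 0"
  shows "lattice_G (scale_lattice c L) k = lattice_G L k / c ^ k"
proof -
  have "lattice_G (scale_lattice c L) k = (\<Sum>\<^sub>\<infinity>w\<in>L - {0}. (1 / c ^ k) * (1 / w ^ k))"
    unfolding lattice_G_def scale_lattice_def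
    by (rule infsum_reindex_bij_witness[of _ "\<lambda>w. c * w" "\<lambda>w. w / c"])
       (use assms in \<open>auto simp: power_divide\<close>)
  also have "\<dots> = (1 / c ^ k) * lattice_G L k"
    unfolding lattice_G_def by (rule infsum_cmult_right')
  finally show ?thesis by simp
qed

lemma lattice_j_scale:
  assumes "c \<noteq> 0"
  shows "lattice_j (scale_lattice c L) = lattice_j L"
proof -
  have E: "(60 * lattice_G (scale_lattice c L) 4) ^ 3 = (60 * lattice_G L 4) ^ 3 / c ^ 12"
    "(140 * lattice_G (scale_lattice c L) 6) ^ 2 = (140 * lattice_G L 6) ^ 2 / c ^ 12"
    by (simp_all add: lattice_G_scale[OF assms] power_divide flip: power_mult)
  have K: "1728 * (a / k) / (a / k - 27 * (b / k)) = 1728 * a / (a - 27 * b)" if "k \<noteq> 0" for a b k :: complex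
  proof -
    have "a / k - 27 * (b / k) = (a - 27 * b) / k" by (simp add: diff_divide_distrib)
    then show ?thesis using that by simp
  qed
  show ?thesis unfolding lattice_j_def E by (rule K) (use assms in simp)
qed

lemma period_lattice_scale:
  assumes "period_lattice L" "c \<noteq> 0"
  shows "period_lattice (scale_lattice c L)"
proof -
  interpret period_lattice L by fact
  show ?thesis
  proof
    show "0 \<in> scale_lattice c L" unfolding scale_lattice_def by (rule image_eqI[of _ _ 0]) auto
    show "x - y \<in> scale_lattice c L" if "x \<in> scale_lattice c L" "y \<in> scale_lattice c L" for x y
      using that diff unfolding scale_lattice_def by (auto simp: right_diff_distrib [symmetric])
    have inj: "inj_on (\<lambda>w. c * w) L" using assms(2) by (auto simp: inj_on_def)
    define K where "K = 1 + 1 / norm c"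
    have "(\<lambda>w. 1 / (1 + norm (c * w)) ^ 3) summable_on L"
    proof (rule summable_on_comparison_test[OF summable_bound[OF subset_refl, of "K ^ 3"]])
      fix w assume "w \<in> L"
      have "1 + norm w \<le> K * (1 + norm (c * w))"
        using assms(2) by (simp add: K_def norm_mult field_simps)
      then have "(1 + norm w) ^ 3 \<le> (K * (1 + norm (c * w))) ^ 3"
        by (intro power_mono) auto
      moreover have "0 < (1 + norm w) ^ 3" "0 < (1 + norm (c * w)) ^ 3"
        by (auto intro!: zero_less_power add_pos_nonneg)
      ultimately show "1 / (1 + norm (c * w)) ^ 3 \<le> K ^ 3 / (1 + norm w) ^ 3"
        by (simp add: divide_simps power_mult_distrib mult.commute)
    qed auto
    then show "(\<lambda>w. 1 / (1 + norm w) ^ 3) summable_on scale_lattice c L"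
      by (simp add: scale_lattice_def summable_on_reindex[OF inj] o_def)
    obtain R where R: "\<And>z. \<exists>w\<in>L. norm (z - w) \<le> R" using covering by blast
    show "\<exists>R. \<forall>z. \<exists>w\<in>scale_lattice c L. norm (z - w) \<le> R"
    proof (intro exI[of _ "norm c * R"] allI)
      fix z
      obtain w where "w \<in> L" "norm (z / c - w) \<le> R" using R by blast
      moreover have "norm (z - c * w) = norm c * norm (z / c - w)"
        using assms(2) by (simp add: norm_mult[symmetric] algebra_simps)
      ultimately have "c * w \<in> scale_lattice c L" "norm (z - c * w) \<le> norm c * R"
        by (auto simp: scale_lattice_def intro!: mult_left_mono)
      then show "\<exists>w\<in>scale_lattice c L. norm (z - w) \<le> norm c * R" by blast
    qed
  qed
qed

lemma complex_nth_root_exists: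
  fixes c :: complex
  assumes "c \<noteq> 0" "n > 0"
  obtains l where "l ^ n = c"
proof
  show "exp (Ln c / of_nat n) ^ n = c"
    using assms by (simp flip: exp_of_nat_mult)
qed

text \<open>Equal \<open>j\<close> means that the ratios of \<open>g2^3\<close> to
  \<open>g3^2\<close> agree, so some \<open>l\<close> scales \<open>g2\<close> by \<open>l^4\<close>
  and \<open>g3\<close> by \<open>l^6\<close>. The scaled lattice then has the same Eisenstein sums
  of weights 4 and 6 as \<open>M\<close>.\<close>

theorem lattice_j_eq_imp_homothetic:
  assumes "period_lattice L" "period_lattice M" and j: "lattice_j L = lattice_j M"
    and L: "(60 * lattice_G L 4) ^ 3 - 27 * (140 * lattice_G L 6) ^ 2 \<noteq> 0"
    and M: "(60 * lattice_G M 4) ^ 3 - 27 * (140 * lattice_G M 6) ^ 2 \<noteq> 0"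
  obtains c where "c \<noteq> 0" "M = scale_lattice c L"
proof -
  define g2 g3 h2 h3 where "g2 = 60 * lattice_G L 4" and "g3 = 140 * lattice_G L 6"
    and "h2 = 60 * lattice_G M 4" and "h3 = 140 * lattice_G M 6"
  note defs = g2_def h2_def g3_def h3_def
  have nz: "g2 ^ 3 - 27 * g3 ^ 2 \<noteq> 0" "h2 ^ 3 - 27 * h3 ^ 2 \<noteq> 0"
    using L M by (simp_all add: defs)
  have "g2 ^ 3 * (h2 ^ 3 - 27 * h3 ^ 2) = h2 ^ 3 * (g2 ^ 3 - 27 * g3 ^ 2)"
    using j nz unfolding lattice_j_def defs[symmetric] by (simp add: frac_eq_eq)
  then have eq: "g2 ^ 3 * h3 ^ 2 = h2 ^ 3 * g3 ^ 2" by (simp add: algebra_simps)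
  obtain l where l: "l \<noteq> 0" "h2 = l ^ 4 * g2" "h3 = l ^ 6 * g3"
  proof (cases "g2 = 0")
    case True
    then have "g3 \<noteq> 0" using nz by auto
    then have "h2 = 0" using eq True by simp
    then have "h3 \<noteq> 0" using nz by auto
    obtain l where "l ^ 6 = h3 / g3"
      by (rule complex_nth_root_exists[of "h3 / g3" 6]) (use \<open>g3 \<noteq> 0\<close> \<open>h3 \<noteq> 0\<close> in auto)
    then show ?thesis using \<open>g3 \<noteq> 0\<close> \<open>h3 \<noteq> 0\<close> True \<open>h2 = 0\<close> by (intro that[of l]) auto
  next
    case False
    have "h2 \<noteq> 0"
    proof
      assume "h2 = 0"
      then show False using eq False nz by simp
    qed
    obtain l where l: "l ^ 4 = h2 / g2"
      by (rule complex_nth_root_exists[of "h2 / g2" 4]) (use False \<open>h2 \<noteq> 0\<close> in auto)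
    then have h2: "h2 = l ^ 4 * g2" "l \<noteq> 0" using False \<open>h2 \<noteq> 0\<close> by auto
    have "g2 ^ 3 * h3 ^ 2 = g2 ^ 3 * (l ^ 6 * g3) ^ 2"
      unfolding eq h2(1) by (simp add: power_mult_distrib mult_ac flip: power_mult)
    then have "h3 ^ 2 = (l ^ 6 * g3) ^ 2" using False by simp
    then consider "h3 = l ^ 6 * g3" | "h3 = - (l ^ 6 * g3)" by (auto simp: power2_eq_iff)
    then show ?thesis
    proof cases
      case 1
      then show ?thesis using h2 by (intro that[of l])
    next
      case 2
      \<comment> \<open>Only the square of \<open>g3\<close> is controlled by \<open>j\<close>.
        Multiplying \<open>l\<close> by \<open>\<i>\<close> keeps its fourth power and flips the
        sign of its sixth.\<close>
      have "\<i> ^ 4 = 1" "\<i> ^ 6 = -1" by (simp_all add: eval_nat_numeral)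
      have "(\<i> * l) ^ 4 = l ^ 4" "(\<i> * l) ^ 6 = - (l ^ 6)"
        using \<open>\<i> ^ 4 = 1\<close> \<open>\<i> ^ 6 = -1\<close> by (simp_all add: power_mult_distrib)
      then show ?thesis using 2 h2 by (intro that[of "\<i> * l"]) auto
    qed
  qed
  have "scale_lattice (1 / l) L = M"
  proof (rule lattice_eqI)
    show "period_lattice (scale_lattice (1 / l) L)"
      using l(1) assms(1) by (simp add: period_lattice_scale)
    show "lattice_G (scale_lattice (1 / l) L) 4 = lattice_G M 4"
      "lattice_G (scale_lattice (1 / l) L) 6 = lattice_G M 6"
      using l by (simp_all add: lattice_G_scale power_divide defs mult.commute)
  qed (rule assms)
  then show thesis using l(1) by (intro that[of "1 / l"]) auto
qed

section \<open>Values at quadratic irrationalities\<close>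

definition tau_lattice :: "complex \<Rightarrow> complex set" where
  "tau_lattice \<tau> = {of_int m + of_int n * \<tau> | m n. True}"

lemma tau_latticeI [intro]: "of_int m + of_int n * \<tau> \<in> tau_lattice \<tau>"
  by (auto simp: tau_lattice_def)

lemma tau_latticeE:
  assumes "w \<in> tau_lattice \<tau>"
  obtains m n where "w = of_int m + of_int n * \<tau>"
  using assms by (auto simp: tau_lattice_def)

lemma coordinates_eq_iff:
  assumes "Im \<tau> > 0"
  shows "of_int m + of_int n * \<tau> = of_int m' + of_int n' * \<tau> \<longleftrightarrow> m = m' \<and> n = n'"
proof
  assume *: "of_int m + of_int n * \<tau> = of_int m' + of_int n' * \<tau>"
  from arg_cong[OF this, of Im] assms have "n = n'" by simp
  with * show "m = m' \<and> n = n'" by simp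
qed auto

lemma tau_lattice_reindex:
  assumes "Im \<tau> > 0"
  shows "inj_on (\<lambda>(m, n). of_int m + of_int n * \<tau>) A"
    "tau_lattice \<tau> = (\<lambda>(m, n). of_int m + of_int n * \<tau>) ` UNIV"
    "tau_lattice \<tau> - {0} = (\<lambda>(m, n). of_int m + of_int n * \<tau>) ` (UNIV - {(0, 0)})"
proof -
  show "inj_on (\<lambda>(m, n). of_int m + of_int n * \<tau>) A"
    by (auto simp: inj_on_def coordinates_eq_iff[OF assms])
  show "tau_lattice \<tau> = (\<lambda>(m, n). of_int m + of_int n * \<tau>) ` UNIV"
    by (auto simp: tau_lattice_def image_iff)
  then show "tau_lattice \<tau> - {0} = (\<lambda>(m, n). of_int m + of_int n * \<tau>) ` (UNIV - {(0, 0)})"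
    using coordinates_eq_iff[OF assms, of _ _ 0 0] by (auto simp: image_iff)
qed

lemma modular_j_eq_lattice_j:
  assumes "Im \<tau> > 0"
  shows "modular_j \<tau> = lattice_j (tau_lattice \<tau>)"
proof -
  have "eisenstein_G k \<tau> = lattice_G (tau_lattice \<tau>) k" for k
    unfolding eisenstein_G_def lattice_G_def tau_lattice_reindex(3)[OF assms]
    by (subst infsum_reindex[OF tau_lattice_reindex(1)[OF assms]]) (simp add: o_def case_prod_unfold)
  then show ?thesis
    by (simp add: modular_j_def weierstrass_g2_def weierstrass_g3_def lattice_j_def)
qed

lemma summable_on_int_powr:
  "(\<lambda>m::int. (1 + real_of_int \<bar>m\<bar>) powr (- 3 / 2)) summable_on UNIV"
proof -
  let ?f = "\<lambda>m::int. (1 + real_of_int \<bar>m\<bar>) powr (- 3 / 2)"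
  have "summable (\<lambda>n. real n powr (- 3 / 2))"
    by (subst summable_real_powr_iff) simp
  then have "summable (\<lambda>n. real (Suc n) powr (- 3 / 2))"
    by (subst summable_Suc_iff)
  then have nat: "(\<lambda>n::nat. (1 + real n) powr (- 3 / 2)) summable_on UNIV"
    by (intro norm_summable_imp_summable_on) simp
  have "?f summable_on range int"
    by (subst summable_on_reindex) (use nat in \<open>auto simp: o_def\<close>)
  moreover have "?f summable_on range (\<lambda>n. - int n)"
    by (subst summable_on_reindex) (use nat in \<open>auto simp: o_def inj_on_def\<close>)
  moreover have "(UNIV :: int set) = range int \<union> range (\<lambda>n. - int n)"
    by (auto simp: image_iff) (metis int_cases2)
  ultimately show ?thesis by (metis summable_on_union)
qed

lemma period_lattice_tau_lattice:
  assumes "Im \<tau> > 0"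
  shows "period_lattice (tau_lattice \<tau>)"
proof
  show "0 \<in> tau_lattice \<tau>"
    using tau_latticeI[of 0 0 \<tau>] by simp
  fix x y assume "x \<in> tau_lattice \<tau>" "y \<in> tau_lattice \<tau>"
  then obtain m n m' n' where "x = of_int m + of_int n * \<tau>" "y = of_int m' + of_int n' * \<tau>"
    by (metis tau_latticeE)
  then have "x - y = of_int (m - m') + of_int (n - n') * \<tau>"
    by (simp add: algebra_simps)
  then show "x - y \<in> tau_lattice \<tau>" by (simp only: tau_latticeI)
next
  \<comment> \<open>Chosen so that \<open>K (1 + norm w)\<close> dominates both
    \<open>1 + \<bar>m\<bar>\<close> and \<open>1 + \<bar>n\<bar>\<close> for
    \<open>w = m + n \<tau>\<close>.\<close>
  define K where "K = 1 + norm \<tau> / Im \<tau> + 1 / Im \<tau>"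
  have K: "K \<ge> 1" using assms by (simp add: K_def)
  let ?a = "\<lambda>m::int. (1 + real_of_int \<bar>m\<bar>) powr (- 3 / 2)"
  have bound: "norm (1 / (1 + norm (of_int m + of_int n * \<tau>)) ^ 3) \<le> K ^ 3 * (?a m * ?a n)" for m n :: int
  proof -
    define w where "w = of_int m + of_int n * \<tau>"
    have n: "\<bar>real_of_int n\<bar> \<le> norm w / Im \<tau>"
    proof -
      have "\<bar>real_of_int n\<bar> * Im \<tau> = \<bar>Im w\<bar>"
        using assms by (simp add: w_def abs_mult)
      also have "\<dots> \<le> norm w" by (rule abs_Im_le_cmod)
      finally show ?thesis using assms by (simp add: field_simps)
    qed
    have "\<bar>real_of_int m\<bar> = norm (w - of_int n * \<tau>)"
      by (simp add: w_def)
    also have "\<dots> \<le> norm w + \<bar>real_of_int n\<bar> * norm \<tau>"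
      using norm_triangle_ineq4[of w "of_int n * \<tau>"] by (simp add: norm_mult)
    also have "\<bar>real_of_int n\<bar> * norm \<tau> \<le> norm w / Im \<tau> * norm \<tau>"
      using n by (rule mult_right_mono) auto
    finally have m: "\<bar>real_of_int m\<bar> \<le> norm w + norm w * (norm \<tau> / Im \<tau>)" by simp
    define N where "N = 1 + norm w"
    have N: "N > 0" by (simp add: N_def add_pos_nonneg)
    have KN: "K * N = 1 + norm w + norm w * (norm \<tau> / Im \<tau>) + norm w / Im \<tau> + norm \<tau> / Im \<tau> + 1 / Im \<tau>"
      by (simp add: K_def N_def algebra_simps add_divide_distrib)
    have nn: "0 \<le> norm w * (norm \<tau> / Im \<tau>)" "0 \<le> norm w / Im \<tau>" "0 \<le> norm \<tau> / Im \<tau>" "0 \<le> 1 / Im \<tau>"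
      using assms by auto
    have 1: "1 + real_of_int \<bar>m\<bar> \<le> K * N" "1 + real_of_int \<bar>n\<bar> \<le> K * N"
      using m n nn norm_ge_zero[of w] unfolding KN of_int_abs by linarith+
    \<comment> \<open>The exponent 3 is split evenly: decay of order 3/2 in each coordinate still
      converges, so the double sum is dominated by a product of two convergent sums.\<close>
    have "((1 + real_of_int \<bar>m\<bar>) * (1 + real_of_int \<bar>n\<bar>)) powr (3 / 2) \<le> ((K * N) * (K * N)) powr (3 / 2)"
      using 1 K N by (intro powr_mono2 mult_mono) auto
    also have "(K * N) * (K * N) = (K * N) powr 2"
      using K N by (simp add: powr_numeral power2_eq_square)
    also have "((K * N) powr 2) powr (3 / 2) = (K * N) ^ 3"
      using K N by (simp only: powr_powr) (simp add: powr_numeral)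
    finally have 2: "((1 + real_of_int \<bar>m\<bar>) * (1 + real_of_int \<bar>n\<bar>)) powr (3 / 2) \<le> K ^ 3 * N ^ 3"
      by (simp add: power_mult_distrib)
    have nz: "1 + \<bar>real_of_int k\<bar> \<noteq> 0" for k
      using abs_ge_zero[of "real_of_int k"] by linarith
    have 3: "?a m * ?a n = 1 / ((1 + real_of_int \<bar>m\<bar>) * (1 + real_of_int \<bar>n\<bar>)) powr (3 / 2)"
      by (simp add: powr_mult powr_minus_divide)
    have "norm (1 / N ^ 3) = 1 / N ^ 3" using N by simp
    also have "\<dots> \<le> K ^ 3 * (1 / ((1 + real_of_int \<bar>m\<bar>) * (1 + real_of_int \<bar>n\<bar>)) powr (3 / 2))"
    proof -
      have "0 < ((1 + real_of_int \<bar>m\<bar>) * (1 + real_of_int \<bar>n\<bar>)) powr (3 / 2)"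
        by (subst powr_gt_zero) (use nz in simp)
      then show ?thesis using 2 N by (simp add: field_simps)
    qed
    finally show ?thesis unfolding 3 N_def w_def .
  qed
  have inner: "(\<lambda>n. ?a m * ?a n) summable_on UNIV" for m
    by (intro summable_on_cmult_right summable_on_int_powr)
  have "(\<lambda>p. norm (case p of (m, n) \<Rightarrow> ?a m * ?a n)) summable_on UNIV \<times> UNIV"
    unfolding Infinite_Sum.abs_summable_on_Sigma_iff
  proof (intro conjI ballI)
    show "(\<lambda>n. norm (case (m, n) of (m, n) \<Rightarrow> ?a m * ?a n)) summable_on UNIV" for m
      using inner[of m] by simp
    have "(\<lambda>m. ?a m * (\<Sum>\<^sub>\<infinity>n. ?a n)) summable_on UNIV"
      by (intro summable_on_cmult_left summable_on_int_powr)
    moreover have "(\<Sum>\<^sub>\<infinity>n. norm (case (m, n) of (m, n) \<Rightarrow> ?a m * ?a n)) = ?a m * (\<Sum>\<^sub>\<infinity>n. ?a n)" for m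
      unfolding infsum_cmult_right' [symmetric] by (rule infsum_cong) simp
    ultimately have "(\<lambda>m. \<Sum>\<^sub>\<infinity>n. norm (case (m, n) of (m, n) \<Rightarrow> ?a m * ?a n)) summable_on UNIV"
      by (simp only:)
    then show "(\<lambda>m. norm (\<Sum>\<^sub>\<infinity>n. norm (case (m, n) of (m, n) \<Rightarrow> ?a m * ?a n))) summable_on UNIV"
      by (rule summable_on_iff_abs_summable_on_real[THEN iffD1])
  qed
  then have "(\<lambda>(m, n). ?a m * ?a n) summable_on UNIV"
    by (simp add: case_prod_unfold)
  then have "(\<lambda>p. K ^ 3 * (case p of (m, n) \<Rightarrow> ?a m * ?a n)) summable_on UNIV"
    by (rule summable_on_cmult_right)
  then have "(\<lambda>p. norm (1 / (1 + norm (case p of (m, n) \<Rightarrow> of_int m + of_int n * \<tau>)) ^ 3)) summable_on UNIV"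
    by (rule Infinite_Sum.abs_summable_on_comparison_test') (use bound in \<open>auto simp: case_prod_unfold\<close>)
  then have "(\<lambda>p. 1 / (1 + norm (case p of (m, n) \<Rightarrow> of_int m + of_int n * \<tau>)) ^ 3) summable_on UNIV"
    by (rule abs_summable_summable)
  then show "(\<lambda>w. 1 / (1 + norm w) ^ 3) summable_on tau_lattice \<tau>"
    unfolding tau_lattice_reindex(2)[OF assms]
    by (subst summable_on_reindex[OF tau_lattice_reindex(1)[OF assms]]) (simp add: o_def)
  show "\<exists>R. \<forall>z. \<exists>w\<in>tau_lattice \<tau>. norm (z - w) \<le> R"
  proof (intro exI[of _ "1 + norm \<tau>"] allI)
    fix z :: complex
    define y where "y = Im z / Im \<tau>"
    define x where "x = Re z - y * Re \<tau>"
    have z: "z = of_real x + of_real y * \<tau>"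
      using assms by (simp add: complex_eq_iff x_def y_def)
    define w where "w = of_int (round x) + of_int (round y) * \<tau>"
    have "z - w = of_real (x - of_int (round x)) + of_real (y - of_int (round y)) * \<tau>"
      by (simp add: z w_def algebra_simps)
    then have "norm (z - w) \<le> \<bar>x - of_int (round x)\<bar> + \<bar>y - of_int (round y)\<bar> * norm \<tau>"
      using norm_triangle_ineq[of "of_real (x - of_int (round x))" "of_real (y - of_int (round y)) * \<tau>"]
      by (simp only: norm_mult norm_of_real)
    also have "\<dots> \<le> 1 + 1 * norm \<tau>"
      using of_int_round_abs_le[of x] of_int_round_abs_le[of y]
      by (intro add_mono mult_right_mono) (auto simp: abs_minus_commute)
    finally show "\<exists>w\<in>tau_lattice \<tau>. norm (z - w) \<le> 1 + norm \<tau>"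
      unfolding w_def by auto
  qed
qed

text \<open>The three half-periods are \<open>\<tau> / 2\<close>, \<open>(\<tau> + 1) / 2\<close>
  and \<open>1 / 2\<close>. Adjoining either of the first two gives the lattice of that number;
  adjoining \<open>1 / 2\<close> gives half the lattice of \<open>2 \<tau>\<close>, which has the
  same \<open>j\<close>.\<close>

lemma modular_j_two_isogeny:
  assumes "Im \<tau> > 0"
  shows "(60 * lattice_G (tau_lattice \<tau>) 4) ^ 3 - 27 * (140 * lattice_G (tau_lattice \<tau>) 6) ^ 2 \<noteq> 0"
    "Phi2 (modular_j \<tau>) (modular_j (\<tau> / 2)) = 0"
    "Phi2 (modular_j \<tau>) (modular_j ((\<tau> + 1) / 2)) = 0"
    "Phi2 (modular_j \<tau>) (modular_j (2 * \<tau>)) = 0"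
    "modular_j (\<tau> / 2) + modular_j ((\<tau> + 1) / 2) + modular_j (2 * \<tau>) =
       modular_j \<tau> ^ 2 - 1488 * modular_j \<tau> + 162000"
proof -
  interpret period_lattice "tau_lattice \<tau>" by (rule period_lattice_tau_lattice[OF assms])
  have mem: "of_real x + of_real y * \<tau> \<in> tau_lattice \<tau> \<longleftrightarrow> x \<in> \<int> \<and> y \<in> \<int>" for x y
  proof
    assume "of_real x + of_real y * \<tau> \<in> tau_lattice \<tau>"
    then obtain m n where *: "of_real x + of_real y * \<tau> = of_int m + of_int n * \<tau>"
      by (rule tau_latticeE)
    from arg_cong[OF this, of Im] assms have "y = of_int n" by simp
    with * have "of_real x = (of_int m :: complex)" by simp
    then have "x = of_int m" by (metis of_real_eq_iff of_real_of_int_eq)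
    with \<open>y = of_int n\<close> show "x \<in> \<int> \<and> y \<in> \<int>" by simp
  qed (auto elim!: Ints_cases)
  have half_nonint: "(1 / 2 :: real) \<notin> \<int>" "(- 1 / 2 :: real) \<notin> \<int>"
    by (auto elim!: Ints_cases simp: field_simps)
  have half: "\<tau> / 2 \<notin> tau_lattice \<tau>" "2 * (\<tau> / 2) \<in> tau_lattice \<tau>"
    "(\<tau> + 1) / 2 \<notin> tau_lattice \<tau>" "2 * ((\<tau> + 1) / 2) \<in> tau_lattice \<tau>"
    "1 / 2 \<notin> tau_lattice \<tau>" "2 * (1 / 2) \<in> tau_lattice \<tau>"
    "\<tau> / 2 - (\<tau> + 1) / 2 \<notin> tau_lattice \<tau>" "\<tau> / 2 - 1 / 2 \<notin> tau_lattice \<tau>"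
    "(\<tau> + 1) / 2 - 1 / 2 \<notin> tau_lattice \<tau>"
    using mem[of 0 "1/2"] mem[of 0 1] mem[of "1/2" "1/2"] mem[of 1 1] mem[of "1/2" 0] mem[of 1 0]
      mem[of "-1/2" 0] mem[of "-1/2" "1/2"] half_nonint
    by (simp_all add: add_divide_distrib diff_divide_distrib add.commute)
  note iso = lattice_j_two_isogeny[OF half]
  have super: "w \<in> superlattice (tau_lattice \<tau>) \<omega> \<longleftrightarrow> w \<in> tau_lattice \<tau> \<or> w - \<omega> \<in> tau_lattice \<tau>" for w \<omega>
    by (force simp: superlattice_def image_iff algebra_simps)
  have 1: "superlattice (tau_lattice \<tau>) (\<tau> / 2) = tau_lattice (\<tau> / 2)"
  proof (intro set_eqI iffI)
    fix w assume "w \<in> superlattice (tau_lattice \<tau>) (\<tau> / 2)"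
    then consider "w \<in> tau_lattice \<tau>" | "w - \<tau> / 2 \<in> tau_lattice \<tau>" by (auto simp: super)
    then show "w \<in> tau_lattice (\<tau> / 2)"
    proof cases
      case 1
      then obtain m n where "w = of_int m + of_int n * \<tau>" by (rule tau_latticeE)
      then have "w = of_int m + of_int (2 * n) * (\<tau> / 2)" by simp
      then show ?thesis by (simp only: tau_latticeI)
    next
      case 2
      then obtain m n where "w - \<tau> / 2 = of_int m + of_int n * \<tau>" by (rule tau_latticeE)
      then have "w = of_int m + of_int (2 * n + 1) * (\<tau> / 2)" by (simp add: algebra_simps)
      then show ?thesis by (simp only: tau_latticeI)
    qed
  next
    fix w assume "w \<in> tau_lattice (\<tau> / 2)"
    then obtain m n where w: "w = of_int m + of_int n * (\<tau> / 2)" by (rule tau_latticeE)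
    obtain k where "n = 2 * k \<or> n = 2 * k + 1" by (metis evenE oddE)
    then have "w = of_int m + of_int k * \<tau> \<or> w - \<tau> / 2 = of_int m + of_int k * \<tau>"
      using w by (auto simp: algebra_simps)
    then show "w \<in> superlattice (tau_lattice \<tau>) (\<tau> / 2)"
      unfolding super by (metis tau_latticeI)
  qed
  have 2: "superlattice (tau_lattice \<tau>) ((\<tau> + 1) / 2) = tau_lattice ((\<tau> + 1) / 2)"
  proof (intro set_eqI iffI)
    fix w assume "w \<in> superlattice (tau_lattice \<tau>) ((\<tau> + 1) / 2)"
    then consider "w \<in> tau_lattice \<tau>" | "w - (\<tau> + 1) / 2 \<in> tau_lattice \<tau>" by (auto simp: super)
    then show "w \<in> tau_lattice ((\<tau> + 1) / 2)"
    proof cases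
      case 1
      then obtain m n where "w = of_int m + of_int n * \<tau>" by (rule tau_latticeE)
      then have "w = of_int (m - n) + of_int (2 * n) * ((\<tau> + 1) / 2)" by (simp add: algebra_simps)
      then show ?thesis by (simp only: tau_latticeI)
    next
      case 2
      then obtain m n where *: "w - (\<tau> + 1) / 2 = of_int m + of_int n * \<tau>" by (rule tau_latticeE)
      have "w = (w - (\<tau> + 1) / 2) + (\<tau> + 1) / 2" by simp
      also have "\<dots> = of_int (m - n) + of_int (2 * n + 1) * ((\<tau> + 1) / 2)"
        unfolding * by (simp add: field_simps)
      finally show ?thesis by (simp only: tau_latticeI)
    qed
  next
    fix w assume "w \<in> tau_lattice ((\<tau> + 1) / 2)"
    then obtain m n where w: "w = of_int m + of_int n * ((\<tau> + 1) / 2)" by (rule tau_latticeE)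
    obtain k where "n = 2 * k \<or> n = 2 * k + 1" by (metis evenE oddE)
    then have "w = of_int (m + k) + of_int k * \<tau> \<or> w - (\<tau> + 1) / 2 = of_int (m + k) + of_int k * \<tau>"
    proof (elim disjE)
      have "of_int (2 * k) * ((\<tau> + 1) / 2) = of_int k * (\<tau> + 1)" by simp
      moreover assume "n = 2 * k"
      ultimately show ?thesis using w by (simp add: algebra_simps)
    next
      have *: "of_int (2 * k + 1) * ((\<tau> + 1) / 2) = of_int k * (\<tau> + 1) + (\<tau> + 1) / 2"
        by (simp add: distrib_right)
      assume n: "n = 2 * k + 1"
      have "w - (\<tau> + 1) / 2 = of_int m + of_int k * (\<tau> + 1)"
        unfolding w n * by (simp only: add_diff_cancel_right' add.assoc [symmetric])
      then show ?thesis by (simp add: algebra_simps)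
    qed
    then show "w \<in> superlattice (tau_lattice \<tau>) ((\<tau> + 1) / 2)"
      unfolding super by (metis tau_latticeI)
  qed
  have 3: "superlattice (tau_lattice \<tau>) (1 / 2) = scale_lattice (1 / 2) (tau_lattice (2 * \<tau>))"
  proof (intro set_eqI iffI)
    fix w assume "w \<in> superlattice (tau_lattice \<tau>) (1 / 2)"
    then consider "w \<in> tau_lattice \<tau>" | "w - 1 / 2 \<in> tau_lattice \<tau>" by (auto simp: super)
    then have "2 * w \<in> tau_lattice (2 * \<tau>)"
    proof cases
      case 1
      then obtain m n where "w = of_int m + of_int n * \<tau>" by (rule tau_latticeE)
      then have "2 * w = of_int (2 * m) + of_int n * (2 * \<tau>)" by (simp add: algebra_simps)
      then show ?thesis by (simp only: tau_latticeI)
    next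
      case 2
      then obtain m n where *: "w - 1 / 2 = of_int m + of_int n * \<tau>" by (rule tau_latticeE)
      have "2 * w = 2 * (w - 1 / 2) + 1" by simp
      also have "\<dots> = of_int (2 * m + 1) + of_int n * (2 * \<tau>)"
        unfolding * by (simp add: algebra_simps)
      finally show ?thesis by (simp only: tau_latticeI)
    qed
    then show "w \<in> scale_lattice (1 / 2) (tau_lattice (2 * \<tau>))"
      unfolding scale_lattice_def by (intro image_eqI[of _ _ "2 * w"]) auto
  next
    fix w assume "w \<in> scale_lattice (1 / 2) (tau_lattice (2 * \<tau>))"
    then obtain m n where w: "w = 1 / 2 * (of_int m + of_int n * (2 * \<tau>))"
      by (auto simp: scale_lattice_def tau_lattice_def)
    obtain k where "m = 2 * k \<or> m = 2 * k + 1" by (metis evenE oddE)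
    then have "w = of_int k + of_int n * \<tau> \<or> w - 1 / 2 = of_int k + of_int n * \<tau>"
      unfolding w by (auto simp: distrib_left add_divide_distrib)
    then show "w \<in> superlattice (tau_lattice \<tau>) (1 / 2)"
      unfolding super by (metis tau_latticeI)
  qed
  have Im: "Im (\<tau> / 2) > 0" "Im ((\<tau> + 1) / 2) > 0" "Im (2 * \<tau>) > 0"
    using assms by auto
  note j = modular_j_eq_lattice_j[OF assms] modular_j_eq_lattice_j[OF Im(1)]
    modular_j_eq_lattice_j[OF Im(2)] modular_j_eq_lattice_j[OF Im(3)]
  have scaled: "lattice_j (superlattice (tau_lattice \<tau>) (1 / 2)) = lattice_j (tau_lattice (2 * \<tau>))"
    unfolding 3 by (rule lattice_j_scale) simp
  note iso' = iso[unfolded 1 2 scaled]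
  show "(60 * lattice_G (tau_lattice \<tau>) 4) ^ 3 - 27 * (140 * lattice_G (tau_lattice \<tau>) 6) ^ 2 \<noteq> 0"
    "Phi2 (modular_j \<tau>) (modular_j (\<tau> / 2)) = 0"
    "Phi2 (modular_j \<tau>) (modular_j ((\<tau> + 1) / 2)) = 0"
    "Phi2 (modular_j \<tau>) (modular_j (2 * \<tau>)) = 0"
    "modular_j (\<tau> / 2) + modular_j ((\<tau> + 1) / 2) + modular_j (2 * \<tau>) =
       modular_j \<tau> ^ 2 - 1488 * modular_j \<tau> + 162000"
    unfolding j by (fact iso')+
qed

text \<open>The form is \<open>a X\<^sup>2 + b X + c\<close> of discriminant \<open>- D\<close>, so \<open>c\<close> is determined by the arguments.\<close>

definition quadratic_root :: "real \<Rightarrow> real \<Rightarrow> real \<Rightarrow> complex" where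
  "quadratic_root D a b = Complex (- b / (2 * a)) (sqrt D / (2 * a))"

definition form_j :: "real \<Rightarrow> real \<Rightarrow> real \<Rightarrow> complex" where
  "form_j D a b = modular_j (quadratic_root D a b)"

lemma Im_quadratic_root_pos: "D > 0 \<Longrightarrow> a > 0 \<Longrightarrow> Im (quadratic_root D a b) > 0"
  by (simp add: quadratic_root_def)

section \<open>Invariance of \<open>j\<close> and equivalence of quadratic forms\<close>

lemma modular_j_add_one:
  assumes "Im \<tau> > 0"
  shows "modular_j (\<tau> + 1) = modular_j \<tau>"
proof -
  have "tau_lattice (\<tau> + 1) = tau_lattice \<tau>"
  proof (intro set_eqI iffI)
    fix w assume "w \<in> tau_lattice (\<tau> + 1)"
    then obtain m n where "w = of_int m + of_int n * (\<tau> + 1)" by (rule tau_latticeE)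
    then have "w = of_int (m + n) + of_int n * \<tau>" by (simp add: algebra_simps)
    then show "w \<in> tau_lattice \<tau>" by (simp only: tau_latticeI)
  next
    fix w assume "w \<in> tau_lattice \<tau>"
    then obtain m n where "w = of_int m + of_int n * \<tau>" by (rule tau_latticeE)
    then have "w = of_int (m - n) + of_int n * (\<tau> + 1)" by (simp add: algebra_simps)
    then show "w \<in> tau_lattice (\<tau> + 1)" by (simp only: tau_latticeI)
  qed
  then show ?thesis using assms by (simp add: modular_j_eq_lattice_j)
qed

lemma modular_j_minus_inverse:
  assumes "Im \<tau> > 0"
  shows "modular_j (- 1 / \<tau>) = modular_j \<tau>"
proof -
  have nz: "\<tau> \<noteq> 0" using assms by auto
  have Im: "Im (- 1 / \<tau>) > 0"
    using assms nz by (simp add: Im_divide sum_power2_gt_zero_iff complex_eq_iff)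
  have "tau_lattice (- 1 / \<tau>) = scale_lattice (1 / \<tau>) (tau_lattice \<tau>)"
  proof (intro set_eqI iffI)
    fix w assume "w \<in> tau_lattice (- 1 / \<tau>)"
    then obtain m n where "w = of_int m + of_int n * (- 1 / \<tau>)" by (rule tau_latticeE)
    then have "w = 1 / \<tau> * (of_int (- n) + of_int m * \<tau>)" using nz by (simp add: field_simps)
    then show "w \<in> scale_lattice (1 / \<tau>) (tau_lattice \<tau>)"
      unfolding scale_lattice_def by blast
  next
    fix w assume "w \<in> scale_lattice (1 / \<tau>) (tau_lattice \<tau>)"
    then obtain m n where "w = 1 / \<tau> * (of_int m + of_int n * \<tau>)"
      by (auto simp: scale_lattice_def tau_lattice_def)
    then have "w = of_int n + of_int (- m) * (- 1 / \<tau>)" using nz by (simp add: field_simps)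
    then show "w \<in> tau_lattice (- 1 / \<tau>)" by (simp only: tau_latticeI)
  qed
  then show ?thesis
    unfolding modular_j_eq_lattice_j[OF assms] modular_j_eq_lattice_j[OF Im]
    using nz by (simp only: lattice_j_scale divide_eq_0_iff one_neq_zero not_False_eq_True simp_thms)
qed

lemma modular_j_minus_cnj:
  assumes "Im \<tau> > 0"
  shows "modular_j (- cnj \<tau>) = cnj (modular_j \<tau>)"
proof -
  have cnj_mem: "cnj w \<in> tau_lattice \<tau>" if "w \<in> tau_lattice (- cnj \<tau>)" for w \<tau>
  proof -
    from that obtain m n where "w = of_int m + of_int n * (- cnj \<tau>)" by (rule tau_latticeE)
    then have "cnj w = of_int m + of_int (- n) * \<tau>" by simp
    then show ?thesis by (simp only: tau_latticeI)
  qed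
  have "lattice_G (tau_lattice (- cnj \<tau>)) k = cnj (lattice_G (tau_lattice \<tau>) k)" for k
  proof -
    have "lattice_G (tau_lattice (- cnj \<tau>)) k = (\<Sum>\<^sub>\<infinity>w\<in>tau_lattice \<tau> - {0}. cnj (1 / w ^ k))"
      unfolding lattice_G_def
      by (rule infsum_reindex_bij_witness[of _ cnj cnj])
         (use cnj_mem[of _ "\<tau>"] cnj_mem[of _ "- cnj \<tau>"] in auto)
    also have "\<dots> = cnj (lattice_G (tau_lattice \<tau>) k)"
      unfolding lattice_G_def by (simp only: infsum_cnj)
    finally show ?thesis .
  qed
  then show ?thesis
    using assms by (simp add: modular_j_eq_lattice_j lattice_j_def)
qed

lemma form_j_add:
  assumes "D > 0" "a > 0"
  shows "form_j D a (b + 2 * a) = form_j D a b"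
proof -
  have "quadratic_root D a b = quadratic_root D a (b + 2 * a) + 1"
    using assms by (simp add: quadratic_root_def complex_eq_iff field_simps)
  then show ?thesis
    using modular_j_add_one[OF Im_quadratic_root_pos[OF assms]] by (simp add: form_j_def)
qed

lemma form_j_shift:
  assumes "D > 0" "a > 0"
  shows "form_j D a (b + 2 * a * of_int k) = form_j D a b"
proof (induction k rule: int_induct[of _ 0])
  case (step1 i)
  have eq: "b + 2 * a * of_int (i + 1) = (b + 2 * a * of_int i) + 2 * a" by (simp add: algebra_simps)
  show ?case by (simp only: eq form_j_add[OF assms] step1(2))
next
  case (step2 i)
  have "b + 2 * a * of_int i = (b + 2 * a * of_int (i - 1)) + 2 * a" by (simp add: algebra_simps)
  then show ?case using form_j_add[OF assms, of "b + 2 * a * of_int (i - 1)"] step2(2) by (simp only:)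
qed simp

text \<open>The inversion \<open>\<tau> |-> - 1 / \<tau>\<close> turns the form
  \<open>(a, b, c)\<close> into \<open>(c, - b, a)\<close>.\<close>

lemma form_j_swap:
  assumes "D > 0" "a > 0" "b ^ 2 + D = 4 * a * c"
  shows "form_j D a b = form_j D c (- b)"
proof -
  have "4 * a * c > 0" using assms(1) by (simp flip: assms(3) add: add_nonneg_pos)
  then have c: "c > 0" using assms(2) by (simp add: zero_less_mult_iff)
  let ?r = "quadratic_root D a b"
  have "quadratic_root D c (- b) * ?r = - 1"
    using assms c by (simp add: quadratic_root_def complex_eq_iff field_simps power2_eq_square)
  moreover have "?r \<noteq> 0" using Im_quadratic_root_pos[OF assms(1,2), of b] by auto
  ultimately have "quadratic_root D c (- b) = - 1 / ?r" by (simp add: field_simps)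
  then show ?thesis
    using modular_j_minus_inverse[OF Im_quadratic_root_pos[OF assms(1,2)]] by (simp add: form_j_def)
qed

text \<open>A form and its double have the same root. A form of discriminant \<open>- D\<close>
  whose last coefficient is half-integral can thus be read as an integral form of discriminant
  \<open>- 4 D\<close>.\<close>

lemma form_j_double:
  assumes "a > 0"
  shows "form_j (4 * D) (2 * a) (2 * b) = form_j D a b"
  using assms by (simp add: form_j_def quadratic_root_def real_sqrt_mult)

lemma form_j_cnj:
  assumes "D > 0" "a > 0"
  shows "form_j D a (- b) = cnj (form_j D a b)"
proof -
  have "quadratic_root D a (- b) = - cnj (quadratic_root D a b)"
    by (simp add: quadratic_root_def complex_eq_iff)
  then show ?thesis
    using modular_j_minus_cnj[OF Im_quadratic_root_pos[OF assms]] by (simp add: form_j_def)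
qed

lemma form_j_two_isogeny:
  assumes "D > 0" "a > 0"
  shows "Phi2 (form_j D a b) (form_j (4 * D) a (2 * b)) = 0"
    "Phi2 (form_j D a b) (form_j D (2 * a) b) = 0"
    "Phi2 (form_j D a b) (form_j D (2 * a) (b - 2 * a)) = 0"
    "form_j (4 * D) a (2 * b) + form_j D (2 * a) b + form_j D (2 * a) (b - 2 * a) =
      form_j D a b ^ 2 - 1488 * form_j D a b + 162000"
proof -
  have "quadratic_root (4 * D) a (2 * b) = 2 * quadratic_root D a b"
    "quadratic_root D (2 * a) b = quadratic_root D a b / 2"
    "quadratic_root D (2 * a) (b - 2 * a) = (quadratic_root D a b + 1) / 2"
    using assms by (simp_all add: quadratic_root_def complex_eq_iff real_sqrt_mult field_simps)
  note * = modular_j_two_isogeny[OF Im_quadratic_root_pos[OF assms, of b], folded this, folded form_j_def]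
  show "Phi2 (form_j D a b) (form_j (4 * D) a (2 * b)) = 0"
    "Phi2 (form_j D a b) (form_j D (2 * a) b) = 0"
    "Phi2 (form_j D a b) (form_j D (2 * a) (b - 2 * a)) = 0"
    "form_j (4 * D) a (2 * b) + form_j D (2 * a) b + form_j D (2 * a) (b - 2 * a) =
      form_j D a b ^ 2 - 1488 * form_j D a b + 162000"
    using * by (simp_all add: add_ac)
qed

text \<open>Equal \<open>j\<close> gives a homothety, hence a fractional linear map from
  \<open>\<tau>\<close> to \<open>\<tau>'\<close>. The second conclusion says that its determinant
  is 1: the lattices correspond exactly, so their covolumes agree after scaling.\<close>

lemma modular_j_eq_imp:
  assumes "Im \<tau> > 0" "Im \<tau>' > 0" and eq: "modular_j \<tau> = modular_j \<tau>'"
  obtains p q r t where "\<tau>' * (of_int p + of_int q * \<tau>) = of_int r + of_int t * \<tau>"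
    "Im \<tau>' * norm (of_int p + of_int q * \<tau>) ^ 2 = Im \<tau>"
proof -
  have L: "period_lattice (tau_lattice \<tau>)" "period_lattice (tau_lattice \<tau>')"
    using assms by (simp_all add: period_lattice_tau_lattice)
  have "lattice_j (tau_lattice \<tau>) = lattice_j (tau_lattice \<tau>')"
    using assms by (simp add: modular_j_eq_lattice_j)
  from lattice_j_eq_imp_homothetic[OF L this modular_j_two_isogeny(1)[OF assms(1)]
      modular_j_two_isogeny(1)[OF assms(2)]]
  obtain c where c: "c \<noteq> 0" "tau_lattice \<tau>' = scale_lattice c (tau_lattice \<tau>)" by blast
  have to: "w / c \<in> tau_lattice \<tau>" if "w \<in> tau_lattice \<tau>'" for w
    using that c by (auto simp: scale_lattice_def)
  have fro: "c * w \<in> tau_lattice \<tau>'" if "w \<in> tau_lattice \<tau>" for w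
    using that c by (auto simp: scale_lattice_def)
  have gens: "1 \<in> tau_lattice \<tau>" "\<tau> \<in> tau_lattice \<tau>" for \<tau>
    using tau_latticeI[of 1 0 \<tau>] tau_latticeI[of 0 1 \<tau>] by auto
  \<comment> \<open>The covolume of a sublattice is an integer multiple of that of the lattice, the
    factor being a determinant. Applied in both directions, the two integers have product 1.\<close>
  have index: "\<exists>k::int. Im \<sigma>' * norm (1 / d) ^ 2 = of_int k * Im \<sigma>"
    if d: "d \<noteq> 0" "1 / d \<in> tau_lattice \<sigma>" "\<sigma>' / d \<in> tau_lattice \<sigma>" for d \<sigma> \<sigma>'
  proof -
    obtain p q where pq: "1 / d = of_int p + of_int q * \<sigma>" using d(2) by (rule tau_latticeE)
    obtain r t where rt: "\<sigma>' / d = of_int r + of_int t * \<sigma>" using d(3) by (rule tau_latticeE)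
    have "\<sigma>' * of_real (norm (1 / d) ^ 2) = \<sigma>' / d * cnj (1 / d)"
      by (simp only: complex_norm_square) (simp add: field_simps)
    also have "\<dots> = (of_int r + of_int t * \<sigma>) * cnj (of_int p + of_int q * \<sigma>)"
      unfolding pq rt ..
    finally have "Im (\<sigma>' * of_real (norm (1 / d) ^ 2)) =
        Im ((of_int r + of_int t * \<sigma>) * cnj (of_int p + of_int q * \<sigma>))"
      by (rule arg_cong)
    then have "Im \<sigma>' * norm (1 / d) ^ 2 = of_int (p * t - q * r) * Im \<sigma>"
      by (simp add: algebra_simps)
    then show ?thesis by blast
  qed
  obtain k where k: "Im \<tau>' * norm (1 / c) ^ 2 = of_int k * Im \<tau>"
    using index[of c \<tau> \<tau>'] c(1) to gens by blast
  obtain k' where k': "Im \<tau> * norm c ^ 2 = of_int k' * Im \<tau>'"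
    using index[of "1 / c" \<tau>' \<tau>] c(1) fro[of 1] fro[of \<tau>] gens by (auto simp: mult.commute)
  have "of_int (k * k') * (Im \<tau> * Im \<tau>') = (Im \<tau>' * norm (1 / c) ^ 2) * (Im \<tau> * norm c ^ 2)"
    unfolding k k' by simp
  also have "\<dots> = 1 * (Im \<tau> * Im \<tau>')"
    using c(1) by (simp add: norm_divide power_divide)
  finally have "real_of_int (k * k') = 1"
    using assms(1,2) by (subst (asm) mult_cancel_right) auto
  then have "k * k' = 1" by linarith
  moreover have "of_int k * Im \<tau> > 0"
    unfolding k[symmetric] using assms c(1) by simp
  then have "k > 0" using assms(1) by (simp add: zero_less_mult_iff)
  ultimately have "k = 1" using zmult_eq_1_iff by fastforce
  obtain p q where pq: "1 / c = of_int p + of_int q * \<tau>" using to[OF gens(1)] by (rule tau_latticeE)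
  obtain r t where rt: "\<tau>' / c = of_int r + of_int t * \<tau>" using to[OF gens(2)] by (rule tau_latticeE)
  show thesis
  proof (rule that)
    show "\<tau>' * (of_int p + of_int q * \<tau>) = of_int r + of_int t * \<tau>"
      unfolding pq[symmetric] rt[symmetric] by simp
    show "Im \<tau>' * norm (of_int p + of_int q * \<tau>) ^ 2 = Im \<tau>"
      unfolding pq[symmetric] k \<open>k = 1\<close> by simp
  qed
qed

text \<open>Comparing imaginary parts shows that an equivalence makes a norm form take a small
  value, and the size of \<open>D\<close> leaves only \<open>q = 0\<close>. Then
  \<open>p^2 = 2\<close> is impossible in the first two cases.\<close>

lemma form_j_distinct:
  assumes "D > (8 :: real)"
  shows "form_j D 1 1 \<noteq> form_j D 2 1" "form_j D 1 1 \<noteq> form_j D 2 (- 1)"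
  and "D > 16 \<Longrightarrow> form_j D 2 1 \<noteq> form_j D 2 (- 1)"
proof -
  have D: "D > 0" using assms by simp
  have norm: "norm (of_int p + of_int q * quadratic_root D a 1) ^ 2 =
      ((2 * a * of_int p - of_int q) ^ 2 + D * of_int q ^ 2) / (4 * a ^ 2)" if "a > 0" for p q :: int and a
    using that D by (simp add: quadratic_root_def cmod_power2 power_divide power_mult_distrib field_simps)
  have neq1: "form_j D 1 1 \<noteq> form_j D 2 b" for b
  proof
    assume "form_j D 1 1 = form_j D 2 b"
    then obtain p q where "Im (quadratic_root D 2 b) * norm (of_int p + of_int q * quadratic_root D 1 1) ^ 2 =
        Im (quadratic_root D 1 1)"
      unfolding form_j_def using modular_j_eq_imp D Im_quadratic_root_pos by (metis zero_less_numeral zero_less_one)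
    then have "sqrt D * ((2 * of_int p - of_int q) ^ 2 + D * of_int q ^ 2) = sqrt D * 8"
      unfolding norm[OF zero_less_one] by (simp add: quadratic_root_def field_simps)
    then have *: "(2 * of_int p - of_int q) ^ 2 + D * of_int q ^ 2 = 8" using D by simp
    have "q = 0"
    proof (rule ccontr)
      assume "q \<noteq> 0"
      then have "(of_int q :: real) ^ 2 \<ge> 1"
        by (metis of_int_1_le_iff of_int_power int_one_le_iff_zero_less zero_less_power2)
      then have "D * 1 \<le> D * of_int q ^ 2" using D by (intro mult_left_mono) auto
      then show False using * assms zero_le_power2[of "2 * real_of_int p - real_of_int q"] by linarith
    qed
    with * have "real_of_int (p ^ 2) = 2" by (simp add: power_mult_distrib)
    then have "p ^ 2 = 2" by linarith
    then have "\<bar>p\<bar> ^ 2 = 2" by simp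
    moreover have "\<bar>p\<bar> \<le> 1 \<or> \<bar>p\<bar> \<ge> 2" by linarith
    then have "\<bar>p\<bar> ^ 2 \<le> 1 ^ 2 \<or> \<bar>p\<bar> ^ 2 \<ge> 2 ^ 2" using power_mono by (metis abs_ge_zero zero_le_numeral)
    ultimately show False by simp
  qed
  show "form_j D 1 1 \<noteq> form_j D 2 1" "form_j D 1 1 \<noteq> form_j D 2 (- 1)" by (rule neq1)+
  show "form_j D 2 1 \<noteq> form_j D 2 (- 1)" if "D > 16"
  proof
    let ?r = "quadratic_root D 2 1" and ?r' = "quadratic_root D 2 (- 1)"
    assume "form_j D 2 1 = form_j D 2 (- 1)"
    then obtain p q r t where 1: "?r' * (of_int p + of_int q * ?r) = of_int r + of_int t * ?r"
      and 2: "Im ?r' * norm (of_int p + of_int q * ?r) ^ 2 = Im ?r"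
      unfolding form_j_def using modular_j_eq_imp D Im_quadratic_root_pos by (metis zero_less_numeral)
    from 2 have "sqrt D * ((4 * of_int p - of_int q) ^ 2 + D * of_int q ^ 2) = sqrt D * 16"
      unfolding norm[OF zero_less_numeral] by (simp add: quadratic_root_def field_simps)
    then have *: "(4 * of_int p - of_int q) ^ 2 + D * of_int q ^ 2 = 16" using D by simp
    have "q = 0"
    proof (rule ccontr)
      assume "q \<noteq> 0"
      then have "(of_int q :: real) ^ 2 \<ge> 1"
        by (metis of_int_1_le_iff of_int_power int_one_le_iff_zero_less zero_less_power2)
      then have "D * 1 \<le> D * of_int q ^ 2" using D by (intro mult_left_mono) auto
      then show False using * that zero_le_power2[of "4 * real_of_int p - real_of_int q"] by linarith
    qed
    with * have "real_of_int (p ^ 2) = 1" by (simp add: power_mult_distrib)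
    then have "p ^ 2 = 1" by linarith
    then have p: "p = 1 \<or> p = - 1" by (simp add: power2_eq_1_iff)
    \<comment> \<open>With \<open>q = 0\<close> and \<open>p = 1\<close> or \<open>p = - 1\<close>
      the equivalence is an integral translation, but the real parts of the two roots are
      \<open>- 1 / 4\<close> and \<open>1 / 4\<close>.\<close>
    have "of_int t = real_of_int p"
      using arg_cong[OF 1, of Im] D \<open>q = 0\<close> by (simp add: quadratic_root_def)
    then have "t = p" by linarith
    then have "real_of_int p = 2 * of_int r"
      using arg_cong[OF 1, of Re] \<open>q = 0\<close> by (simp add: quadratic_root_def)
    then have "p = 2 * r" by linarith
    with p show False by presburger
  qed
qed

text \<open>Gauss reduction: a translation brings \<open>b\<close> into the range
  \<open>\<bar>b\<bar> \<le> a\<close>, and if then \<open>c < a\<close>, the inversion produces a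
  smaller leading coefficient. The parity clause carries primitivity at 2 along, to tell forms of
  discriminant \<open>- 4 D\<close> from doubled forms of discriminant \<open>- D\<close>.\<close>

lemma form_reduction:
  fixes a b c :: int and D :: int
  assumes "a > 0" "b ^ 2 + D = 4 * a * c" "D > 0" "odd a \<or> odd b \<or> odd c"
  shows "\<exists>a' b' c'. a' > 0 \<and> b' ^ 2 + D = 4 * a' * c' \<and> (odd a' \<or> odd b' \<or> odd c') \<and>
     \<bar>b'\<bar> \<le> a' \<and> a' \<le> c' \<and> form_j D a b = form_j D a' b'"
  using assms
proof (induction "nat a" arbitrary: a b c rule: less_induct)
  case less
  define k where "k = - ((b + a) div (2 * a))"
  define b' where "b' = b + 2 * a * k"
  define c' where "c' = c + b * k + a * k ^ 2"
  have "b' + a = (b + a) mod (2 * a)"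
    by (simp add: b'_def k_def minus_mult_div_eq_mod [symmetric])
  moreover have "0 \<le> (b + a) mod (2 * a)" "(b + a) mod (2 * a) < 2 * a" using less.prems by auto
  ultimately have b': "\<bar>b'\<bar> \<le> a" by linarith
  have disc: "b' ^ 2 + D = 4 * a * c'"
    using less.prems(2) by (simp add: b'_def c'_def power2_eq_square algebra_simps)
  have par: "odd a \<or> odd b' \<or> odd c'"
    using less.prems(4) by (auto simp: b'_def c'_def)
  have "form_j D a (of_int b + 2 * of_int a * of_int k) = form_j D a b"
    by (rule form_j_shift) (use less.prems in auto)
  then have j: "form_j D a b = form_j D a b'" by (simp add: b'_def)
  show ?case
  proof (cases "a \<le> c'")
    case True
    then show ?thesis using less.prems(1) disc par b' j by blast
  next
    case False
    have "4 * a * c' > 0" unfolding disc[symmetric] using less.prems(3) by (simp add: add_nonneg_pos)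
    then have "c' > 0" using less.prems(1) by (simp add: zero_less_mult_iff)
    have "form_j D a b' = form_j D c' (- of_int b')"
    proof (rule form_j_swap)
      show "(real_of_int b')\<^sup>2 + real_of_int D = 4 * real_of_int a * real_of_int c'"
        using arg_cong[OF disc, of real_of_int] by simp
    qed (use less.prems in auto)
    moreover have "\<exists>a'' b'' c''. a'' > 0 \<and> b'' ^ 2 + D = 4 * a'' * c'' \<and> (odd a'' \<or> odd b'' \<or> odd c'') \<and>
     \<bar>b''\<bar> \<le> a'' \<and> a'' \<le> c'' \<and> form_j D c' (- b') = form_j D a'' b''"
      by (rule less.hyps[of c' "- b'" a]) (use False \<open>c' > 0\<close> less.prems disc par in \<open>auto simp: mult_ac\<close>)
    ultimately show ?thesis using j by simp
  qed
qed

lemma quadratic_root_unique: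
  fixes a b c :: real
  assumes "Im \<tau> > 0" "a > 0" "of_real a * \<tau> ^ 2 + of_real b * \<tau> + of_real c = 0" "b ^ 2 + D = 4 * a * c"
  shows "\<tau> = quadratic_root D a b"
proof -
  define x y where "x = Re \<tau>" and "y = Im \<tau>"
  have \<tau>: "\<tau> = Complex x y" by (simp add: x_def y_def)
  have "y > 0" using assms by (simp add: y_def)
  have "a * (2 * x * y) + b * y = 0"
    using arg_cong[OF assms(3), of Im] by (simp add: \<tau> power2_eq_square algebra_simps)
  then have "y * (2 * a * x + b) = 0" by (simp add: algebra_simps)
  then have x: "2 * a * x = - b" using \<open>y > 0\<close> by simp
  have "a * (x ^ 2 - y ^ 2) + b * x + c = 0"
    using arg_cong[OF assms(3), of Re] by (simp add: \<tau> power2_eq_square algebra_simps)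
  then have "4 * a * (a * (x ^ 2 - y ^ 2) + b * x + c) = 0" by simp
  then have "(2 * a * x) ^ 2 - (2 * a * y) ^ 2 + 2 * b * (2 * a * x) + 4 * a * c = 0"
    by (simp add: power2_eq_square algebra_simps)
  then have "(2 * a * y) ^ 2 = D" unfolding x assms(4)[symmetric] by (simp add: power2_eq_square)
  then have "2 * a * y = sqrt D" using \<open>y > 0\<close> assms(2) by (intro real_sqrt_unique[symmetric]) auto
  then show ?thesis using x assms(2) by (simp add: \<tau> quadratic_root_def field_simps)
qed

lemma quadratic_with_discriminant_reduced:
  fixes D :: int
  assumes "is_singular_modulus_at x \<tau> (- D)" "D > 0"
  obtains a b c :: int where "a > 0" "b ^ 2 + D = 4 * a * c" "odd a \<or> odd b \<or> odd c"
    "\<bar>b\<bar> \<le> a" "a \<le> c" "x = form_j D a b"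
proof -
  from assms obtain a b c where Im: "Im \<tau> > 0" and x: "x = modular_j \<tau>" and
    p: "a \<noteq> 0" "is_min_int_poly [:c, b, a:] \<tau>" "- D = b\<^sup>2 - 4 * a * c"
    by (auto simp: is_singular_modulus_at_def quadratic_with_discriminant_def)
  have a: "a > 0" and root: "poly (map_poly of_int [:c, b, a:]) \<tau> = 0" and cont: "content [:c, b, a:] = 1"
    using p by (auto simp: is_min_int_poly_def)
  have odd: "odd a \<or> odd b \<or> odd c"
  proof (rule ccontr)
    assume "\<not> ?thesis"
    then have "[:2:] dvd [:c, b, a:]"
      by (auto simp: const_poly_dvd_iff coeff_pCons split: nat.splits)
    then have "2 dvd content [:c, b, a:]" using const_poly_dvd_iff_dvd_content by blast
    then show False unfolding cont by simp
  qed
  have disc: "b ^ 2 + D = 4 * a * c" using p(3) by simp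
  have "\<tau> = quadratic_root D a b"
  proof (rule quadratic_root_unique[OF Im])
    show "of_real (of_int a) * \<tau> ^ 2 + of_real (of_int b) * \<tau> + of_real (of_int c) = 0"
      using root p(1) by (simp add: map_poly_pCons power2_eq_square algebra_simps)
    show "(real_of_int b)\<^sup>2 + real_of_int D = 4 * real_of_int a * real_of_int c"
      using arg_cong[OF disc, of real_of_int] by simp
  qed (use a in simp)
  then have "x = form_j D a b" by (simp add: x form_j_def)
  with form_reduction[OF a disc assms(2) odd] show thesis using that by auto
qed

section \<open>Arithmetic of the cubic field\<close>

text \<open>\<open>\<psi>\<close> is the divided difference of the modular polynomial in its second argument; a further divided
  difference determines the second symmetric function of the three numbers from the first.\<close>

lemma two_isogeny_triangle:
  fixes x1 x2 x3 :: complex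
  assumes Phi: "Phi2 x1 x2 = 0" "Phi2 x1 x3 = 0" "Phi2 x2 x3 = 0"
    and distinct: "x1 \<noteq> x2" "x1 \<noteq> x3" "x2 \<noteq> x3"
  defines "e1 \<equiv> x1 + x2 + x3"
  shows "x1 * x2 + x1 * x3 + x2 * x3 = 1487 * e1 + 40935375"
    "x1 * x2 * x3 = 1487 * e1 + 40935375 - e1 ^ 2 + 162000 * e1 - 8748000000"
    "e1 = - 3491750 \<or> e1 = - 39491307"
proof -
  define e2 e3 where "e2 = x1 * x2 + x1 * x3 + x2 * x3" and "e3 = x1 * x2 * x3"
  define \<psi> where "\<psi> = (\<lambda>x y z :: complex. y ^ 2 + y * z + z ^ 2 - x ^ 2 * (y + z)
    + 1488 * (x ^ 2 + x * (y + z)) - 162000 * (y + z) + 40773375 * x + 8748000000)"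
  have \<psi>: "Phi2 x y - Phi2 x z = (y - z) * \<psi> x y z" for x y z
    by (simp add: Phi2_def \<psi>_def power2_eq_square power3_eq_cube algebra_simps)
  have "\<psi> x1 x2 x3 = 0" "\<psi> x2 x1 x3 = 0"
    using \<psi>[of x1 x2 x3] \<psi>[of x2 x1 x3] Phi distinct Phi2_commute[of x2 x1] by simp_all
  moreover have "\<psi> x1 x2 x3 - \<psi> x2 x1 x3 = (x1 - x2) * (1487 * e1 + 40935375 - e2)"
    by (simp add: \<psi>_def e1_def e2_def power2_eq_square algebra_simps)
  ultimately have e2: "e2 = 1487 * e1 + 40935375" using distinct by simp
  then show "x1 * x2 + x1 * x3 + x2 * x3 = 1487 * e1 + 40935375" by (simp add: e2_def)
  have "\<psi> x1 x2 x3 = x1 * (1487 * e1 + 40935375 - e2) + (e3 + e1 ^ 2 - e2 - 162000 * e1 + 8748000000)"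
    by (simp add: \<psi>_def e1_def e2_def e3_def power2_eq_square algebra_simps)
  with \<open>\<psi> x1 x2 x3 = 0\<close> e2 have "e3 + e1 ^ 2 - e2 - 162000 * e1 + 8748000000 = 0" by simp
  then have e3: "e3 = e2 - e1 ^ 2 + 162000 * e1 - 8748000000" by (simp add: algebra_simps eq_neg_iff_add_eq_0)
  then show "x1 * x2 * x3 = 1487 * e1 + 40935375 - e1 ^ 2 + 162000 * e1 - 8748000000"
    by (simp add: e2 e3_def)
  define Q where "Q = - ((e1 - 162000) * e2) - 157464000000000 - 1486 * e3"
  have *: "x * Q = 0" if F: "Phi2 x y = 0" "\<psi> x y z = 0"
    and sym: "x + y + z = e1" "x * y + x * z + y * z = e2" "x * y * z = e3" for x y z
  proof -
    \<comment> \<open>The left side is \<open>Phi2 x 0 = (x - 54000)^3\<close>, and the last factor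
      on the right is the third root over \<open>x\<close>. So this is the product of the three
      roots; multiplying by \<open>x\<close> below makes \<open>e3 = x y z\<close> appear.\<close>
    have "x ^ 3 - 162000 * x ^ 2 + 8748000000 * x - 157464000000000 =
        Phi2 x y - y * \<psi> x y z - y * z * (x ^ 2 - 1488 * x + 162000 - y - z)"
      by (simp add: Phi2_def \<psi>_def power2_eq_square power3_eq_cube algebra_simps)
    then have "x * (x ^ 3 - 162000 * x ^ 2 + 8748000000 * x - 157464000000000
        + y * z * (x ^ 2 - 1488 * x + 162000 - y - z)) = 0"
      using F by simp
    moreover have "x * (x ^ 3 - 162000 * x ^ 2 + 8748000000 * x - 157464000000000
        + y * z * (x ^ 2 - 1488 * x + 162000 - y - z)) =
        x * Q + (e1 - 162000 + x) * (x ^ 3 - e1 * x ^ 2 + e2 * x - e3)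
         + x ^ 2 * (e3 + e1 ^ 2 - e2 - 162000 * e1 + 8748000000)"
      unfolding Q_def sym[symmetric]
      by (simp add: power2_eq_square power3_eq_cube power4_eq_xxxx algebra_simps)
    moreover have "x ^ 3 - e1 * x ^ 2 + e2 * x - e3 = 0"
      unfolding sym[symmetric] by (simp add: power2_eq_square power3_eq_cube algebra_simps)
    ultimately show ?thesis using e3 by simp
  qed
  have "x1 * Q = 0"
    by (rule *[of x1 x2 x3]) (use Phi \<open>\<psi> x1 x2 x3 = 0\<close> in \<open>simp_all add: e1_def e2_def e3_def\<close>)
  moreover have "x2 * Q = 0"
    by (rule *[of x2 x1 x3]) (use Phi \<open>\<psi> x2 x1 x3 = 0\<close> Phi2_commute[of x2 x1] in
        \<open>simp_all add: e1_def e2_def e3_def algebra_simps\<close>)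
  ultimately have "(x1 - x2) * Q = 0" by (simp only: left_diff_distrib) simp
  then have "Q = 0" using distinct by simp
  \<comment> \<open>After eliminating \<open>e2\<close> and \<open>e3\<close>, \<open>Q\<close> is
    quadratic in \<open>e1\<close> with integral roots. They are the traces of the Hilbert class
    polynomials of discriminants \<open>-23\<close> and \<open>-31\<close>.\<close>
  moreover have "Q = - ((e1 + 3491750) * (e1 + 39491307))"
    unfolding Q_def e3 e2 by (simp add: power2_eq_square algebra_simps)
  ultimately have "e1 + 3491750 = 0 \<or> e1 + 39491307 = 0" by simp
  then show "e1 = - 3491750 \<or> e1 = - 39491307" by (auto simp: eq_neg_iff_add_eq_0)
qed

text \<open>The cubic is irreducible modulo \<open>2\<close>, so the norm form of \<open>\<int>[x]\<close> (the determinant \<open>N\<close> below) is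
  anisotropic modulo \<open>2\<close>, and a nontrivial relation can be halved forever.\<close>

lemma cubic_powers_independent:
  fixes x :: complex and a b c A B C :: int
  assumes x: "x ^ 3 + of_int a * x ^ 2 + of_int b * x + of_int c = 0"
    and par: "odd c" "odd (a + b)"
    and rel: "of_int A + of_int B * x + of_int C * x ^ 2 = 0"
  shows "A = 0 \<and> B = 0 \<and> C = 0"
  using rel
proof (induction "nat (\<bar>A\<bar> + \<bar>B\<bar> + \<bar>C\<bar>)" arbitrary: A B C rule: less_induct)
  case less
  \<comment> \<open>Coordinates of the relation multiplied by \<open>x\<close>, reduced by the
    cubic; the next line multiplies by \<open>x\<close> once more.\<close>
  define A' B' C' where "A' = - c * C" and "B' = A - b * C" and "C' = B - a * C"
  define A'' B'' C'' where "A'' = - c * C'" and "B'' = A' - b * C'" and "C'' = B' - a * C'"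
  have 1: "of_int A' + of_int B' * x + of_int C' * x ^ 2 = (of_int A + of_int B * x + of_int C * x ^ 2) * x
      - of_int C * (x ^ 3 + of_int a * x ^ 2 + of_int b * x + of_int c)"
    by (simp add: A'_def B'_def C'_def power2_eq_square power3_eq_cube algebra_simps)
  have 2: "of_int A'' + of_int B'' * x + of_int C'' * x ^ 2 = (of_int A' + of_int B' * x + of_int C' * x ^ 2) * x
      - of_int C' * (x ^ 3 + of_int a * x ^ 2 + of_int b * x + of_int c)"
    by (simp add: A''_def B''_def C''_def power2_eq_square power3_eq_cube algebra_simps)
  define N where "N = A * (B' * C'' - C' * B'') - A' * (B * C'' - C * B'') + A'' * (B * C' - C * B')"
  \<comment> \<open>Expansion along the column replaced by the three elements themselves:
    \<open>N\<close> is a combination of the relation and its two multiples, all of which are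
    0.\<close>
  have "of_int N = (of_int A + of_int B * x + of_int C * x ^ 2) * of_int (B' * C'' - C' * B'')
      - (of_int A' + of_int B' * x + of_int C' * x ^ 2) * of_int (B * C'' - C * B'')
      + (of_int A'' + of_int B'' * x + of_int C'' * x ^ 2) * of_int (B * C' - C * B')"
    by (simp add: N_def algebra_simps)
  also have "\<dots> = 0" using 1 2 less.prems x by simp
  finally have "even N" by simp
  then have "even A \<and> even B \<and> even C"
    using par unfolding N_def A''_def B''_def C''_def A'_def B'_def C'_def
    by (cases "even A"; cases "even B"; cases "even C"; cases "even a"; cases "even b"; simp)
  then obtain A0 B0 C0 where h: "A = 2 * A0" "B = 2 * B0" "C = 2 * C0" by (auto elim!: evenE)
  show ?case
  proof (cases "A = 0 \<and> B = 0 \<and> C = 0")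
    case False
    have "2 * (of_int A0 + of_int B0 * x + of_int C0 * x ^ 2) = 0"
      using less.prems by (simp add: h algebra_simps)
    then have "of_int A0 + of_int B0 * x + of_int C0 * x ^ 2 = 0"
      by (metis mult_eq_0_iff zero_neq_numeral)
    then have "A0 = 0 \<and> B0 = 0 \<and> C0 = 0"
      by (intro less.hyps) (use False h in auto)
    then show ?thesis using h by simp
  qed
qed

section \<open>Powers in an order, examined at the prime 17\<close>

lemma prime_17: "prime (17 :: int)"
  by simp

lemma not_dvd_17_simps:
  "\<not> 17 dvd (8 :: int)" "\<not> (17 :: int) dvd u \<Longrightarrow> \<not> 17 dvd u ^ n"
  "\<not> (17 :: int) dvd u \<Longrightarrow> \<not> 17 dvd v \<Longrightarrow> \<not> 17 dvd u * v"
  "\<not> (17 :: int) dvd u \<Longrightarrow> \<not> 17 dvd u + 17 * v"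
  using prime_17 prime_dvd_power[OF prime_17, of u n]
  by (auto simp: prime_dvd_mult_iff dvd_add_left_iff)

text \<open>An order with basis \<open>1, x, z\<close>, given by its multiplication table, in which
  \<open>x\<^sup>2\<close> and \<open>8 x\<close> are congruent modulo \<open>17\<close>.\<close>

locale order_table =
  fixes p q r0 r1 r2 s0 s1 s2 :: int
  assumes q: "17 dvd q" and p: "17 dvd p - 8"
begin

definition table :: "complex \<Rightarrow> complex \<Rightarrow> bool" where
  "table x z \<longleftrightarrow> x * x = of_int q + of_int p * x + 17 * z \<and>
     x * z = of_int r0 + of_int r1 * x + of_int r2 * z \<and>
     z * z = of_int s0 + of_int s1 * x + of_int s2 * z"

text \<open>Coordinates are attached to expressions in \<open>x\<close> and \<open>z\<close>, not to
  numbers, so that the same integers hold at every pair obeying the table, in particular at all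
  conjugates.\<close>

definition rep :: "int \<Rightarrow> int \<Rightarrow> int \<Rightarrow> (complex \<Rightarrow> complex \<Rightarrow> complex) \<Rightarrow> bool" where
  "rep a b c f \<longleftrightarrow> (\<forall>x z. table x z \<longrightarrow> f x z = of_int a + of_int b * x + of_int c * z)"

definition integral_fun :: "(complex \<Rightarrow> complex \<Rightarrow> complex) \<Rightarrow> bool" where
  "integral_fun f \<longleftrightarrow> (\<exists>a b c. rep a b c f)"

lemma rep_add: "rep a b c f \<Longrightarrow> rep a' b' c' g \<Longrightarrow> rep (a + a') (b + b') (c + c') (\<lambda>x z. f x z + g x z)"
  by (auto simp: rep_def algebra_simps)

lemma rep_mult:
  assumes "rep a b c f" "rep a' b' c' g"
  shows "rep (a * a' + b * b' * q + (b * c' + c * b') * r0 + c * c' * s0)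
     (a * b' + b * a' + b * b' * p + (b * c' + c * b') * r1 + c * c' * s1)
     (a * c' + c * a' + b * b' * 17 + (b * c' + c * b') * r2 + c * c' * s2) (\<lambda>x z. f x z * g x z)"
  unfolding rep_def
proof (intro allI impI)
  fix x z assume t: "table x z"
  then have xx: "x * x = of_int q + of_int p * x + 17 * z"
    and xz: "x * z = of_int r0 + of_int r1 * x + of_int r2 * z"
    and zz: "z * z = of_int s0 + of_int s1 * x + of_int s2 * z" by (auto simp: table_def)
  have "f x z * g x z = (of_int a + of_int b * x + of_int c * z) * (of_int a' + of_int b' * x + of_int c' * z)"
    using assms t by (simp add: rep_def)
  also have "\<dots> = of_int a * of_int a' + of_int (a * b' + b * a') * x + of_int (a * c' + c * a') * z
    + of_int (b * b') * (x * x) + of_int (b * c' + c * b') * (x * z) + of_int (c * c') * (z * z)"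
    by (simp add: algebra_simps)
  also have "\<dots> = of_int (a * a' + b * b' * q + (b * c' + c * b') * r0 + c * c' * s0) +
     of_int (a * b' + b * a' + b * b' * p + (b * c' + c * b') * r1 + c * c' * s1) * x +
     of_int (a * c' + c * a' + b * b' * 17 + (b * c' + c * b') * r2 + c * c' * s2) * z"
    unfolding xx xz zz by (simp add: algebra_simps)
  finally show "f x z * g x z = of_int (a * a' + b * b' * q + (b * c' + c * b') * r0 + c * c' * s0) +
     of_int (a * b' + b * a' + b * b' * p + (b * c' + c * b') * r1 + c * c' * s1) * x +
     of_int (a * c' + c * a' + b * b' * 17 + (b * c' + c * b') * r2 + c * c' * s2) * z" .
qed

lemma rep_basis: "rep k 0 0 (\<lambda>x z. of_int k)" "rep 0 1 0 (\<lambda>x z. x)" "rep 0 0 1 (\<lambda>x z. z)"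
  by (simp_all add: rep_def)

lemma integral_fun_intros:
  "integral_fun f \<Longrightarrow> integral_fun g \<Longrightarrow> integral_fun (\<lambda>x z. f x z + g x z)"
  "integral_fun f \<Longrightarrow> integral_fun g \<Longrightarrow> integral_fun (\<lambda>x z. f x z * g x z)"
  "integral_fun (\<lambda>x z. of_int k)" "integral_fun (\<lambda>x z. x)" "integral_fun (\<lambda>x z. z)"
  unfolding integral_fun_def using rep_add rep_mult rep_basis by blast+

text \<open>Modulo 17 a power is \<open>b x\<close>, and multiplying by \<open>x\<close> gives
  \<open>8 b x\<close> because \<open>p\<close> is 8 and \<open>q\<close> is 0 there; 8 is a
  unit.\<close>

lemma rep_power_x:
  obtains a b c where "17 dvd a" "\<not> 17 dvd b" "17 dvd c" "rep a b c (\<lambda>x z. x ^ Suc m)"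
proof -
  have "\<exists>a b c. 17 dvd a \<and> \<not> 17 dvd b \<and> 17 dvd c \<and> rep a b c (\<lambda>x z. x ^ Suc m)"
  proof (induction m)
    case 0
    show ?case by (intro exI[of _ 0] exI[of _ 1]) (use rep_basis(2) in simp)
  next
    case (Suc m)
    then obtain a b c where abc: "17 dvd a" "\<not> 17 dvd b" "17 dvd c" "rep a b c (\<lambda>x z. x ^ Suc m)"
      by blast
    have "rep (b * q + c * r0) (a + b * p + c * r1) (b * 17 + c * r2) (\<lambda>x z. x ^ Suc (Suc m))"
      using rep_mult[OF rep_basis(2) abc(4)] by (simp add: algebra_simps)
    moreover have "\<not> 17 dvd a + b * p + c * r1"
    proof
      assume "17 dvd a + b * p + c * r1"
      moreover have "b * 8 = (a + b * p + c * r1) - a - c * r1 - b * (p - 8)" by (simp add: algebra_simps)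
      moreover have "17 dvd c * r1" "17 dvd b * (p - 8)" using abc p by simp_all
      ultimately have "17 dvd b * 8" using abc(1) by (metis dvd_diff)
      then show False using not_dvd_17_simps(3)[OF abc(2) not_dvd_17_simps(1)] by simp
    qed
    moreover have "17 dvd b * q + c * r0" "17 dvd b * 17 + c * r2"
      using abc q by auto
    ultimately show ?case by blast
  qed
  then show thesis using that by blast
qed

text \<open>Up to a constant, \<open>f\<close> is \<open>17\<^sup>k\<close> times a vector that is congruent modulo \<open>17\<close> to a nonzero multiple
  of \<open>z\<close>. Raising to the power \<open>17\<close> increases \<open>k\<close> by one.\<close>

definition lifted :: "nat \<Rightarrow> (complex \<Rightarrow> complex \<Rightarrow> complex) \<Rightarrow> bool" where
  "lifted k f \<longleftrightarrow> (\<exists>u s r. \<not> 17 dvd u \<and> \<not> 17 dvd r \<and> rep u (17 ^ k * (17 * s)) (17 ^ k * r) f)"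

text \<open>To first order the power is \<open>8^(N+1) + 17 (N+1) 8^N z\<close>, and everything else
  is divisible by \<open>17^2\<close>. The coefficient of \<open>z\<close> has exactly one factor 17
  because 17 does not divide the exponent.\<close>

lemma lifted_coprime_power:
  assumes "\<not> 17 dvd Suc N"
  shows "lifted 1 (\<lambda>x z. (8 + 17 * z) ^ Suc N)"
proof -
  have "\<exists>W. integral_fun W \<and> (\<forall>x z. (8 + 17 * z) ^ Suc N =
      of_int (8 ^ Suc N) + of_int (17 * (int (Suc N) * 8 ^ N)) * z + of_int (17 ^ 2) * W x z)"
  proof (induction N)
    case 0
    show ?case using integral_fun_intros(3)[of 0] by (intro exI[of _ "\<lambda>x z. 0"]) simp
  next
    case (Suc N)
    then obtain W where W: "integral_fun W" "\<And>x z. (8 + 17 * z) ^ Suc N =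
      of_int (8 ^ Suc N) + of_int (17 * (int (Suc N) * 8 ^ N)) * z + of_int (17 ^ 2) * W x z" by blast
    let ?W = "\<lambda>x z. of_int (int (Suc N) * 8 ^ N) * (z * z) + (of_int 8 + of_int 17 * z) * W x z"
    have "integral_fun ?W" by (intro integral_fun_intros W)
    moreover have "(8 + 17 * z) ^ Suc (Suc N) = of_int (8 ^ Suc (Suc N)) +
        of_int (17 * (int (Suc (Suc N)) * 8 ^ Suc N)) * z + of_int (17 ^ 2) * ?W x z" for x z
      unfolding power_Suc[of "8 + 17 * z" "Suc N"] W(2)[of z x]
      by (simp add: algebra_simps power2_eq_square)
    ultimately show ?case by blast
  qed
  then obtain W where W: "integral_fun W" "\<And>x z. (8 + 17 * z) ^ Suc N =
      of_int (8 ^ Suc N) + of_int (17 * (int (Suc N) * 8 ^ N)) * z + of_int (17 ^ 2) * W x z" by blast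
  obtain a b c where "rep a b c W" using W(1) by (auto simp: integral_fun_def)
  then have "rep (8 ^ Suc N + 17 * (17 * a)) (17 ^ 1 * (17 * b)) (17 ^ 1 * (int (Suc N) * 8 ^ N + 17 * c))
      (\<lambda>x z. (8 + 17 * z) ^ Suc N)"
    unfolding rep_def
  proof (intro allI impI)
    fix x z assume "table x z"
    with \<open>rep a b c W\<close> have "W x z = of_int a + of_int b * x + of_int c * z" by (simp add: rep_def)
    then show "(8 + 17 * z) ^ Suc N = of_int (8 ^ Suc N + 17 * (17 * a)) + of_int (17 ^ 1 * (17 * b)) * x +
        of_int (17 ^ 1 * (int (Suc N) * 8 ^ N + 17 * c)) * z"
      unfolding W(2)[of z x] by (simp add: algebra_simps)
  qed
  moreover have "\<not> 17 dvd 8 ^ Suc N + 17 * (17 * a)"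
    by (intro not_dvd_17_simps)
  moreover have "\<not> (17 :: int) dvd int (Suc N)"
    using assms by (metis int_dvd_int_iff of_nat_numeral)
  then have "\<not> 17 dvd int (Suc N) * 8 ^ N + 17 * c"
    by (intro not_dvd_17_simps)
  ultimately show ?thesis unfolding lifted_def by blast
qed

text \<open>Write \<open>f = u + 17^k t\<close>. The linear term of \<open>f^17\<close> gains one
  factor 17. The quadratic term has coefficient \<open>136 = 8 * 17\<close>, hence at least
  \<open>17^(2k+1)\<close>, and the rest has \<open>17^(3k)\<close>; as \<open>k >= 1\<close>, both
  are divisible by \<open>17^(k+2)\<close> and do not disturb the direction.\<close>

lemma lifted_power_17:
  assumes "lifted k f" "k \<ge> 1"
  shows "lifted (Suc k) (\<lambda>x z. f x z ^ 17)"
proof -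
  from assms(1) obtain u s r where usr: "\<not> 17 dvd u" "\<not> 17 dvd r" "rep u (17 ^ k * (17 * s)) (17 ^ k * r) f"
    by (auto simp: lifted_def)
  define t :: "complex \<Rightarrow> complex \<Rightarrow> complex" where "t = (\<lambda>x z. of_int (17 * s) * x + of_int r * z)"
  have t: "integral_fun t" unfolding t_def by (intro integral_fun_intros)
  have f: "f x z = of_int u + of_int (17 ^ k) * t x z" if "table x z" for x z
    using usr(3) that by (simp add: rep_def t_def algebra_simps)
  have "\<exists>W. integral_fun W \<and> (\<forall>x z. (of_int u + of_int (17 ^ k) * t x z) ^ (n + 2) =
      of_int (u ^ (n + 2)) + of_int (int (n + 2) * u ^ (n + 1)) * (of_int (17 ^ k) * t x z) +
      of_int (int ((n + 2) choose 2) * u ^ n) * (of_int (17 ^ k) * t x z) ^ 2 +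
      (of_int (17 ^ k) * t x z) ^ 3 * W x z)" for n
  proof (induction n)
    case 0
    show ?case using integral_fun_intros(3)[of 0]
      by (intro exI[of _ "\<lambda>x z. 0"]) (simp add: numeral_2_eq_2 algebra_simps)
  next
    case (Suc n)
    then obtain W where W: "integral_fun W" "\<And>x z. (of_int u + of_int (17 ^ k) * t x z) ^ (n + 2) =
      of_int (u ^ (n + 2)) + of_int (int (n + 2) * u ^ (n + 1)) * (of_int (17 ^ k) * t x z) +
      of_int (int ((n + 2) choose 2) * u ^ n) * (of_int (17 ^ k) * t x z) ^ 2 +
      (of_int (17 ^ k) * t x z) ^ 3 * W x z" by blast
    let ?W = "\<lambda>x z. of_int (int ((n + 2) choose 2) * u ^ n) + (of_int u + of_int (17 ^ k) * t x z) * W x z"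
    have "integral_fun ?W" by (intro integral_fun_intros W t)
    moreover have choose: "(Suc n + 2) choose 2 = (n + 2) + ((n + 2) choose 2)"
      by (simp add: numeral_2_eq_2)
    have "(of_int u + of_int (17 ^ k) * t x z) ^ (Suc n + 2) =
      of_int (u ^ (Suc n + 2)) + of_int (int (Suc n + 2) * u ^ (Suc n + 1)) * (of_int (17 ^ k) * t x z) +
      of_int (int ((Suc n + 2) choose 2) * u ^ Suc n) * (of_int (17 ^ k) * t x z) ^ 2 +
      (of_int (17 ^ k) * t x z) ^ 3 * ?W x z" for x z
    proof -
      define h where "h = of_int (17 ^ k) * t x z"
      have "(of_int u + h) ^ (Suc n + 2) = (of_int u + h) * (of_int u + h) ^ (n + 2)" by simp
      also have "\<dots> = of_int (u ^ (Suc n + 2)) + of_int (int (Suc n + 2) * u ^ (Suc n + 1)) * h +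
        of_int (int ((Suc n + 2) choose 2) * u ^ Suc n) * h ^ 2 +
        h ^ 3 * (of_int (int ((n + 2) choose 2) * u ^ n) + (of_int u + h) * W x z)"
        unfolding W(2)[of x z, folded h_def] choose
        by (simp del: binomial_Suc_Suc add: algebra_simps power2_eq_square power3_eq_cube)
      finally show ?thesis by (simp only: h_def)
    qed
    ultimately show ?case by blast
  qed
  from this[of 15] obtain W where W: "integral_fun W" "\<And>x z. (of_int u + of_int (17 ^ k) * t x z) ^ 17 =
      of_int (u ^ 17) + of_int (17 * u ^ 16) * (of_int (17 ^ k) * t x z) +
      of_int (136 * u ^ 15) * (of_int (17 ^ k) * t x z) ^ 2 + (of_int (17 ^ k) * t x z) ^ 3 * W x z"
    by (auto simp: choose_two)
  obtain j where j: "k = Suc j" using assms(2) by (cases k) auto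
  \<comment> \<open>The quadratic and higher terms of the expansion divided by
    \<open>17^(k+2)\<close>, with \<open>k = Suc j\<close>.\<close>
  define V where "V = (\<lambda>x z. of_int (8 * u ^ 15 * 17 ^ j) * (t x z * t x z) +
      of_int (17 ^ (2 * j)) * (t x z * t x z * t x z * W x z))"
  have "integral_fun V" unfolding V_def by (intro integral_fun_intros W t)
  then obtain a b c where V: "rep a b c V" by (auto simp: integral_fun_def)
  have f17: "f x z ^ 17 = of_int (u ^ 17) + of_int (17 ^ Suc k) * (of_int (u ^ 16) * t x z + of_int 17 * V x z)"
    if "table x z" for x z
    unfolding f[OF that] W(2) V_def unfolding j
    by (simp add: algebra_simps power2_eq_square power3_eq_cube power_add power_mult)
  have "rep (u ^ 17 + 17 * (17 ^ k * (17 * a))) (17 ^ Suc k * (17 * (u ^ 16 * s + b)))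
      (17 ^ Suc k * (u ^ 16 * r + 17 * c)) (\<lambda>x z. f x z ^ 17)"
    unfolding rep_def
  proof (intro allI impI)
    fix x z assume xz: "table x z"
    with V have "V x z = of_int a + of_int b * x + of_int c * z" by (simp add: rep_def)
    then show "f x z ^ 17 = of_int (u ^ 17 + 17 * (17 ^ k * (17 * a))) +
        of_int (17 ^ Suc k * (17 * (u ^ 16 * s + b))) * x + of_int (17 ^ Suc k * (u ^ 16 * r + 17 * c)) * z"
      unfolding f17[OF xz] t_def by (simp add: algebra_simps)
  qed
  moreover have "\<not> 17 dvd u ^ 17 + 17 * (17 ^ k * (17 * a))" "\<not> 17 dvd u ^ 16 * r + 17 * c"
    using usr by (intro not_dvd_17_simps; simp)+
  ultimately show ?thesis unfolding lifted_def by blast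
qed

lemma lifted_power:
  assumes "n > 0"
  shows "\<exists>k\<ge>1. lifted k (\<lambda>x z. (8 + 17 * z) ^ n)"
  using assms
proof (induction n rule: less_induct)
  case (less n)
  show ?case
  proof (cases "17 dvd n")
    case True
    then obtain n' where n: "n = n' * 17" by (auto elim!: dvdE simp: mult.commute)
    then obtain k where "k \<ge> 1" "lifted k (\<lambda>x z. (8 + 17 * z) ^ n')"
      using less.IH[of n'] less.prems by auto
    then have "lifted (Suc k) (\<lambda>x z. (8 + 17 * z) ^ n)"
      unfolding n power_mult by (intro lifted_power_17)
    then show ?thesis by auto
  next
    case False
    then show ?thesis using lifted_coprime_power[of "n - 1"] less.prems by auto
  qed
qed

text \<open>After the common factor \<open>17^k\<close> is removed, the determinant of the
  coordinates at \<open>x\<close> and \<open>z\<close> is \<open>a1 * r\<close> modulo 17, a product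
  of units.\<close>

lemma powers_transversal:
  assumes "m > 0" "n > 0"
  obtains a0 a1 a2 c0 c1 c2 where "rep a0 a1 a2 (\<lambda>x z. x ^ m)" "rep c0 c1 c2 (\<lambda>x z. (8 + 17 * z) ^ n)"
    "a1 * c2 \<noteq> a2 * c1"
proof -
  obtain a0 a1 a2 where a: "17 dvd a0" "\<not> 17 dvd a1" "17 dvd a2" "rep a0 a1 a2 (\<lambda>x z. x ^ m)"
    using rep_power_x[of "m - 1"] assms by auto
  obtain k u s r where c: "\<not> 17 dvd u" "\<not> 17 dvd r"
    "rep u (17 ^ k * (17 * s)) (17 ^ k * r) (\<lambda>x z. (8 + 17 * z) ^ n)"
    using lifted_power[OF assms(2)] by (auto simp: lifted_def)
  show thesis
  proof (rule that[OF a(4) c(3)])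
    show "a1 * (17 ^ k * r) \<noteq> a2 * (17 ^ k * (17 * s))"
    proof
      assume "a1 * (17 ^ k * r) = a2 * (17 ^ k * (17 * s))"
      then have "17 ^ k * (a1 * r) = 17 ^ k * (17 * (a2 * s))" by (simp add: algebra_simps)
      then have "a1 * r = 17 * (a2 * s)" by (subst (asm) mult_cancel_left) auto
      then have "17 dvd a1 * r" by simp
      then show False using not_dvd_17_simps(3)[OF a(2) c(2)] by simp
    qed
  qed
qed

end

text \<open>If \<open>x\<close> and \<open>x'\<close> are different roots, complex conjugation replaces the action of the Galois group:
  subtracting the conjugate relation reduces to the case of one root.\<close>

lemma (in order_table) linear_relation_trivial:
  fixes x1 x2 x3 x x' :: complex and A B C E :: int
  defines "Z \<equiv> \<lambda>x. (x ^ 2 - of_int p * x - of_int q) / 17"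
  assumes conj: "cnj x1 = x1" "cnj x2 = x3" "x2 \<noteq> x3" and sum: "x1 + x2 + x3 = of_int E"
    and table: "\<And>x. x \<in> {x1, x2, x3} \<Longrightarrow> table x (Z x)"
    and indep: "\<And>x a b c. x \<in> {x1, x2, x3} \<Longrightarrow> of_int a + of_int b * x + of_int c * x ^ 2 = 0
        \<Longrightarrow> a = 0 \<and> b = 0 \<and> c = 0"
    and pos: "m > 0" "n > 0" and x: "x \<in> {x1, x2, x3}" "x' \<in> {x1, x2, x3}"
    and rel: "of_int A + of_int B * x ^ m + of_int C * (8 + 17 * Z x') ^ n = 0"
  shows "A = 0 \<and> B = 0 \<and> C = 0"
proof -
  obtain a0 a1 a2 c0 c1 c2 where reps: "rep a0 a1 a2 (\<lambda>x z. x ^ m)" "rep c0 c1 c2 (\<lambda>x z. (8 + 17 * z) ^ n)"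
    and det: "a1 * c2 \<noteq> a2 * c1"
    using powers_transversal[OF pos] by blast
  define f g :: "complex \<Rightarrow> complex" where "f = (\<lambda>x. x ^ m)" and "g = (\<lambda>x. (8 + 17 * Z x) ^ n)"
  have f: "f x = of_int a0 + of_int a1 * x + of_int a2 * Z x"
    and g: "g x = of_int c0 + of_int c1 * x + of_int c2 * Z x" if "x \<in> {x1, x2, x3}" for x
    using reps table[OF that] by (auto simp: rep_def f_def g_def)
  have cnj_fg: "cnj (f x) = f (cnj x)" "cnj (g x) = g (cnj x)" for x
    by (simp_all add: f_def g_def Z_def)
  have conj': "cnj x3 = x2" using conj(2) by auto
  have rel: "of_int A + of_int B * f x + of_int C * g x' = 0"
    using rel by (simp add: f_def g_def)
  from arg_cong[OF this, of cnj]
  have rel': "of_int A + of_int B * f (cnj x) + of_int C * g (cnj x') = 0"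
    by (simp add: cnj_fg)
  have det0: "b = 0 \<and> c = 0" if "b * a1 + c * c1 = 0" "b * a2 + c * c2 = 0" for b c :: int
  proof -
    have "b * (a1 * c2 - a2 * c1) = (b * a1 + c * c1) * c2 - (b * a2 + c * c2) * c1"
      "c * (a1 * c2 - a2 * c1) = (b * a2 + c * c2) * a1 - (b * a1 + c * c1) * a2"
      by (simp_all add: algebra_simps)
    then have "b * (a1 * c2 - a2 * c1) = 0" "c * (a1 * c2 - a2 * c1) = 0"
      unfolding that by simp_all
    then show ?thesis using det by simp
  qed
  have single: "u = 0 \<and> v = 0" if "y \<in> {x1, x2, x3}" "of_int w + of_int u * y + of_int v * Z y = 0"
    for y and u v w :: int
  proof -
    have "of_int (17 * w - v * q) + of_int (17 * u - v * p) * y + of_int v * y ^ 2 =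
        17 * (of_int w + of_int u * y + of_int v * Z y)"
      by (simp add: Z_def field_simps)
    with that(2) have "of_int (17 * w - v * q) + of_int (17 * u - v * p) * y + of_int v * y ^ 2 = 0" by simp
    from indep[OF that(1) this] show ?thesis by auto
  qed
  \<comment> \<open>\<open>Z x2 - Z x3\<close> is \<open>x2 - x3\<close> times
    \<open>(x2 + x3 - p) / 17\<close>, and \<open>x2 + x3 = E - x1\<close>. Cancelling
    \<open>x2 - x3\<close> leaves a relation for \<open>x1\<close> alone.\<close>
  have difference: "u = 0 \<and> v = 0" if "of_int u * (x2 - x3) + of_int v * (Z x2 - Z x3) = 0" for u v :: int
  proof -
    have "(x2 - x3) * (of_int (17 * u + v * (E - p)) + of_int (- v) * x1 + of_int 0 * x1 ^ 2) =
        17 * (of_int u * (x2 - x3) + of_int v * (Z x2 - Z x3))"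
      by (simp add: Z_def sum[symmetric] field_simps power2_eq_square)
    with that conj(3) have "of_int (17 * u + v * (E - p)) + of_int (- v) * x1 + of_int 0 * x1 ^ 2 = 0" by simp
    from indep[OF _ this] show ?thesis by auto
  qed
  have f23: "f x2 - f x3 = of_int a1 * (x2 - x3) + of_int a2 * (Z x2 - Z x3)"
    and g23: "g x2 - g x3 = of_int c1 * (x2 - x3) + of_int c2 * (Z x2 - Z x3)"
    by (simp_all add: f g algebra_simps)
  have "B = 0 \<and> C = 0"
  proof (cases "x = x'")
    case True
    have "of_int (A + B * a0 + C * c0) + of_int (B * a1 + C * c1) * x + of_int (B * a2 + C * c2) * Z x = 0"
      using rel unfolding True[symmetric] f[OF x(1)] g[OF x(1)] by (simp add: algebra_simps)
    from single[OF x(1) this] det0 show ?thesis by blast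
  next
    case False
    then consider "x = x1" "x' = x2 \<or> x' = x3" | "x = x2 \<or> x = x3" "x' = x1" | "x = x2" "x' = x3" | "x = x3" "x' = x2"
      using x by auto
    then show ?thesis
    proof cases
      case 1
      \<comment> \<open>The term in the real root is fixed by conjugation, so the difference
        isolates the other term. Once its coefficient is 0, the original relation involves only
        \<open>x1\<close>.\<close>
      have "of_int C * (g x' - g (cnj x')) = (of_int A + of_int B * f x + of_int C * g x') -
          (of_int A + of_int B * f (cnj x) + of_int C * g (cnj x'))"
        using 1(1) conj(1) by (simp add: algebra_simps)
      then have "of_int C * (g x' - g (cnj x')) = 0" unfolding rel rel' by simp
      then have "of_int C * (g x2 - g x3) = 0" using 1(2) conj(2) conj' by auto
      then have "of_int (C * c1) * (x2 - x3) + of_int (C * c2) * (Z x2 - Z x3) = 0"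
        unfolding g23 by (simp add: algebra_simps)
      from difference[OF this] have "C = 0" using det0[of 0 C] by simp
      have "of_int (A + B * a0) + of_int (B * a1) * x1 + of_int (B * a2) * Z x1 = 0"
        using rel 1(1) \<open>C = 0\<close> f[of x1] by (simp add: algebra_simps)
      from single[OF _ this] show ?thesis using det0[of B 0] \<open>C = 0\<close> by simp
    next
      case 2
      have "of_int B * (f x - f (cnj x)) = (of_int A + of_int B * f x + of_int C * g x') -
          (of_int A + of_int B * f (cnj x) + of_int C * g (cnj x'))"
        using 2(2) conj(1) by (simp add: algebra_simps)
      then have "of_int B * (f x - f (cnj x)) = 0" unfolding rel rel' by simp
      then have "of_int B * (f x2 - f x3) = 0" using 2(1) conj(2) conj' by auto
      then have "of_int (B * a1) * (x2 - x3) + of_int (B * a2) * (Z x2 - Z x3) = 0"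
        unfolding f23 by (simp add: algebra_simps)
      from difference[OF this] have "B = 0" using det0[of B 0] by simp
      have "of_int (A + C * c0) + of_int (C * c1) * x1 + of_int (C * c2) * Z x1 = 0"
        using rel 2(2) \<open>B = 0\<close> g[of x1] by (simp add: algebra_simps)
      from single[OF _ this] show ?thesis using det0[of 0 C] \<open>B = 0\<close> by simp
    next
      case 3
      \<comment> \<open>Conjugation swaps the two nonreal roots, so both terms survive in the
        difference, with opposite signs.\<close>
      have "of_int B * (f x2 - f x3) - of_int C * (g x2 - g x3) =
        (of_int A + of_int B * f x + of_int C * g x') - (of_int A + of_int B * f (cnj x) + of_int C * g (cnj x'))"
        unfolding 3 conj(2) conj' by (simp add: algebra_simps)
      then have "of_int (B * a1 - C * c1) * (x2 - x3) + of_int (B * a2 - C * c2) * (Z x2 - Z x3) = 0"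
        unfolding rel rel' f23 g23 by (simp add: algebra_simps)
      from difference[OF this] show ?thesis using det0[of B "- C"] by simp
    next
      case 4
      have "of_int B * (f x2 - f x3) - of_int C * (g x2 - g x3) =
        (of_int A + of_int B * f (cnj x) + of_int C * g (cnj x')) - (of_int A + of_int B * f x + of_int C * g x')"
        unfolding 4 conj(2) conj' by (simp add: algebra_simps)
      then have "of_int (B * a1 - C * c1) * (x2 - x3) + of_int (B * a2 - C * c2) * (Z x2 - Z x3) = 0"
        unfolding rel rel' f23 g23 by (simp add: algebra_simps)
      from difference[OF this] show ?thesis using det0[of B "- C"] by simp
    qed
  qed
  with rel show ?thesis by simp
qed

text \<open>The base of the last power is the third root of the modular polynomial over
  \<open>x'\<close>: subtracting the other two roots from the trace
  \<open>x'^2 - 1488 x' + 162000\<close> and completing them to the full sum changes 1488 into 1487.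
  For either value of the sum, the resulting order satisfies the two congruences at 17.\<close>

lemma two_isogeny_triangle_independent:
  fixes x1 x2 x3 x x' :: complex and A B C :: int
  assumes Phi: "Phi2 x1 x2 = 0" "Phi2 x1 x3 = 0" "Phi2 x2 x3 = 0"
    and distinct: "x1 \<noteq> x2" "x1 \<noteq> x3" "x2 \<noteq> x3"
    and conj: "cnj x1 = x1" "cnj x2 = x3"
    and pos: "m > 0" "n > 0" and x: "x \<in> {x1, x2, x3}" "x' \<in> {x1, x2, x3}"
    and rel: "of_int A + of_int B * x ^ m + of_int C * (x' ^ 2 - 1487 * x' + 162000 - (x1 + x2 + x3)) ^ n = 0"
  shows "A = 0 \<and> B = 0 \<and> C = 0"
proof -
  note tri = two_isogeny_triangle[OF Phi distinct]
  have cubic: "w ^ 3 - (x1 + x2 + x3) * w ^ 2 + (x1 * x2 + x1 * x3 + x2 * x3) * w - x1 * x2 * x3 = 0"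
    if "w \<in> {x1, x2, x3}" for w
  proof -
    have "w ^ 3 - (x1 + x2 + x3) * w ^ 2 + (x1 * x2 + x1 * x3 + x2 * x3) * w - x1 * x2 * x3 =
       (w - x1) * (w - x2) * (w - x3)"
      by (simp add: power2_eq_square power3_eq_cube algebra_simps)
    then show ?thesis using that by auto
  qed
  \<comment> \<open>The constants below are the multiplication table of \<open>1, w, z\<close>, where
    \<open>17 z = w\<^sup>2 - 1487 w + 162000 - (x1 + x2 + x3) - 8\<close>, reduced by the cubic.\<close>
  consider "x1 + x2 + x3 = - 3491750" | "x1 + x2 + x3 = - 39491307" using tri(3) by blast
  then show ?thesis
  proof cases
    case 1
    interpret order_table 1487 "-3653742" "-499653913" "-2323106" "-3493237"
      103214150083392 477332951777 718109608384
      by unfold_locales simp_all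
    have c: "w ^ 3 + 3491750 * w ^ 2 - 5151296875 * w + 12771880859375 = 0" if "w \<in> {x1, x2, x3}" for w
      using cubic[OF that] unfolding tri(1,2) 1 by (simp add: algebra_simps)
    \<comment> \<open>Modulo 2 this cubic is \<open>w^3 + w + 1\<close>, and the one of the other
      case is \<open>w^3 + w^2 + 1\<close>; these are the two irreducible cubics over the field with
      two elements.\<close>
    have irr: "a = 0 \<and> b = 0 \<and> c = 0"
      if "w \<in> {x1, x2, x3}" "of_int a + of_int b * w + of_int c * w ^ 2 = 0" for w and a b c :: int
      by (rule cubic_powers_independent[OF _ _ _ that(2), of 3491750 "- 5151296875" 12771880859375])
         (use c[OF that(1)] in simp_all)
    have tab: "table w ((w ^ 2 - of_int 1487 * w - of_int (- 3653742)) / 17)" if "w \<in> {x1, x2, x3}" for w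
    proof -
      define t where "t = w ^ 2 - 1487 * w + 3653742"
      have "w * t = 17 * (- 499653913) + 17 * (- 2323106) * w + (- 3493237) * t"
        "t * t = 289 * 103214150083392 + 289 * 477332951777 * w + 17 * 718109608384 * t"
        unfolding t_def using c[OF that] by algebra+
      then show ?thesis
        by (simp add: table_def t_def[symmetric]) (simp add: t_def field_simps power2_eq_square)
    qed
    have sum: "x1 + x2 + x3 = of_int (- 3491750)" using 1 by simp
    have "8 + 17 * ((x' ^ 2 - of_int 1487 * x' - of_int (- 3653742)) / 17) = x' ^ 2 - 1487 * x' + 162000 - (x1 + x2 + x3)"
      unfolding 1 by simp
    note rel' = rel[folded this]
    show ?thesis
      by (rule linear_relation_trivial[OF conj distinct(3) sum tab irr pos x rel'])
  next
    case 2
    interpret order_table 1487 "-39653299" "-516594881" "-205485" "-39492794"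
      1200628914795328 477332951777 91749384698304
      by unfold_locales simp_all
    have c: "w ^ 3 + 39491307 * w ^ 2 - 58682638134 * w + 1566028350940383 = 0" if "w \<in> {x1, x2, x3}" for w
      using cubic[OF that] unfolding tri(1,2) 2 by (simp add: algebra_simps)
    have irr: "a = 0 \<and> b = 0 \<and> c = 0"
      if "w \<in> {x1, x2, x3}" "of_int a + of_int b * w + of_int c * w ^ 2 = 0" for w and a b c :: int
      by (rule cubic_powers_independent[OF _ _ _ that(2), of 39491307 "- 58682638134" 1566028350940383])
         (use c[OF that(1)] in simp_all)
    have tab: "table w ((w ^ 2 - of_int 1487 * w - of_int (- 39653299)) / 17)" if "w \<in> {x1, x2, x3}" for w
    proof -
      define t where "t = w ^ 2 - 1487 * w + 39653299"
      have "w * t = 17 * (- 516594881) + 17 * (- 205485) * w + (- 39492794) * t"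
        "t * t = 289 * 1200628914795328 + 289 * 477332951777 * w + 17 * 91749384698304 * t"
        unfolding t_def using c[OF that] by algebra+
      then show ?thesis
        by (simp add: table_def t_def[symmetric]) (simp add: t_def field_simps power2_eq_square)
    qed
    have sum: "x1 + x2 + x3 = of_int (- 39491307)" using 2 by simp
    have "8 + 17 * ((x' ^ 2 - of_int 1487 * x' - of_int (- 39653299)) / 17) = x' ^ 2 - 1487 * x' + 162000 - (x1 + x2 + x3)"
      unfolding 2 by simp
    note rel' = rel[folded this]
    show ?thesis
      by (rule linear_relation_trivial[OF conj distinct(3) sum tab irr pos x rel'])
  qed
qed

lemma rat_lin_independentI:
  fixes u v :: complex
  assumes *: "\<And>A B C :: int. of_int A + of_int B * u + of_int C * v = 0 \<Longrightarrow> A = 0 \<and> B = 0 \<and> C = 0"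
  shows "rat_lin_independent [1, u, v]"
proof -
  have ne: "1 \<noteq> u" "1 \<noteq> v" "u \<noteq> v"
    using *[of 1 "-1" 0] *[of 1 0 "-1"] *[of 0 1 "-1"] by auto
  have "a = 0 \<and> b = 0 \<and> c = 0" if rel: "of_rat a + of_rat b * u + of_rat c * v = 0" for a b c :: rat
  proof -
    have ratE: "\<exists>k l :: int. l \<noteq> 0 \<and> r = of_int k / of_int l" for r :: rat
      by (metis quotient_of_div quotient_of_denom_pos less_irrefl surj_pair)
    obtain a1 a2 where a: "a2 \<noteq> 0" "a = of_int a1 / of_int a2" using ratE by blast
    obtain b1 b2 where b: "b2 \<noteq> 0" "b = of_int b1 / of_int b2" using ratE by blast
    obtain c1 c2 where c: "c2 \<noteq> 0" "c = of_int c1 / of_int c2" using ratE by blast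
    have "of_int (a1 * b2 * c2) + of_int (b1 * a2 * c2) * u + of_int (c1 * a2 * b2) * v =
       of_int (a2 * b2 * c2) * (of_rat a + of_rat b * u + of_rat c * v)"
      using a(1) b(1) c(1) unfolding a(2) b(2) c(2) by (simp add: of_rat_divide field_simps)
    also have "\<dots> = 0" by (simp add: rel)
    finally show ?thesis using *[of "a1 * b2 * c2" "b1 * a2 * c2" "c1 * a2 * b2"] a b c by auto
  qed
  then have "rat_complex.independent {1, u, v}"
    using ne by (subst rat_complex.dependent_finite) (auto simp: add.assoc)
  then show ?thesis using ne by (simp add: rat_lin_independent_def)
qed

section \<open>Reduced forms of the four discriminants and their isogenies\<close>

lemma reduced_form_bound:
  fixes a b c D :: int
  assumes "a > 0" "b ^ 2 + D = 4 * a * c" "\<bar>b\<bar> \<le> a" "a \<le> c"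
  shows "3 * a ^ 2 \<le> D"
proof -
  have "b ^ 2 \<le> a ^ 2" using assms(1,3) by (simp add: abs_le_square_iff[symmetric])
  moreover have "a * a \<le> a * c" using assms by (intro mult_left_mono) auto
  ultimately show ?thesis using assms(2) by (simp add: power2_eq_square)
qed

lemma singular_modulus_23:
  assumes "is_singular_modulus_at x \<tau> (- 23)"
  shows "x \<in> {form_j 23 1 1, form_j 23 2 1, form_j 23 2 (- 1)}"
proof -
  from assms obtain a b c :: int where *: "a > 0" "b ^ 2 + 23 = 4 * a * c" "\<bar>b\<bar> \<le> a" "a \<le> c"
    "x = form_j 23 a b"
    by (rule quadratic_with_discriminant_reduced[of x \<tau> 23]) auto
  \<comment> \<open>A reduced form has \<open>3 a^2 \<le> 23\<close>; the other three discriminants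
    are bounded in the same way.\<close>
  have "a < 3"
  proof (rule ccontr)
    assume "\<not> ?thesis"
    then have "3 ^ 2 \<le> a ^ 2" by (intro power_mono) auto
    then show False using reduced_form_bound[OF *(1-4)] by simp
  qed
  then consider "a = 1" | "a = 2" using *(1) by linarith
  then show ?thesis
  proof cases
    case 1
    then have "b = -1 \<or> b = 0 \<or> b = 1" using *(3) by linarith
    moreover have "form_j 23 1 (- 1) = form_j 23 1 1" using form_j_add[of 23 1 "- 1"] by simp
    ultimately show ?thesis using *(2,5) 1 by auto presburger
  next
    case 2
    then have "b = -2 \<or> b = -1 \<or> b = 0 \<or> b = 1 \<or> b = 2" using *(3) by linarith
    then show ?thesis using *(2,5) 2 by auto presburger+
  qed
qed

lemma singular_modulus_31:
  assumes "is_singular_modulus_at x \<tau> (- 31)"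
  shows "x \<in> {form_j 31 1 1, form_j 31 2 1, form_j 31 2 (- 1)}"
proof -
  from assms obtain a b c :: int where *: "a > 0" "b ^ 2 + 31 = 4 * a * c" "\<bar>b\<bar> \<le> a" "a \<le> c"
    "x = form_j 31 a b"
    by (rule quadratic_with_discriminant_reduced[of x \<tau> 31]) auto
  have "a < 4"
  proof (rule ccontr)
    assume "\<not> ?thesis"
    then have "4 ^ 2 \<le> a ^ 2" by (intro power_mono) auto
    then show False using reduced_form_bound[OF *(1-4)] by simp
  qed
  then consider "a = 1" | "a = 2" | "a = 3" using *(1) by linarith
  then show ?thesis
  proof cases
    case 1
    then have "b = -1 \<or> b = 0 \<or> b = 1" using *(3) by linarith
    moreover have "form_j 31 1 (- 1) = form_j 31 1 1" using form_j_add[of 31 1 "- 1"] by simp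
    ultimately show ?thesis using *(2,5) 1 by auto presburger
  next
    case 2
    then have "b = -2 \<or> b = -1 \<or> b = 0 \<or> b = 1 \<or> b = 2" using *(3) by linarith
    then show ?thesis using *(2,5) 2 by auto presburger+
  next
    case 3
    then have "- 3 \<le> b" "b \<le> 3" using *(3) by linarith+
    then have "b = -3 \<or> b = -2 \<or> b = -1 \<or> b = 0 \<or> b = 1 \<or> b = 2 \<or> b = 3" by presburger
    then show ?thesis using *(2,5) 3 by auto presburger+
  qed
qed

text \<open>The forms \<open>(2, b, 12)\<close> and \<open>(4, b, 6)\<close> with
  \<open>b = 2\<close> or \<open>b = - 2\<close> also meet the size conditions. They are doubles of
  forms of discriminant \<open>-23\<close>, and \<open>par\<close> discards them.\<close>

lemma singular_modulus_92:
  assumes "is_singular_modulus_at x \<tau> (- 92)"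
  shows "x \<in> {form_j 92 1 0, form_j 92 3 2, form_j 92 3 (- 2)}"
proof -
  from assms obtain a b c :: int where *: "a > 0" "b ^ 2 + 92 = 4 * a * c" "\<bar>b\<bar> \<le> a" "a \<le> c"
    "x = form_j 92 a b" and par: "odd a \<or> odd b \<or> odd c"
    by (rule quadratic_with_discriminant_reduced[of x \<tau> 92]) auto
  have "a < 6"
  proof (rule ccontr)
    assume "\<not> ?thesis"
    then have "6 ^ 2 \<le> a ^ 2" by (intro power_mono) auto
    then show False using reduced_form_bound[OF *(1-4)] by simp
  qed
  then consider "a = 1" | "a = 2" | "a = 3" | "a = 4" | "a = 5" using *(1) by linarith
  then show ?thesis
  proof cases
    case 1
    then have "b = -1 \<or> b = 0 \<or> b = 1" using *(3) by linarith
    then show ?thesis using *(2,5) 1 by auto presburger+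
  next
    case 2
    then have "b = -2 \<or> b = -1 \<or> b = 0 \<or> b = 1 \<or> b = 2" using *(3) by linarith
    then show ?thesis using *(2,5) 2 par by auto presburger+
  next
    case 3
    then have "- 3 \<le> b" "b \<le> 3" using *(3) by linarith+
    then have "b = -3 \<or> b = -2 \<or> b = -1 \<or> b = 0 \<or> b = 1 \<or> b = 2 \<or> b = 3" by presburger
    then show ?thesis using *(2,5) 3 by auto presburger+
  next
    case 4
    then have "- 4 \<le> b" "b \<le> 4" using *(3) by linarith+
    then have "b = -4 \<or> b = -3 \<or> b = -2 \<or> b = -1 \<or> b = 0 \<or> b = 1 \<or> b = 2 \<or> b = 3 \<or> b = 4" by presburger
    then show ?thesis using *(2,5) 4 par by auto presburger+
  next
    case 5
    then have "- 5 \<le> b" "b \<le> 5" using *(3) by linarith+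
    then have "b = -5 \<or> b = -4 \<or> b = -3 \<or> b = -2 \<or> b = -1 \<or> b = 0 \<or> b = 1 \<or> b = 2 \<or> b = 3 \<or> b = 4 \<or> b = 5" by presburger
    then show ?thesis using *(2,5) 5 by auto presburger+
  qed
qed

text \<open>Here \<open>par\<close> discards \<open>(2, b, 16)\<close> and \<open>(4, b, 8)\<close>
  with \<open>b = 2\<close> or \<open>b = - 2\<close>, the doubles of forms of discriminant
  \<open>-31\<close>.\<close>

lemma singular_modulus_124:
  assumes "is_singular_modulus_at x \<tau> (- 124)"
  shows "x \<in> {form_j 124 1 0, form_j 124 5 4, form_j 124 5 (- 4)}"
proof -
  from assms obtain a b c :: int where *: "a > 0" "b ^ 2 + 124 = 4 * a * c" "\<bar>b\<bar> \<le> a" "a \<le> c"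
    "x = form_j 124 a b" and par: "odd a \<or> odd b \<or> odd c"
    by (rule quadratic_with_discriminant_reduced[of x \<tau> 124]) auto
  have "a < 7"
  proof (rule ccontr)
    assume "\<not> ?thesis"
    then have "7 ^ 2 \<le> a ^ 2" by (intro power_mono) auto
    then show False using reduced_form_bound[OF *(1-4)] by simp
  qed
  then consider "a = 1" | "a = 2" | "a = 3" | "a = 4" | "a = 5" | "a = 6" using *(1) by linarith
  then show ?thesis
  proof cases
    case 1
    then have "b = -1 \<or> b = 0 \<or> b = 1" using *(3) by linarith
    then show ?thesis using *(2,5) 1 by auto presburger+
  next
    case 2
    then have "b = -2 \<or> b = -1 \<or> b = 0 \<or> b = 1 \<or> b = 2" using *(3) by linarith
    then show ?thesis using *(2,5) 2 par by auto presburger+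
  next
    case 3
    then have "- 3 \<le> b" "b \<le> 3" using *(3) by linarith+
    then have "b = -3 \<or> b = -2 \<or> b = -1 \<or> b = 0 \<or> b = 1 \<or> b = 2 \<or> b = 3" by presburger
    then show ?thesis using *(2,5) 3 by auto presburger+
  next
    case 4
    then have "- 4 \<le> b" "b \<le> 4" using *(3) by linarith+
    then have "b = -4 \<or> b = -3 \<or> b = -2 \<or> b = -1 \<or> b = 0 \<or> b = 1 \<or> b = 2 \<or> b = 3 \<or> b = 4" by presburger
    then show ?thesis using *(2,5) 4 par by auto presburger+
  next
    case 5
    then have "- 5 \<le> b" "b \<le> 5" using *(3) by linarith+
    then have "b = -5 \<or> b = -4 \<or> b = -3 \<or> b = -2 \<or> b = -1 \<or> b = 0 \<or> b = 1 \<or> b = 2 \<or> b = 3 \<or> b = 4 \<or> b = 5" by presburger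
    then show ?thesis using *(2,5) 5 by auto presburger+
  next
    case 6
    then have "- 6 \<le> b" "b \<le> 6" using *(3) by linarith+
    then have "b = -6 \<or> b = -5 \<or> b = -4 \<or> b = -3 \<or> b = -2 \<or> b = -1 \<or> b = 0 \<or> b = 1 \<or> b = 2 \<or> b = 3 \<or> b = 4
      \<or> b = 5 \<or> b = 6" by presburger
    then show ?thesis using *(2,5) 6 by auto presburger+
  qed
qed

text \<open>The neighbours of the principal form: halving the root leads to \<open>(2, 1)\<close>
  and \<open>(2, - 1)\<close>, doubling it to the principal form of discriminant
  \<open>- 4 D\<close>, after a translation of \<open>b = 2\<close> to \<open>b = 0\<close>. The
  last clause recognises the doubled principal form, met again when the root of
  \<open>(2, 1)\<close> is doubled.\<close>

lemma principal_form_isogenies: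
  assumes "D > 16"
  shows "form_j D 1 1 \<noteq> form_j D 2 1" "form_j D 1 1 \<noteq> form_j D 2 (- 1)" "form_j D 2 1 \<noteq> form_j D 2 (- 1)"
    "cnj (form_j D 1 1) = form_j D 1 1" "cnj (form_j D 2 1) = form_j D 2 (- 1)"
    "Phi2 (form_j D 1 1) (form_j D 2 1) = 0" "Phi2 (form_j D 1 1) (form_j D 2 (- 1)) = 0"
    "form_j (4 * D) 1 0 = form_j D 1 1 ^ 2 - 1488 * form_j D 1 1 + 162000 - form_j D 2 1 - form_j D 2 (- 1)"
    "form_j (4 * D) 2 2 = form_j D 1 1"
proof -
  have D: "D > 0" using assms by simp
  show "form_j D 1 1 \<noteq> form_j D 2 1" "form_j D 1 1 \<noteq> form_j D 2 (- 1)" "form_j D 2 1 \<noteq> form_j D 2 (- 1)"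
    using form_j_distinct[of D] assms by auto
  show "cnj (form_j D 1 1) = form_j D 1 1"
    using form_j_cnj[of D 1 1] form_j_add[of D 1 "- 1"] D by simp
  show "cnj (form_j D 2 1) = form_j D 2 (- 1)"
    using form_j_cnj[of D 2 1] D by simp
  show "Phi2 (form_j D 1 1) (form_j D 2 1) = 0" "Phi2 (form_j D 1 1) (form_j D 2 (- 1)) = 0"
    using form_j_two_isogeny(2,3)[of D 1 1] D by simp_all
  have "form_j (4 * D) 1 2 = form_j (4 * D) 1 0"
    using form_j_add[of "4 * D" 1 0] D by simp
  then show "form_j (4 * D) 1 0 = form_j D 1 1 ^ 2 - 1488 * form_j D 1 1 + 162000 - form_j D 2 1 - form_j D 2 (- 1)"
    using form_j_two_isogeny(4)[of D 1 1] D by (simp add: algebra_simps)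
  show "form_j (4 * D) 2 2 = form_j D 1 1"
    using form_j_double[of 1 D 1] by simp
qed

text \<open>Halving the root of \<open>(2, 1, 3)\<close> leads to leading coefficient 4 with
  \<open>b = 1\<close> or \<open>b = - 3\<close>. Since 23 is 7 modulo 16,
  \<open>(4, - 3, 2)\<close> is integral and equivalent to \<open>(2, - 1, 3)\<close>, while
  \<open>b = 1\<close> needs doubling and gives \<open>(8, 2, 3)\<close> of discriminant
  \<open>-92\<close>.\<close>

lemma isogeny_triangle_23:
  "Phi2 (form_j 23 2 1) (form_j 23 2 (- 1)) = 0"
  "form_j 92 3 (- 2) = form_j 23 2 1 ^ 2 - 1488 * form_j 23 2 1 + 162000 - form_j 23 1 1 - form_j 23 2 (- 1)"
proof -
  have 1: "form_j 23 4 (- 3) = form_j 23 2 (- 1)"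
    using form_j_swap[of 23 4 "- 3" 2] form_j_add[of 23 2 "- 1"] by simp
  have 2: "form_j 23 4 1 = form_j 92 3 (- 2)"
    using form_j_double[of 4 23 1] form_j_swap[of 92 8 2 3] by simp
  show "Phi2 (form_j 23 2 1) (form_j 23 2 (- 1)) = 0"
    using form_j_two_isogeny(3)[of 23 2 1] 1 by simp
  show "form_j 92 3 (- 2) = form_j 23 2 1 ^ 2 - 1488 * form_j 23 2 1 + 162000 - form_j 23 1 1 - form_j 23 2 (- 1)"
    using form_j_two_isogeny(4)[of 23 2 1] principal_form_isogenies(9)[of 23] 1 2
    by (simp add: algebra_simps)
qed

text \<open>As 31 is 15 modulo 16, the two values of \<open>b\<close> change roles:
  \<open>(4, 1, 2)\<close> is integral, and \<open>b = - 3\<close> doubles to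
  \<open>(8, - 6, 5)\<close> of discriminant \<open>-124\<close>.\<close>

lemma isogeny_triangle_31:
  "Phi2 (form_j 31 2 1) (form_j 31 2 (- 1)) = 0"
  "form_j 124 5 (- 4) = form_j 31 2 1 ^ 2 - 1488 * form_j 31 2 1 + 162000 - form_j 31 1 1 - form_j 31 2 (- 1)"
proof -
  have 1: "form_j 31 4 1 = form_j 31 2 (- 1)"
    using form_j_swap[of 31 4 1 2] by simp
  have 2: "form_j 31 4 (- 3) = form_j 124 5 (- 4)"
    using form_j_double[of 4 31 "- 3"] form_j_swap[of 124 8 "- 6" 5] form_j_add[of 124 5 "- 4"] by simp
  show "Phi2 (form_j 31 2 1) (form_j 31 2 (- 1)) = 0"
    using form_j_two_isogeny(2)[of 31 2 1] 1 by simp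
  show "form_j 124 5 (- 4) = form_j 31 2 1 ^ 2 - 1488 * form_j 31 2 1 + 162000 - form_j 31 1 1 - form_j 31 2 (- 1)"
    using form_j_two_isogeny(4)[of 31 2 1] principal_form_isogenies(9)[of 31] 1 2
    by (simp add: algebra_simps)
qed

text \<open>Each candidate for \<open>y\<close> is the third isogenous value over one of the three
  roots: the principal one over the real root, \<open>w\<close> over \<open>form_j D 2 1\<close>,
  and \<open>cnj w\<close> over its conjugate.\<close>

lemma singular_moduli_independent:
  fixes D :: real and w :: complex
  assumes D: "D > 16" and Phi: "Phi2 (form_j D 2 1) (form_j D 2 (- 1)) = 0"
    and w: "w = form_j D 2 1 ^ 2 - 1488 * form_j D 2 1 + 162000 - form_j D 1 1 - form_j D 2 (- 1)"
    and x: "x \<in> {form_j D 1 1, form_j D 2 1, form_j D 2 (- 1)}"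
    and y: "y \<in> {form_j (4 * D) 1 0, w, cnj w}" and pos: "m > 0" "n > 0"
    and rel: "of_int A + of_int B * x ^ m + of_int C * y ^ n = 0"
  shows "A = 0 \<and> B = 0 \<and> C = 0"
proof -
  note iso = principal_form_isogenies[OF D]
  let ?S = "{form_j D 1 1, form_j D 2 1, form_j D 2 (- 1)}"
  have "cnj (form_j D 2 (- 1)) = form_j D 2 1" unfolding iso(5)[symmetric] by simp
  then have w': "cnj w = form_j D 2 (- 1) ^ 2 - 1488 * form_j D 2 (- 1) + 162000 - form_j D 1 1 - form_j D 2 1"
    unfolding w by (simp add: iso(4,5))
  have "\<exists>x'\<in>?S. y = x' ^ 2 - 1487 * x' + 162000 - (form_j D 1 1 + form_j D 2 1 + form_j D 2 (- 1))"
    using y unfolding w' unfolding w iso(8) by (auto simp: algebra_simps)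
  then obtain x' where x': "x' \<in> ?S"
    "y = x' ^ 2 - 1487 * x' + 162000 - (form_j D 1 1 + form_j D 2 1 + form_j D 2 (- 1))" by blast
  show ?thesis
    by (rule two_isogeny_triangle_independent[OF iso(6,7) Phi iso(1-3) iso(4,5) pos x x'(1)])
       (use rel in \<open>simp only: x'(2)\<close>)
qed

lemma singular_moduli_independent_ordered:
  assumes "is_singular_modulus_at x \<tau> (- 23) \<and> is_singular_modulus_at y \<tau>' (- 92) \<or>
      is_singular_modulus_at x \<tau> (- 31) \<and> is_singular_modulus_at y \<tau>' (- 124)"
    and pos: "m > 0" "n > 0"
    and rel: "of_int A + of_int B * x ^ m + of_int C * y ^ n = 0"
  shows "A = 0 \<and> B = 0 \<and> C = 0"
  using assms(1)
proof
  assume *: "is_singular_modulus_at x \<tau> (- 23) \<and> is_singular_modulus_at y \<tau>' (- 92)"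
  have x: "x \<in> {form_j 23 1 1, form_j 23 2 1, form_j 23 2 (- 1)}"
    by (rule singular_modulus_23) (use * in blast)
  have "y \<in> {form_j 92 1 0, form_j 92 3 2, form_j 92 3 (- 2)}"
    by (rule singular_modulus_92) (use * in blast)
  then have y: "y \<in> {form_j (4 * 23) 1 0, form_j 92 3 (- 2), cnj (form_j 92 3 (- 2))}"
    using form_j_cnj[of 92 3 "- 2"] by auto
  show ?thesis
    by (rule singular_moduli_independent[OF _ isogeny_triangle_23 x y pos rel]) simp
next
  assume *: "is_singular_modulus_at x \<tau> (- 31) \<and> is_singular_modulus_at y \<tau>' (- 124)"
  have x: "x \<in> {form_j 31 1 1, form_j 31 2 1, form_j 31 2 (- 1)}"
    by (rule singular_modulus_31) (use * in blast)
  have "y \<in> {form_j 124 1 0, form_j 124 5 4, form_j 124 5 (- 4)}"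
    by (rule singular_modulus_124) (use * in blast)
  then have y: "y \<in> {form_j (4 * 31) 1 0, form_j 124 5 (- 4), cnj (form_j 124 5 (- 4))}"
    using form_j_cnj[of 124 5 "- 4"] by auto
  show ?thesis
    by (rule singular_moduli_independent[OF _ isogeny_triangle_31 x y pos rel]) simp
qed

theorem theorem1p2:
  fixes x y \<tau> \<tau>' :: complex and \<Delta> \<Delta>' :: int and m n :: nat
  assumes "is_singular_modulus_at x \<tau> \<Delta>"
    and "is_singular_modulus_at y \<tau>' \<Delta>'"
    and "m > 0" and "n > 0"
    and "{\<Delta>, \<Delta>'} = {- 4 * 23, - 23} \<or> {\<Delta>, \<Delta>'} = {- 4 * 31, - 31}"
  shows "rat_lin_independent [1, x ^ m, y ^ n]"
proof (rule rat_lin_independentI)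
  fix A B C :: int
  assume rel: "of_int A + of_int B * x ^ m + of_int C * y ^ n = 0"
  \<comment> \<open>If \<open>y\<close> carries the odd discriminant, the two powers exchange their
    roles along with their exponents and coefficients.\<close>
  then have rel': "of_int A + of_int C * y ^ n + of_int B * x ^ m = 0" by (simp add: add_ac)
  from assms(5) consider "\<Delta> = - 23 \<and> \<Delta>' = - 92 \<or> \<Delta> = - 31 \<and> \<Delta>' = - 124"
    | "\<Delta>' = - 23 \<and> \<Delta> = - 92 \<or> \<Delta>' = - 31 \<and> \<Delta> = - 124"
    by (auto simp: doubleton_eq_iff)
  then show "A = 0 \<and> B = 0 \<and> C = 0"
  proof cases
    case 1
    show ?thesis
      by (rule singular_moduli_independent_ordered[OF _ assms(3,4) rel]) (use 1 assms(1,2) in blast)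
  next
    case 2
    have "A = 0 \<and> C = 0 \<and> B = 0"
      by (rule singular_moduli_independent_ordered[OF _ assms(4,3) rel']) (use 2 assms(1,2) in blast)
    then show ?thesis by blast
  qed
qed

end
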